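(* Let $\Gamma$ be a connected metric graph of genus $g\geq 2$ and let $q \in \Gamma$. If the set $\iota_q(\Gamma)\cap \mathrm{Jac}(\Gamma)_{\mathrm{tors}}$ is finite, then $$\#\big(\iota_q(\Gamma)\cap \mathrm{Jac}(\Gamma)_{\mathrm{tors}}\big) \leq 3g-3.$$
   Context: A metric graph $\Gamma=(G,\ell)$ is the compact connected metric space obtained from a finite connected graph $G$ (loops and multiple edges allowed) with edge lengths $\ell:E(G)\to\mathbb{R}_{>0}$ by identifying each edge $e$ with a closed interval $[0,\ell(e)]$ and taking the path metric; $(G,\ell)$ is then called a model of $\Gamma$ (a metric graph has many models). The genus of $\Gamma$ is $g=\dim H_1(\Gamma,\mathbb{R})=\#E(G)-\#V(G)+1$. $\mathrm{Div}(\Gamma)$ is the free abelian group on the points of $\Gamma$, $\deg$ is the sum of coefficients, and $\mathrm{Div}^0(\Gamma)=\ker(\deg)$. $\mathrm{PL}_{\mathbb{Z}}(\Gamma)$ is the set of continuous functions $f:\Gamma\to\mathbb{R}$ that are linear with integer slope (with respect to arc length) on each edge of some model of $\Gamma$. For such $f$, $\Delta(f)=-\sum_{x\in\Gamma}a_x\,x$, where $a_x$ is the sum of the outgoing slopes of $f$ at $x$. The Jacobian is $\mathrm{Jac}(\Gamma)=\mathrm{Div}^0(\Gamma)/\Delta(\mathrm{PL}_{\mathbb{Z}}(\Gamma))$, and $\mathrm{Jac}(\Gamma)_{\mathrm{tors}}$ is its torsion subgroup. The class of a divisor $D$ is denoted $[D]$. The Abel--Jacobi map with basepoint $q$ is $\iota_q:\Gamma\to\mathrm{Jac}(\Gamma)$,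 $\iota_q(x)=[x-q]$. *)

theory Defs
  imports
    "HOL-Analysis.Analysis"
    "HOL-Algebra.Coset"
    "HOL-Algebra.Free_Abelian_Groups"
    "Graph_Theory.Digraph_Component"
begin

section \<open>Metric graphs\<close>

text \<open>
  Finite undirected multigraphs (loops and multiple edges allowed) are represented by
  finite directed multigraphs. The orientation of an arc \<open>e\<close> records which end of the
  interval \<open>[0, len e]\<close> is glued to which end vertex. It has no other significance:
  \<open>Digraph_Component.connected\<close> is connectedness of the underlying undirected graph.
  The vertices are taken to be points of the metric space, and \<open>\<gamma> e t\<close> is the point at
  arc length \<open>t\<close> along the edge \<open>e\<close>.
\<close>

text \<open>
  \<open>edge_path G len \<gamma> x r y\<close>: there is a path of length \<open>r\<close> from \<open>x\<close> to \<open>y\<close> which is a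
  concatenation of finitely many segments of edges.
\<close>
inductive edge_path ::
    "('a, 'e) pre_digraph \<Rightarrow> ('e \<Rightarrow> real) \<Rightarrow> ('e \<Rightarrow> real \<Rightarrow> 'a) \<Rightarrow> 'a \<Rightarrow> real \<Rightarrow> 'a \<Rightarrow> bool"
  for G len \<gamma> x where
  refl: "edge_path G len \<gamma> x 0 x"
| step: "edge_path G len \<gamma> x (r + \<bar>t - s\<bar>) (\<gamma> e t)"
    if "edge_path G len \<gamma> x r (\<gamma> e s)" "e \<in> arcs G" "s \<in> {0..len e}" "t \<in> {0..len e}"

text \<open>
  \<open>(G, len)\<close> is a model of the metric graph \<open>\<Gamma>\<close>: the maps \<open>\<gamma> e\<close> exhibit the point set of \<open>\<Gamma>\<close>
  as the quotient of \<open>verts G\<close> and the intervals \<open>[0, len e]\<close> by the identification of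
  their end points with the end vertices, and the metric of \<open>\<Gamma>\<close> is the path metric.
\<close>
locale metric_graph_model = fin_digraph G
  for \<Gamma> :: "'a metric" and G :: "('a, 'e) pre_digraph"
    and len :: "'e \<Rightarrow> real" and \<gamma> :: "'e \<Rightarrow> real \<Rightarrow> 'a" +
  assumes connected: "Digraph_Component.connected G"
    and len_pos: "e \<in> arcs G \<Longrightarrow> 0 < len e"
    and verts_subset: "verts G \<subseteq> mspace \<Gamma>"
    and chart_tail: "e \<in> arcs G \<Longrightarrow> \<gamma> e 0 = tail G e"
    and chart_head: "e \<in> arcs G \<Longrightarrow> \<gamma> e (len e) = head G e"
    and chart_interior:
      "bij_betw (\<lambda>(e, t). \<gamma> e t) (SIGMA e:arcs G. {0<..<len e}) (mspace \<Gamma> - verts G)"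
    and path_metric:
      "\<lbrakk>x \<in> mspace \<Gamma>; y \<in> mspace \<Gamma>\<rbrakk> \<Longrightarrow> mdist \<Gamma> x y = Inf {r. edge_path G len \<gamma> x r y}"

text \<open>
  Genus of the metric graph, computed from a model. It is \<open>int\<close>-valued to avoid truncated
  subtraction.
\<close>
definition genus :: "('a, 'e) pre_digraph \<Rightarrow> int" where
  "genus G = int (card (arcs G)) - int (card (verts G)) + 1"


section \<open>Piecewise linear functions with integer slopes\<close>

text \<open>\<open>m e\<close> is the slope of \<open>f\<close> along the edge \<open>e\<close>, traversed from tail to head.\<close>
definition linear_on_edges ::
    "('a, 'e) pre_digraph \<Rightarrow> ('e \<Rightarrow> real) \<Rightarrow> ('e \<Rightarrow> real \<Rightarrow> 'a) \<Rightarrow> ('a \<Rightarrow> real) \<Rightarrow> ('e \<Rightarrow> int) \<Rightarrow> bool"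
where
  "linear_on_edges G len \<gamma> f m \<longleftrightarrow>
     (\<forall>e\<in>arcs G. \<forall>t\<in>{0..len e}. f (\<gamma> e t) = f (\<gamma> e 0) + of_int (m e) * t)"

text \<open>
  Quantification over all models of \<open>\<Gamma>\<close>: since a model has finitely many edges, they can be
  assumed to be labelled by natural numbers.
\<close>
definition PL_int :: "'a metric \<Rightarrow> ('a \<Rightarrow> real) set" where
  "PL_int \<Gamma> = {f. continuous_map (mtopology_of \<Gamma>) euclideanreal f \<and>
     (\<exists>(G :: ('a, nat) pre_digraph) len \<gamma> m.
        metric_graph_model \<Gamma> G len \<gamma> \<and> linear_on_edges G len \<gamma> f m)}"

text \<open>
  The sum of the outgoing slopes of \<open>f\<close> at \<open>x\<close>, read off from any model on whose edges \<open>f\<close>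
  is linear; the value does not depend on that model. An edge with tail \<open>x\<close> leaves \<open>x\<close> with
  slope \<open>m e\<close> and an edge with head \<open>x\<close> leaves \<open>x\<close> with slope \<open>- m e\<close>. If \<open>x\<close> is not a
  vertex of the model, both sums are empty and the value is 0, in agreement with the two
  opposite outgoing slopes at an interior point of an edge.
\<close>
definition outgoing_slope_sum :: "'a metric \<Rightarrow> ('a \<Rightarrow> real) \<Rightarrow> 'a \<Rightarrow> int" where
  "outgoing_slope_sum \<Gamma> f x = (THE a. \<exists>(G :: ('a, nat) pre_digraph) len \<gamma> m.
     metric_graph_model \<Gamma> G len \<gamma> \<and> linear_on_edges G len \<gamma> f m \<and>
     a = (\<Sum>e\<in>out_arcs G x. m e) + (\<Sum>e\<in>in_arcs G x. - m e))"

definition Laplacian :: "'a metric \<Rightarrow> ('a \<Rightarrow> real) \<Rightarrow> 'a \<Rightarrow>\<^sub>0 int" where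
  "Laplacian \<Gamma> f =
     - (\<Sum>x\<in>{x \<in> mspace \<Gamma>. outgoing_slope_sum \<Gamma> f x \<noteq> 0}.
          frag_cmul (outgoing_slope_sum \<Gamma> f x) (frag_of x))"


section \<open>Divisors and the Jacobian\<close>

definition Div :: "'a metric \<Rightarrow> ('a \<Rightarrow>\<^sub>0 int) monoid" where
  "Div \<Gamma> = free_Abelian_group (mspace \<Gamma>)"

definition divisor_degree :: "('a \<Rightarrow>\<^sub>0 int) \<Rightarrow> int" where
  "divisor_degree D = (\<Sum>x\<in>Poly_Mapping.keys D. Poly_Mapping.lookup D x)"

definition Div0 :: "'a metric \<Rightarrow> ('a \<Rightarrow>\<^sub>0 int) monoid" where
  "Div0 \<Gamma> = (Div \<Gamma>)\<lparr>carrier := {D \<in> carrier (Div \<Gamma>). divisor_degree D = 0}\<rparr>"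

definition Jac :: "'a metric \<Rightarrow> ('a \<Rightarrow>\<^sub>0 int) set monoid" where
  "Jac \<Gamma> = Div0 \<Gamma> Mod (Laplacian \<Gamma> ` PL_int \<Gamma>)"

definition divisor_class :: "'a metric \<Rightarrow> ('a \<Rightarrow>\<^sub>0 int) \<Rightarrow> ('a \<Rightarrow>\<^sub>0 int) set" where
  "divisor_class \<Gamma> D = (Laplacian \<Gamma> ` PL_int \<Gamma>) #>\<^bsub>Div0 \<Gamma>\<^esub> D"

definition Abel_Jacobi :: "'a metric \<Rightarrow> 'a \<Rightarrow> 'a \<Rightarrow> ('a \<Rightarrow>\<^sub>0 int) set" where
  "Abel_Jacobi \<Gamma> q x = divisor_class \<Gamma> (frag_of x - frag_of q)"

definition torsion_elements :: "('a, 'b) monoid_scheme \<Rightarrow> 'a set" where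
  "torsion_elements A = {a \<in> carrier A. \<exists>n::nat. 0 < n \<and> a [^]\<^bsub>A\<^esub> n = \<one>\<^bsub>A\<^esub>}"

end

theory Submission
  imports Defs
begin

text \<open>
  A tent function on a piece of an edge is piecewise linear, so in the Jacobian the points of
  an edge \<open>e\<close> satisfy \<open>[\<gamma> e t] = [\<gamma> e 0] + \<psi> e t\<close> for an additive map \<open>\<psi> e\<close> on the reals, and a
  tent function around a vertex shows that the maps of the half-edges at that vertex sum to zero.
  Hence \<open>\<psi> e = 0\<close> at a leaf, and at a vertex of degree two the two maps agree along the path, so
  that leaves can be deleted and vertices of degree two smoothed. What remains has all degrees at
  least three and therefore at most \<open>3 g - 3\<close> edges. Each of them carries at most one torsion
  class: given two, all rational points between them are torsion, hence represent finitely many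
  classes, and an additive map from the rationals with finite image is zero.
\<close>


section \<open>Curves modulo a subgroup\<close>

text \<open>The reductions are not carried out on \<Gamma> itself: removing a leaf would change the
  points, the divisors and the Jacobian. The subgroup \<open>H\<close> of principal divisors and its
  ambient group stay fixed, and only a combinatorial record of curves in that group is reduced; for
  the same reason all identities are congruences modulo \<open>H\<close> and no quotient is formed
  until the end. The constant arises as follows: both reductions remove one vertex and one edge, so
  they preserve \<open>card E - card V\<close>, which is \<open>g - 1\<close>; once all degrees are
  at least three, \<open>3 * card V \<le> 2 * card E\<close>, that is,
  \<open>card E \<le> 3 * (card E - card V)\<close>. Genus at least two excludes a point and a
  circle, where the reductions would get stuck. The other obstacle is that each piecewise linear
  function brings its own model. Slopes and sums are therefore treated through the metric alone, by
  distances and small spheres.\<close>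

locale additive_subgroup =
  fixes H :: "'p :: ab_group_add set"
  assumes zero_mem: "0 \<in> H"
    and diff_mem: "a \<in> H \<Longrightarrow> b \<in> H \<Longrightarrow> a - b \<in> H"
begin

lemma minus_mem: "a \<in> H \<Longrightarrow> - a \<in> H"
  using diff_mem[OF zero_mem] by fastforce

lemma add_mem: "a \<in> H \<Longrightarrow> b \<in> H \<Longrightarrow> a + b \<in> H"
  using diff_mem[OF _ minus_mem] by fastforce

lemma mem_of_diff_mem: "a \<in> H \<Longrightarrow> a - b \<in> H \<Longrightarrow> b \<in> H"
  using diff_mem[of a "a - b"] by simp

lemma sum_mem: "(\<And>i. i \<in> I \<Longrightarrow> f i \<in> H) \<Longrightarrow> sum f I \<in> H"
  by (induction I rule: infinite_finite_induct) (auto intro: add_mem zero_mem)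

lemma add_cancel_mem: "b \<in> H \<Longrightarrow> a + b \<in> H \<longleftrightarrow> a \<in> H"
  using add_mem diff_mem[of "a + b" b] by auto

text \<open>A representative, as a bare function, of a homomorphism from the reals to the quotient
  by \<open>H\<close>.\<close>

definition hom_mod :: "(real \<Rightarrow> 'p) \<Rightarrow> bool" where
  "hom_mod \<psi> \<longleftrightarrow> (\<forall>s t. \<psi> (s + t) - \<psi> s - \<psi> t \<in> H)"

lemma hom_modD: "hom_mod \<psi> \<Longrightarrow> \<psi> (s + t) - \<psi> s - \<psi> t \<in> H"
  by (simp add: hom_mod_def)

lemma hom_mod_zero: "hom_mod \<psi> \<Longrightarrow> \<psi> 0 \<in> H"
  using hom_modD[of \<psi> 0 0] minus_mem by fastforce

lemma hom_mod_diff: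
  assumes "hom_mod \<psi>" shows "\<psi> (s - t) - \<psi> s + \<psi> t \<in> H"
  using minus_mem[OF hom_modD[OF assms, of "s - t" t]] by (simp add: algebra_simps)

lemma hom_mod_minus:
  assumes "hom_mod \<psi>" shows "\<psi> (- t) + \<psi> t \<in> H"
  using add_mem[OF hom_mod_diff[OF assms, of 0 t] hom_mod_zero[OF assms]] by (simp add: algebra_simps)

lemma hom_mod_uminus: "hom_mod \<psi> \<Longrightarrow> hom_mod (\<lambda>t. - \<psi> t)"
  using minus_mem by (fastforce simp: hom_mod_def algebra_simps)

lemma hom_mod_sum:
  assumes "\<And>i. i \<in> I \<Longrightarrow> hom_mod (\<psi> i)" shows "hom_mod (\<lambda>t. \<Sum>i\<in>I. \<psi> i t)"
  unfolding hom_mod_def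
proof (intro allI)
  fix s t
  have "(\<Sum>i\<in>I. \<psi> i (s + t) - \<psi> i s - \<psi> i t) \<in> H"
    using assms by (intro sum_mem hom_modD)
  then show "(\<Sum>i\<in>I. \<psi> i (s + t)) - (\<Sum>i\<in>I. \<psi> i s) - (\<Sum>i\<in>I. \<psi> i t) \<in> H"
    by (simp add: sum_subtractf)
qed

lemma hom_mod_multiple:
  assumes "hom_mod \<psi>" "\<psi> s \<in> H" shows "\<psi> (real n * s) \<in> H"
proof (induction n)
  case 0 show ?case using hom_mod_zero[OF assms(1)] by simp
next
  case (Suc n)
  have "\<psi> (real n * s + s) - \<psi> (real n * s) - \<psi> s \<in> H" by (rule hom_modD[OF assms(1)])
  from add_mem[OF add_mem[OF this Suc] assms(2)] show ?case by (simp add: algebra_simps)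
qed

text \<open>Every positive real is a natural multiple of one below \<open>\<delta>\<close>.
  Relations seen only on short segments around a vertex thus extend to all reals.\<close>

lemma hom_mod_trivial:
  assumes hom: "hom_mod \<psi>" and "\<delta> > 0" and small: "\<And>t. 0 < t \<Longrightarrow> t < \<delta> \<Longrightarrow> \<psi> t \<in> H"
  shows "\<psi> t \<in> H"
proof -
  have pos: "\<psi> t \<in> H" if "t > 0" for t
  proof -
    obtain n :: nat where "t / \<delta> < real n" using reals_Archimedean2 by blast
    moreover have "0 < t / \<delta>" using that \<open>\<delta> > 0\<close> by simp
    ultimately have "real n > 0" by linarith
    then have "n > 0" "t / real n < \<delta>" using \<open>t / \<delta> < real n\<close> \<open>\<delta> > 0\<close>
      by (simp_all add: pos_divide_less_eq mult.commute)
    then show ?thesis using hom_mod_multiple[OF hom small, of "t / n" n] that by simp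
  qed
  consider "t > 0" | "t = 0" | "t < 0" by linarith
  then show ?thesis
  proof cases
    case 3
    then have "\<psi> (- t) \<in> H" using pos by simp
    then show ?thesis using hom_mod_minus[OF hom, of t] add_cancel_mem[of "\<psi> (- t)" "\<psi> t"]
      by (simp add: add.commute)
  qed (use pos hom_mod_zero[OF hom] in auto)
qed

text \<open>The set is saturated modulo \<open>H\<close>: it contains every representative of each
  class on the curve, so that curves can be compared and united as plain sets although their
  parametrizations agree only modulo \<open>H\<close>.\<close>

definition curve :: "'p \<Rightarrow> (real \<Rightarrow> 'p) \<Rightarrow> real \<Rightarrow> 'p set" where
  "curve p \<psi> L = {x. \<exists>t\<in>{0..L}. x - p - \<psi> t \<in> H}"

lemma curve_mem_cong:
  assumes "x - y \<in> H" "y \<in> curve p \<psi> L" shows "x \<in> curve p \<psi> L"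
proof -
  obtain t where "t \<in> {0..L}" "y - p - \<psi> t \<in> H" using assms(2) by (auto simp: curve_def)
  moreover from add_mem[OF assms(1) this(2)] have "x - p - \<psi> t \<in> H" by (simp add: algebra_simps)
  ultimately show ?thesis by (auto simp: curve_def)
qed

text \<open>Substitution of \<open>L - t\<close> for \<open>t\<close>. Applied in both directions,
  it shows that the curve of an edge does not depend on the end from which it is
  parametrized.\<close>

lemma curve_subset_reverse:
  assumes "hom_mod \<psi>" "p' - p - \<psi> L \<in> H" "\<And>t. \<psi>' t + \<psi> t \<in> H"
  shows "curve p \<psi> L \<subseteq> curve p' \<psi>' L"
proof
  fix x assume "x \<in> curve p \<psi> L"
  then obtain t where t: "t \<in> {0..L}" "x - p - \<psi> t \<in> H" by (auto simp: curve_def)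
  from diff_mem[OF diff_mem[OF add_mem[OF t(2) hom_mod_diff[OF assms(1), of L t]] assms(2)] assms(3)[of "L - t"]]
  have "x - p' - \<psi>' (L - t) \<in> H" by (simp add: algebra_simps)
  then show "x \<in> curve p' \<psi>' L" using t(1) by (auto simp: curve_def intro!: bexI[of _ "L - t"])
qed

text \<open>The curve is split at the parameter \<open>L\<close>; by additivity the value
  \<open>\<psi> L\<close> is absorbed in the new starting point \<open>p'\<close>.\<close>

lemma curve_append:
  assumes "hom_mod \<psi>" "p' - p - \<psi> L \<in> H" "\<And>t. \<psi>' t - \<psi> t \<in> H" "0 \<le> L" "0 \<le> L'"
  shows "curve p \<psi> (L + L') = curve p \<psi> L \<union> curve p' \<psi>' L'"
proof (intro Set.set_eqI iffI)
  fix x assume "x \<in> curve p \<psi> (L + L')"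
  then obtain t where t: "0 \<le> t" "t \<le> L + L'" "x - p - \<psi> t \<in> H" by (auto simp: curve_def)
  show "x \<in> curve p \<psi> L \<union> curve p' \<psi>' L'"
  proof (cases "t \<le> L")
    case False
    from diff_mem[OF diff_mem[OF diff_mem[OF t(3) hom_mod_diff[OF assms(1), of t L]] assms(2)] assms(3)[of "t - L"]]
    have "x - p' - \<psi>' (t - L) \<in> H" by (simp add: algebra_simps)
    then have "x \<in> curve p' \<psi>' L'" using t False by (auto simp: curve_def intro!: bexI[of _ "t - L"])
    then show ?thesis ..
  qed (use t in \<open>auto simp: curve_def\<close>)
next
  fix x assume "x \<in> curve p \<psi> L \<union> curve p' \<psi>' L'"
  then consider "x \<in> curve p \<psi> L" | "x \<in> curve p' \<psi>' L'" by blast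
  then show "x \<in> curve p \<psi> (L + L')"
  proof cases
    case 2
    then obtain t where t: "0 \<le> t" "t \<le> L'" "x - p' - \<psi>' t \<in> H" by (auto simp: curve_def)
    from diff_mem[OF add_mem[OF add_mem[OF t(3) assms(2)] assms(3)[of t]] hom_modD[OF assms(1), of L t]]
    have "x - p - \<psi> (L + t) \<in> H" by (simp add: algebra_simps)
    then show ?thesis using t assms by (auto simp: curve_def intro!: bexI[of _ "L + t"])
  qed (use assms in \<open>force simp: curve_def\<close>)
qed

end

text \<open>A finite graph with the half-edges \<open>(e, b)\<close>: \<open>en e b\<close> is the end vertex of \<open>(e, b)\<close>, and \<open>\<psi> e b\<close>
  parametrizes the curve of \<open>e\<close>, modulo \<open>H\<close>, starting from that end.\<close>

locale curve_graph = additive_subgroup H for H :: "'p :: ab_group_add set" +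
  fixes V :: "'v set" and E :: "'e set" and en :: "'e \<Rightarrow> bool \<Rightarrow> 'v"
    and L :: "'e \<Rightarrow> real" and \<psi> :: "'e \<Rightarrow> bool \<Rightarrow> real \<Rightarrow> 'p" and pos :: "'v \<Rightarrow> 'p"
  assumes finite_V: "finite V" and finite_E: "finite E"
    and en_in_V: "e \<in> E \<Longrightarrow> en e b \<in> V"
    and conn: "\<lbrakk>S \<subseteq> V; S \<noteq> {}; \<And>e b. e \<in> E \<Longrightarrow> en e b \<in> S \<Longrightarrow> en e (\<not> b) \<in> S\<rbrakk> \<Longrightarrow> S = V"
    and L_pos: "e \<in> E \<Longrightarrow> 0 < L e"
    and hom: "e \<in> E \<Longrightarrow> hom_mod (\<psi> e b)"
    and reverse: "e \<in> E \<Longrightarrow> \<psi> e (\<not> b) t + \<psi> e b t \<in> H"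
    and incidence: "e \<in> E \<Longrightarrow> pos (en e (\<not> b)) - pos (en e b) - \<psi> e b (L e) \<in> H"
    and kirchhoff: "v \<in> V \<Longrightarrow> (\<Sum>(e, b)\<in>{x \<in> E \<times> UNIV. en (fst x) (snd x) = v}. \<psi> e b t) \<in> H"
begin

text \<open>A loop at \<open>v\<close> contributes two half-edges, so the cardinality is the usual
  degree of \<open>v\<close>.\<close>

definition half_edges :: "'v \<Rightarrow> ('e \<times> bool) set" where
  "half_edges v = {x \<in> E \<times> UNIV. en (fst x) (snd x) = v}"

definition edge_curve :: "'e \<Rightarrow> 'p set" where
  "edge_curve e = curve (pos (en e True)) (\<psi> e True) (L e)"

lemma finite_half_edges: "finite (half_edges v)"
  using finite_E unfolding half_edges_def by auto

lemma edge_curve_eq: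
  assumes "e \<in> E" shows "edge_curve e = curve (pos (en e b)) (\<psi> e b) (L e)"
proof -
  have *: "curve (pos (en e b)) (\<psi> e b) (L e) \<subseteq> curve (pos (en e (\<not> b))) (\<psi> e (\<not> b)) (L e)" for b
    by (rule curve_subset_reverse) (use assms hom reverse incidence in auto)
  from *[of True] *[of False] show ?thesis by (cases b) (auto simp: edge_curve_def)
qed

lemma pos_mem_edge_curve: assumes "e \<in> E" shows "pos (en e b) \<in> edge_curve e"
  unfolding edge_curve_eq[OF assms, of b] curve_def
  using minus_mem[OF hom_mod_zero[OF hom[OF assms]]] L_pos[OF assms] by (auto intro!: bexI[of _ 0])

lemma card_half_edges: "2 * card E = (\<Sum>v\<in>V. card (half_edges v))"
proof -
  have "(\<Sum>v\<in>V. card (half_edges v)) = card (\<Union>v\<in>V. half_edges v)"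
    by (rule card_UN_disjoint[symmetric]) (use finite_V finite_half_edges in \<open>auto simp: half_edges_def\<close>)
  also have "(\<Union>v\<in>V. half_edges v) = E \<times> UNIV" using en_in_V by (auto simp: half_edges_def)
  finally show ?thesis by (simp add: card_cartesian_product)
qed

text \<open>A vertex without half-edges would be a whole component, leaving no end vertex for an
  edge.\<close>

lemma ex_half_edge:
  assumes "E \<noteq> {}" "v \<in> V" shows "half_edges v \<noteq> {}"
proof
  assume empty: "half_edges v = {}"
  have "{v} = V"
    by (rule conn) (use assms(2) empty in \<open>auto simp: half_edges_def\<close>)
  moreover obtain e where "e \<in> E" using assms(1) by auto
  ultimately show False using en_in_V[of e True] empty by (auto simp: half_edges_def)
qed

text \<open>With a single half-edge at \<open>v\<close>, the relation \<open>kirchhoff\<close> says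
  that \<open>\<psi> e b\<close> is trivial modulo \<open>H\<close>. So the whole edge represents
  the class of its other end, and dropping its term from the relations at the remaining vertices
  changes nothing modulo \<open>H\<close>.\<close>

lemma delete_leaf:
  assumes v: "v \<in> V" and leaf: "half_edges v = {(e, b)}" and V: "V \<noteq> {v}"
  shows "curve_graph H (V - {v}) (E - {e}) en L \<psi> pos"
    and "\<And>x. x \<in> edge_curve e \<Longrightarrow> x - pos (en e (\<not> b)) \<in> H"
    and "e \<in> E" and "en e (\<not> b) \<in> V - {v}"
proof -
  have e: "e \<in> E" "en e b = v" and only: "\<And>e' b'. e' \<in> E \<Longrightarrow> en e' b' = v \<Longrightarrow> e' = e \<and> b' = b"
    using leaf by (auto simp: half_edges_def set_eq_iff)
  have triv: "\<psi> e b t \<in> H" for t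
    using kirchhoff[OF v, of t] leaf by (simp add: half_edges_def)
  have triv': "\<psi> e b' t \<in> H" for b' t
    using reverse[OF e(1), of b t] triv add_cancel_mem[OF triv, of "\<psi> e (\<not> b) t"] by (cases "b' = b") (auto simp: )
  show w: "en e (\<not> b) \<in> V - {v}" using en_in_V e only[of e "\<not> b"] by auto
  show "e \<in> E" by fact
  show "x - pos (en e (\<not> b)) \<in> H" if "x \<in> edge_curve e" for x
  proof -
    obtain t where "x - pos (en e (\<not> b)) - \<psi> e (\<not> b) t \<in> H"
      using \<open>x \<in> edge_curve e\<close> by (auto simp: edge_curve_eq[OF e(1), of "\<not> b"] curve_def)
    from add_mem[OF this triv'[of "\<not> b" t]] show ?thesis by simp
  qed
  show "curve_graph H (V - {v}) (E - {e}) en L \<psi> pos"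
  proof
    fix e' b' assume "e' \<in> E - {e}"
    then show "en e' b' \<in> V - {v}" using en_in_V only by auto
  next
    fix S assume S: "S \<subseteq> V - {v}" "S \<noteq> {}"
      and closed: "\<And>e' b'. e' \<in> E - {e} \<Longrightarrow> en e' b' \<in> S \<Longrightarrow> en e' (\<not> b') \<in> S"
    \<comment> \<open>A set closed in the smaller graph becomes closed in the old one once the leaf
      is added whenever its neighbour belongs to the set.\<close>
    define S' where "S' = (if en e (\<not> b) \<in> S then insert v S else S)"
    have "S' = V"
    proof (rule conn)
      fix e' b' assume "e' \<in> E" "en e' b' \<in> S'"
      then show "en e' (\<not> b') \<in> S'"
      proof (cases "e' = e")
        case True
        then show ?thesis using \<open>en e' b' \<in> S'\<close> e(2) w S(1)
          by (cases "b' = b") (auto simp: S'_def split: if_splits)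
      next
        case False
        then have "en e' b' \<noteq> v" using only[OF \<open>e' \<in> E\<close>] by blast
        then have "en e' b' \<in> S" using \<open>en e' b' \<in> S'\<close> by (simp add: S'_def split: if_splits)
        then have "en e' (\<not> b') \<in> S" using closed \<open>e' \<in> E\<close> False by blast
        then show ?thesis by (simp add: S'_def)
      qed
    qed (use S v in \<open>auto simp: S'_def\<close>)
    then show "S = V - {v}" using S v by (auto simp: S'_def split: if_splits)
  next
    fix u t assume u: "u \<in> V - {v}"
    have "(\<Sum>(e', b')\<in>half_edges u. \<psi> e' b' t)
        = (\<Sum>(e', b')\<in>half_edges u - {e} \<times> UNIV. \<psi> e' b' t) + (\<Sum>(e', b')\<in>half_edges u \<inter> {e} \<times> UNIV. \<psi> e' b' t)"
      using sum.Int_Diff[OF finite_half_edges, of _ u "{e} \<times> UNIV"] by (simp add: add.commute)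
    moreover have "(\<Sum>(e', b')\<in>half_edges u \<inter> {e} \<times> UNIV. \<psi> e' b' t) \<in> H"
      by (rule sum_mem) (use triv' in auto)
    ultimately have "(\<Sum>(e', b')\<in>half_edges u - {e} \<times> UNIV. \<psi> e' b' t) \<in> H"
      using kirchhoff[of u t] u by (simp add: half_edges_def add_cancel_mem)
    moreover have "half_edges u - {e} \<times> UNIV = {x \<in> (E - {e}) \<times> UNIV. en (fst x) (snd x) = u}"
      by (auto simp: half_edges_def)
    ultimately show "(\<Sum>(e', b')\<in>{x \<in> (E - {e}) \<times> UNIV. en (fst x) (snd x) = u}. \<psi> e' b' t) \<in> H"
      by simp
  qed (use finite_V finite_E L_pos hom reverse incidence in auto)
qed

text \<open>With two half-edges at \<open>v\<close>, \<open>kirchhoff\<close> says that the map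
  arriving along one edge equals the map leaving along the other. Hence \<open>\<psi> e1\<close>
  already parametrizes the concatenation, and only the end vertex and the length of
  \<open>e1\<close> need updating. If the two edges have the same far end, \<open>e1\<close> becomes
  a loop.\<close>

lemma smooth_vertex:
  assumes v: "v \<in> V" and deg: "half_edges v = {(e1, b1), (e2, b2)}" and ne: "e1 \<noteq> e2"
  defines "en' \<equiv> en(e1 := (en e1)(b1 := en e2 (\<not> b2)))" and "L' \<equiv> L(e1 := L e1 + L e2)"
  shows "curve_graph H (V - {v}) (E - {e2}) en' L' \<psi> pos"
    and "curve (pos (en' e1 True)) (\<psi> e1 True) (L' e1) = edge_curve e1 \<union> edge_curve e2"
    and "e1 \<in> E" "e2 \<in> E"
proof -
  have "(e1, b1) \<in> half_edges v" "(e2, b2) \<in> half_edges v" by (simp_all add: deg)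
  then have e: "e1 \<in> E" "e2 \<in> E" "en e1 b1 = v" "en e2 b2 = v" by (simp_all add: half_edges_def)
  have only: "e' = e1 \<and> b' = b1 \<or> e' = e2 \<and> b' = b2" if "e' \<in> E" "en e' b' = v" for e' b'
  proof -
    have "(e', b') \<in> half_edges v" using that by (simp add: half_edges_def)
    then show ?thesis by (simp add: deg)
  qed
  show "e1 \<in> E" "e2 \<in> E" using e by simp_all
  have w: "en e1 (\<not> b1) \<noteq> v" "en e2 (\<not> b2) \<noteq> v" using only e ne by blast+
  have "\<psi> e1 b1 t + \<psi> e2 b2 t \<in> H" for t
    using kirchhoff[OF v, of t] deg ne by (simp add: half_edges_def)
  from diff_mem[OF this reverse[OF e(2), of b2]]
  have "\<psi> e1 b1 t + \<psi> e2 b2 t - (\<psi> e2 (\<not> b2) t + \<psi> e2 b2 t) \<in> H" for t .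
  then have through: "\<psi> e1 b1 t - \<psi> e2 (\<not> b2) t \<in> H" for t by (simp add: algebra_simps)
  have through': "\<psi> e2 (\<not> b2) t + \<psi> e1 (\<not> b1) t \<in> H" for t
    using diff_mem[OF reverse[OF e(1), of b1 t] through[of t]] by (simp add: algebra_simps)
  \<comment> \<open>The increment from the far end of \<open>e1\<close> through \<open>v\<close> to
    the far end of \<open>e2\<close> is the sum of the two increments, the second one measured by
    \<open>\<psi> e1\<close> instead of \<open>\<psi> e2\<close>.\<close>
  have inc: "pos (en e2 (\<not> b2)) - pos (en e1 (\<not> b1)) - \<psi> e1 (\<not> b1) (L e1 + L e2) \<in> H"
  proof -
    note i1 = incidence[OF e(1), of "\<not> b1"] and i2 = incidence[OF e(2), of "b2"]
    from diff_mem[OF through'[of "L e2"] reverse[OF e(2), of b2 "L e2"]]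
    have t: "\<psi> e1 (\<not> b1) (L e2) - \<psi> e2 b2 (L e2) \<in> H" by (simp add: algebra_simps)
    from diff_mem[OF diff_mem[OF add_mem[OF i1 i2] t] hom_modD[OF hom[OF e(1), of "\<not> b1"], of "L e1" "L e2"]]
    show ?thesis using e by (simp add: algebra_simps)
  qed
  show "curve_graph H (V - {v}) (E - {e2}) en' L' \<psi> pos"
  proof
    fix e' b' assume "e' \<in> E - {e2}"
    then show "en' e' b' \<in> V - {v}" using en_in_V only w e unfolding en'_def by auto
  next
    fix S assume S: "S \<subseteq> V - {v}" "S \<noteq> {}"
      and closed: "\<And>e' b'. e' \<in> E - {e2} \<Longrightarrow> en' e' b' \<in> S \<Longrightarrow> en' e' (\<not> b') \<in> S"
    define S' where "S' = (if en e1 (\<not> b1) \<in> S then insert v S else S)"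
    \<comment> \<open>In the new graph \<open>e1\<close> joins the two far ends, so a closed set
      contains both or neither, and \<open>v\<close> can be added consistently.\<close>
    have c1: "en e1 (\<not> b1) \<in> S \<longleftrightarrow> en e2 (\<not> b2) \<in> S"
      using closed[of e1 b1] closed[of e1 "\<not> b1"] e ne by (auto simp: en'_def)
    have "S' = V"
    proof (rule conn)
      fix e' b' assume "e' \<in> E" "en e' b' \<in> S'"
      consider "e' = e1" "b' = b1" | "e' = e1" "b' = (\<not> b1)" | "e' = e2" "b' = b2" | "e' = e2" "b' = (\<not> b2)"
        | "e' \<noteq> e1" "e' \<noteq> e2" by blast
      then show "en e' (\<not> b') \<in> S'"
      proof cases
        case 5
        then have "en e' b' \<noteq> v" using only \<open>e' \<in> E\<close> by blast
        then have "en e' b' \<in> S" using \<open>en e' b' \<in> S'\<close> by (auto simp: S'_def split: if_splits)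
        then show ?thesis using closed[of e' b'] \<open>e' \<in> E\<close> 5 by (auto simp: S'_def en'_def)
      qed (use \<open>en e' b' \<in> S'\<close> c1 e w S in \<open>auto simp: S'_def split: if_splits\<close>)
    qed (use S v in \<open>auto simp: S'_def\<close>)
    then show "S = V - {v}" using S v by (auto simp: S'_def split: if_splits)
  next
    fix e' b' assume e': "e' \<in> E - {e2}"
    show "pos (en' e' (\<not> b')) - pos (en' e' b') - \<psi> e' b' (L' e') \<in> H"
    proof (cases "e' = e1")
      case True
      have *: "pos (en e1 (\<not> b1)) - pos (en e2 (\<not> b2)) - \<psi> e1 b1 (L e1 + L e2) \<in> H"
        using diff_mem[OF minus_mem[OF inc] reverse[OF e(1), of b1 "L e1 + L e2"]] by (simp add: algebra_simps)
      show ?thesis using True inc * by (cases "b' = b1") (auto simp: en'_def L'_def)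
    qed (use e' incidence in \<open>auto simp: en'_def L'_def\<close>)
  next
    fix u t assume u: "u \<in> V - {v}"
    let ?N = "half_edges u - {(e2, \<not> b2)}" and ?f = "\<lambda>(e', b'). \<psi> e' b' t"
    \<comment> \<open>Only the half-edge \<open>(e2, \<not> b2)\<close> changes its name: it becomes
      \<open>(e1, b1)\<close>, which carries the same map modulo \<open>H\<close> by
      \<open>through\<close>.\<close>
    have N: "{x \<in> (E - {e2}) \<times> UNIV. en' (fst x) (snd x) = u}
        = (if en e2 (\<not> b2) = u then insert (e1, b1) ?N else ?N)"
    proof (rule Set.set_eqI)
      fix x
      show "x \<in> {x \<in> (E - {e2}) \<times> UNIV. en' (fst x) (snd x) = u}
        \<longleftrightarrow> x \<in> (if en e2 (\<not> b2) = u then insert (e1, b1) ?N else ?N)"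
      proof (cases "x = (e1, b1)")
        case False
        then have "en' (fst x) (snd x) = en (fst x) (snd x)" by (cases x) (auto simp: en'_def)
        then show ?thesis using False e(4) u
          by (cases x; cases "fst x = e2"; cases "snd x = b2") (auto simp: half_edges_def)
      qed (use e u ne in \<open>auto simp: half_edges_def en'_def\<close>)
    qed
    have "(e1, b1) \<notin> half_edges u" using e u by (auto simp: half_edges_def)
    show "sum ?f {x \<in> (E - {e2}) \<times> UNIV. en' (fst x) (snd x) = u} \<in> H"
    proof (cases "en e2 (\<not> b2) = u")
      case True
      then have "(e2, \<not> b2) \<in> half_edges u" using e by (auto simp: half_edges_def)
      then have "sum ?f (half_edges u) = \<psi> e2 (\<not> b2) t + sum ?f ?N"
        using sum.remove[OF finite_half_edges, of _ u ?f] by simp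
      moreover have "sum ?f (half_edges u) \<in> H" using kirchhoff u by (simp add: half_edges_def)
      ultimately have "\<psi> e1 b1 t + sum ?f ?N \<in> H" using add_mem[OF through[of t]]
        by (metis (no_types, lifting) add.assoc diff_add_cancel)
      then show ?thesis using True \<open>(e1, b1) \<notin> half_edges u\<close> finite_half_edges by (simp add: N)
    next
      case False
      then have "?N = half_edges u" by (auto simp: half_edges_def)
      then show ?thesis using False kirchhoff[of u t] u by (simp add: N) (simp add: half_edges_def)
    qed
  qed (use finite_V finite_E L_pos hom reverse e in \<open>auto simp: L'_def add_pos_pos\<close>)
  then interpret G': curve_graph H "V - {v}" "E - {e2}" en' L' \<psi> pos .
  have "curve (pos (en' e1 True)) (\<psi> e1 True) (L' e1) = curve (pos (en' e1 (\<not> b1))) (\<psi> e1 (\<not> b1)) (L' e1)"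
    using G'.edge_curve_eq[of e1 "\<not> b1"] e ne by (simp add: G'.edge_curve_def)
  also have "\<dots> = curve (pos (en e1 (\<not> b1))) (\<psi> e1 (\<not> b1)) (L e1 + L e2)" by (simp add: en'_def L'_def)
  also have "\<dots> = curve (pos (en e1 (\<not> b1))) (\<psi> e1 (\<not> b1)) (L e1) \<union> curve (pos (en e2 b2)) (\<psi> e2 b2) (L e2)"
  proof (rule curve_append)
    fix t from diff_mem[OF reverse[OF e(2), of b2 t] through'[of t]]
    show "\<psi> e2 b2 t - \<psi> e1 (\<not> b1) t \<in> H" by (simp add: algebra_simps)
  qed (use hom e L_pos incidence[of e1 "\<not> b1"] in \<open>auto simp: less_imp_le\<close>)
  also have "\<dots> = edge_curve e1 \<union> edge_curve e2" using edge_curve_eq e by blast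
  finally show "curve (pos (en' e1 True)) (\<psi> e1 True) (L' e1) = edge_curve e1 \<union> edge_curve e2" .
qed

end

text \<open>Deleting leaves and smoothing vertices of degree two changes neither the genus nor the
  union of the edge curves; when neither is possible, all degrees are at least three.\<close>
lemma curve_graph_cover:
  assumes "curve_graph H V E en L \<psi> pos" and "card E \<ge> Suc (card V)"
  shows "\<exists>\<C>. finite \<C> \<and> card \<C> + 3 * card V \<le> 3 * card E \<and>
    (\<forall>C\<in>\<C>. \<exists>p \<phi> l. additive_subgroup.hom_mod H \<phi> \<and> C = additive_subgroup.curve H p \<phi> l) \<and>
    \<Union>\<C> = (\<Union>e\<in>E. curve_graph.edge_curve H en L \<psi> pos e)"
  using assms
proof (induction "card V" arbitrary: V E en L rule: less_induct)
  case less
  then interpret curve_graph H V E en L \<psi> pos by simp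
  have "E \<noteq> {}" using less.prems(2) by auto
  show ?case
  proof (cases "\<forall>v\<in>V. card (half_edges v) \<ge> 3")
    case True
    then have "3 * card V \<le> (\<Sum>v\<in>V. card (half_edges v))"
      using sum_mono[of V "\<lambda>_. 3" "\<lambda>v. card (half_edges v)"] by simp
    \<comment> \<open>The degree sum is twice the number of edges, so
      \<open>3 * card V \<le> 2 * card E\<close>.\<close>
    then have "card E + 3 * card V \<le> 3 * card E" using card_half_edges by linarith
    moreover have "card (edge_curve ` E) \<le> card E" using card_image_le finite_E by blast
    ultimately show ?thesis
      by (intro exI[of _ "edge_curve ` E"]) (use finite_E hom in \<open>auto simp: edge_curve_def\<close>)
  next
    case False
    then obtain v where v: "v \<in> V" "card (half_edges v) < 3" by force
    have card_v: "card (V - {v}) < card V" "card V = Suc (card (V - {v}))"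
      using card_Diff1_less[OF finite_V v(1)] card_Suc_Diff1[OF finite_V v(1)] by simp_all
    have "card (half_edges v) \<noteq> 0" using ex_half_edge[OF \<open>E \<noteq> {}\<close> v(1)] finite_half_edges by simp
    with v(2) consider "card (half_edges v) = 1" | "card (half_edges v) = 2" by linarith
    then show ?thesis
    proof cases
      case 1
      then obtain e b where leaf: "half_edges v = {(e, b)}" by (metis card_1_singletonE surj_pair)
      \<comment> \<open>With a single vertex all half-edges end there, and they come in pairs, so
        the degree could not be one.\<close>
      have "V \<noteq> {v}"
      proof
        assume "V = {v}"
        then have "E \<times> UNIV = half_edges v" using en_in_V by (auto simp: half_edges_def)
        then have "card E * 2 = 1" using 1 by (metis card_UNIV_bool card_cartesian_product)
        then show False by presburger
      qed
      note del = delete_leaf[OF v(1) leaf this]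
      interpret G': curve_graph H "V - {v}" "E - {e}" en L \<psi> pos by (rule del)
      have cE: "card E = Suc (card (E - {e}))" using card_Suc_Diff1[OF finite_E del(3)] by simp
      then have big: "Suc (card (V - {v})) \<le> card (E - {e})" using less.prems(2) card_v by simp
      then have "E - {e} \<noteq> {}" by (metis card.empty Zero_not_Suc le_zero_eq)
      \<comment> \<open>Some edge survives at the neighbour of the leaf. Its curve contains the
        single class represented by the deleted edge, so the union of the curves is
        unchanged.\<close>
      then obtain e' b' where e': "e' \<in> E - {e}" "en e' b' = en e (\<not> b)"
        using G'.ex_half_edge[OF _ del(4)] by (auto simp: G'.half_edges_def)
      have "edge_curve e \<subseteq> edge_curve e'"
      proof
        fix x assume "x \<in> edge_curve e"
        then have "x - pos (en e' b') \<in> H" using del(2) e' by simp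
        moreover have "pos (en e' b') \<in> edge_curve e'" using pos_mem_edge_curve e' by blast
        ultimately show "x \<in> edge_curve e'" unfolding edge_curve_def
          by (rule curve_mem_cong)
      qed
      then have "(\<Union>e\<in>E. edge_curve e) = (\<Union>e\<in>E - {e}. edge_curve e)" using e' by blast
      moreover obtain \<C> where "finite \<C>" "card \<C> + 3 * card (V - {v}) \<le> 3 * card (E - {e})"
        "\<forall>C\<in>\<C>. \<exists>p \<phi> l. hom_mod \<phi> \<and> C = curve p \<phi> l" "\<Union>\<C> = (\<Union>e\<in>E - {e}. edge_curve e)"
        using less.hyps[OF card_v(1) del(1) big] by metis
      ultimately show ?thesis using cE card_v(2) by (intro exI[of _ \<C>]) simp
    next
      case 2
      then obtain e1 b1 e2 b2 where deg: "half_edges v = {(e1, b1), (e2, b2)}" "(e1, b1) \<noteq> (e2, b2)"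
        by (auto simp: card_2_iff)
      \<comment> \<open>If both half-edges at \<open>v\<close> belonged to one edge, the graph would
        be a circle with one vertex and one edge, which \<open>card E \<ge> Suc (card V)\<close>
        excludes.\<close>
      have "e1 \<noteq> e2"
      proof
        assume eq: "e1 = e2"
        have "{v} = V"
        proof (rule conn)
          fix e b assume "e \<in> E" "en e b \<in> {v}"
          then have "(e, b) \<in> half_edges v" by (auto simp: half_edges_def)
          then have "(e, \<not> b) \<in> half_edges v" using deg eq by auto
          then show "en e (\<not> b) \<in> {v}" by (auto simp: half_edges_def)
        qed (use v in auto)
        then have "E \<times> UNIV = half_edges v" using en_in_V by (auto simp: half_edges_def)
        then have "card E * 2 = 2" using 2 by (metis card_UNIV_bool card_cartesian_product)
        moreover have "card V = 1" unfolding \<open>{v} = V\<close>[symmetric] by simp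
        ultimately show False using less.prems(2) by simp
      qed
      note sm = smooth_vertex[OF v(1) deg(1) this]
      define en' where "en' = en(e1 := (en e1)(b1 := en e2 (\<not> b2)))"
      define L' where "L' = L(e1 := L e1 + L e2)"
      note sm = sm[folded en'_def L'_def]
      interpret G': curve_graph H "V - {v}" "E - {e2}" en' L' \<psi> pos by (rule sm)
      have cE: "card E = Suc (card (E - {e2}))" using card_Suc_Diff1[OF finite_E sm(4)] by simp
      have "G'.edge_curve e = edge_curve e" if "e \<in> E - {e1, e2}" for e
        using that unfolding G'.edge_curve_def edge_curve_def by (simp add: en'_def L'_def)
      moreover have "G'.edge_curve e1 = edge_curve e1 \<union> edge_curve e2" using sm(2) unfolding G'.edge_curve_def .
      moreover have "E = insert e1 (insert e2 (E - {e1, e2}))" "E - {e2} = insert e1 (E - {e1, e2})"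
        using sm(3,4) \<open>e1 \<noteq> e2\<close> by auto
      ultimately have "(\<Union>e\<in>E. edge_curve e) = (\<Union>e\<in>E - {e2}. G'.edge_curve e)"
        by (smt (verit, ccfv_SIG) SUP_cong UN_insert Un_assoc)
      moreover have big: "Suc (card (V - {v})) \<le> card (E - {e2})" using less.prems(2) card_v cE by simp
      obtain \<C> where "finite \<C>" "card \<C> + 3 * card (V - {v}) \<le> 3 * card (E - {e2})"
        "\<forall>C\<in>\<C>. \<exists>p \<phi> l. hom_mod \<phi> \<and> C = curve p \<phi> l" "\<Union>\<C> = (\<Union>e\<in>E - {e2}. G'.edge_curve e)"
        using less.hyps[OF card_v(1) sm(1) big] by metis
      ultimately show ?thesis using cE card_v(2) by (intro exI[of _ \<C>]) simp
    qed
  qed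
qed


section \<open>Models and the path metric\<close>

lemma bij_betw_inj: "bij_betw f A B \<Longrightarrow> x \<in> A \<Longrightarrow> y \<in> A \<Longrightarrow> f x = f y \<Longrightarrow> x = y"
  by (auto simp: bij_betw_def inj_on_def)

text \<open>Connectedness in terms of closed sets survives reductions and refinements without any
  handling of walks. The vertices reachable from \<open>u\<close> form such a set, and every such
  set containing \<open>u\<close> contains them.\<close>

lemma (in fin_digraph) connected_iff:
  "Digraph_Component.connected G \<longleftrightarrow> verts G \<noteq> {} \<and>
    (\<forall>S\<subseteq>verts G. S \<noteq> {} \<longrightarrow> (\<forall>e\<in>arcs G. tail G e \<in> S \<longleftrightarrow> head G e \<in> S) \<longrightarrow> S = verts G)"
  (is "?l \<longleftrightarrow> ?r")
proof -
  interpret S: pair_wf_digraph "mk_symmetric G" ..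
  have adj: "arcs_ends (with_proj (mk_symmetric G)) = (\<Union>e\<in>arcs G. {(tail G e, head G e), (head G e, tail G e)})"
    by (simp add: parcs_mk_symmetric)
  show ?thesis
  proof
    assume con: ?l
    have "S = verts G" if S: "S \<subseteq> verts G" "u \<in> S" and closed: "\<forall>e\<in>arcs G. tail G e \<in> S \<longleftrightarrow> head G e \<in> S" for S u
    proof -
      have "v \<in> S" if "u \<rightarrow>\<^sup>*\<^bsub>with_proj (mk_symmetric G)\<^esub> v" for v
        using that
      proof (induction rule: S.reachable_induct)
        case (step x y)
        then show ?case using closed adj by auto
      qed (use S in auto)
      then show ?thesis using con S by (auto simp: connected_def strongly_connected_def)
    qed
    then show ?r using con by (auto simp: connected_def strongly_connected_def)
  next
    assume r: ?r
    show ?l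
    proof (rule connectedI)
      fix u v assume uv: "u \<in> verts G" "v \<in> verts G"
      define S where "S = {v. u \<rightarrow>\<^sup>*\<^bsub>with_proj (mk_symmetric G)\<^esub> v}"
      have sub: "S \<subseteq> verts G" using S.reachable_in_verts(2) by (auto simp: S_def)
      have "u \<in> S" using uv S.reachable_refl by (simp add: S_def)
      then have ne: "S \<noteq> {}" by blast
      have closed: "tail G e \<in> S \<longleftrightarrow> head G e \<in> S" if "e \<in> arcs G" for e
      proof -
        have adj': "(tail G e, head G e) \<in> parcs (mk_symmetric G)" "(head G e, tail G e) \<in> parcs (mk_symmetric G)"
          unfolding parcs_mk_symmetric using that by blast+
        show ?thesis unfolding S_def mem_Collect_eq
          by (rule iffI) (erule S.reachable_adj_trans[OF _ adj'(1)], erule S.reachable_adj_trans[OF _ adj'(2)])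
      qed
      have "S = verts G" by (rule r[THEN conjunct2, rule_format, OF sub ne closed])
      then have "v \<in> S" using uv(2) by simp
      then show "u \<rightarrow>\<^sup>*\<^bsub>with_proj (mk_symmetric G)\<^esub> v" unfolding S_def by (rule CollectD)
    qed (use r in auto)
  qed
qed

lemma edge_path_nonneg: "edge_path G len \<gamma> x r y \<Longrightarrow> 0 \<le> r"
  by (induction rule: edge_path.induct) auto

lemma edge_path_trans:
  assumes "edge_path G len \<gamma> y r' z" "edge_path G len \<gamma> x r y"
  shows "edge_path G len \<gamma> x (r + r') z"
  using assms by (induction rule: edge_path.induct) (auto simp: add.assoc[symmetric] intro: edge_path.step)

lemma edge_path_segment:
  assumes "e \<in> arcs G" "s \<in> {0..len e}" "t \<in> {0..len e}"
  shows "edge_path G len \<gamma> (\<gamma> e s) \<bar>t - s\<bar> (\<gamma> e t)"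
  using edge_path.step[of G len \<gamma> "\<gamma> e s" 0 e s t] assms edge_path.refl by fastforce

lemma edge_path_stepI:
  assumes "edge_path G len \<gamma> x r p" "p = \<gamma> e s" "e \<in> arcs G" "0 \<le> s" "s \<le> len e" "0 \<le> t" "t \<le> len e"
    "r' = r + \<bar>t - s\<bar>" "y = \<gamma> e t"
  shows "edge_path G len \<gamma> x r' y"
  using edge_path.step[of G len \<gamma> x r e s t] assms by simp

context metric_graph_model
begin

lemma verts_nonempty: "verts G \<noteq> {}"
  using connected connected_iff by blast

lemma connected_closed:
  "\<lbrakk>S \<subseteq> verts G; S \<noteq> {}; \<And>e. e \<in> arcs G \<Longrightarrow> tail G e \<in> S \<longleftrightarrow> head G e \<in> S\<rbrakk> \<Longrightarrow> S = verts G"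
  using connected connected_iff by blast

lemma chart_interior_in:
  assumes "e \<in> arcs G" "0 < t" "t < len e" shows "\<gamma> e t \<in> mspace \<Gamma> - verts G"
  using bij_betwE[OF chart_interior] assms by force

lemma chart_in_mspace:
  assumes "e \<in> arcs G" "0 \<le> t" "t \<le> len e" shows "\<gamma> e t \<in> mspace \<Gamma>"
proof -
  consider "t = 0" | "t = len e" | "0 < t" "t < len e" using assms by linarith
  then show ?thesis
  proof cases
    case 3
    then show ?thesis using chart_interior_in[of e t] assms(1) by simp
  qed (use assms(1) chart_tail chart_head verts_subset in auto)
qed

lemma chart_interior_inj:
  assumes "e \<in> arcs G" "0 < t" "t < len e" "e' \<in> arcs G" "0 < t'" "t' < len e'" "\<gamma> e t = \<gamma> e' t'"
  shows "e = e'" "t = t'"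
  using bij_betw_inj[OF chart_interior, of "(e, t)" "(e', t')"] assms by auto

lemma point_cases:
  assumes "x \<in> mspace \<Gamma>"
  obtains "x \<in> verts G" | e t where "x \<notin> verts G" "e \<in> arcs G" "0 < t" "t < len e" "x = \<gamma> e t"
proof (cases "x \<in> verts G")
  case True
  then show ?thesis by (rule that(1))
next
  case False
  then have "x \<in> (\<lambda>(e, t). \<gamma> e t) ` (SIGMA e:arcs G. {0<..<len e})"
    using assms bij_betw_imp_surj_on[OF chart_interior] by simp
  then show ?thesis using that(2) False by auto
qed

lemma chart_eq_cases:
  assumes "e \<in> arcs G" "0 \<le> t" "t \<le> len e" "e' \<in> arcs G" "0 \<le> t'" "t' \<le> len e'" "\<gamma> e t = \<gamma> e' t'"
  shows "e = e' \<and> t = t' \<or> (t = 0 \<or> t = len e) \<and> (t' = 0 \<or> t' = len e')"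
proof -
  have end_vert: "\<gamma> f s \<in> verts G" if "f \<in> arcs G" "s = 0 \<or> s = len f" for f s
    using that chart_tail chart_head by auto
  show ?thesis
    using chart_interior_inj[of e t e' t'] chart_interior_in[of e t] chart_interior_in[of e' t'] assms
      end_vert[of e t] end_vert[of e' t']
    by (metis DiffD2 order_le_imp_less_or_eq)
qed

text \<open>The universal property of the gluing: functions on the edges that agree at shared
  vertices define a function on the points of \<Gamma>. The test functions, for distances and for
  divisors alike, arise in this way.\<close>

lemma chart_function_exists:
  assumes "\<And>e. e \<in> arcs G \<Longrightarrow> \<phi> e 0 = u (tail G e)" "\<And>e. e \<in> arcs G \<Longrightarrow> \<phi> e (len e) = u (head G e)"
  shows "\<exists>F. (\<forall>v\<in>verts G. F v = u v) \<and> (\<forall>e\<in>arcs G. \<forall>t. 0 \<le> t \<and> t \<le> len e \<longrightarrow> F (\<gamma> e t) = \<phi> e t)"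
proof -
  define D where "D = (SIGMA e:arcs G. {0<..<len e})"
  define F where "F x = (if x \<in> verts G then u x else case inv_into D (\<lambda>(e, t). \<gamma> e t) x of (e, t) \<Rightarrow> \<phi> e t)" for x
  have inj: "inj_on (\<lambda>(e, t). \<gamma> e t) D" using chart_interior by (simp add: bij_betw_def D_def)
  have F: "F (\<gamma> e t) = \<phi> e t" if e: "e \<in> arcs G" "0 \<le> t" "t \<le> len e" for e t
  proof -
    consider "t = 0" | "t = len e" | "0 < t" "t < len e" using e by linarith
    then show ?thesis
    proof cases
      case 3
      then have "(e, t) \<in> D" using e by (simp add: D_def)
      from inv_into_f_f[OF inj this] show ?thesis using chart_interior_in[of e t] 3 e by (simp add: F_def)
    qed (use e assms chart_tail chart_head in \<open>simp_all add: F_def\<close>)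
  qed
  show ?thesis by (rule exI[of _ F]) (use F in \<open>auto simp: F_def\<close>)
qed

lemma edge_path_in_mspace: "edge_path G len \<gamma> x r y \<Longrightarrow> x \<in> mspace \<Gamma> \<Longrightarrow> y \<in> mspace \<Gamma>"
  by (induction rule: edge_path.induct) (auto intro: chart_in_mspace)

lemma edge_path_sym:
  assumes "edge_path G len \<gamma> x r y" shows "edge_path G len \<gamma> y r x"
  using assms
proof (induction rule: edge_path.induct)
  case (step r e s t)
  have "edge_path G len \<gamma> (\<gamma> e t) \<bar>s - t\<bar> (\<gamma> e s)" using step by (intro edge_path_segment) auto
  from edge_path_trans[OF step.IH this] show ?case by (simp add: add.commute abs_minus_commute)
qed (rule edge_path.refl)

text \<open>Ensures that the infimum in \<open>path_metric\<close> is taken over a nonempty set, so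
  that a lower bound for all paths is one for the distance.\<close>

lemma edge_path_exists:
  assumes "x \<in> mspace \<Gamma>" "y \<in> mspace \<Gamma>" shows "\<exists>r. edge_path G len \<gamma> x r y"
proof -
  obtain v where v: "v \<in> verts G" using verts_nonempty by auto
  define S where "S = {w \<in> verts G. \<exists>r. edge_path G len \<gamma> v r w}"
  have edge: "edge_path G len \<gamma> (tail G e) (len e) (head G e)" if "e \<in> arcs G" for e
    using edge_path_segment[of e G 0 len "len e" \<gamma>] that len_pos[OF that] chart_tail chart_head by simp
  have "S = verts G"
  proof (rule connected_closed)
    have "v \<in> S" using v edge_path.refl[of G len \<gamma> v] by (auto simp: S_def)
    then show "S \<noteq> {}" by auto
    show "tail G e \<in> S \<longleftrightarrow> head G e \<in> S" if "e \<in> arcs G" for e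
    proof -
      have "tail G e \<in> verts G" "head G e \<in> verts G" using that by auto
      then show ?thesis unfolding S_def
        using edge_path_trans[OF edge[OF that], of v] edge_path_trans[OF edge_path_sym[OF edge[OF that]], of v] by blast
    qed
  qed (auto simp: S_def)
  have from_v: "\<exists>r. edge_path G len \<gamma> v r x" if "x \<in> mspace \<Gamma>" for x
    using that
  proof (cases rule: point_cases)
    case 1
    then show ?thesis using \<open>S = verts G\<close> by (auto simp: S_def)
  next
    case (2 e t)
    have "tail G e \<in> S" using \<open>S = verts G\<close> 2 by simp
    then obtain r where "edge_path G len \<gamma> v r (\<gamma> e 0)" using chart_tail 2 by (auto simp: S_def)
    then show ?thesis using edge_path.step[of G len \<gamma> v r e 0 t] 2 by auto
  qed
  obtain r s where "edge_path G len \<gamma> v r x" "edge_path G len \<gamma> v s y"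
    using from_v[OF assms(1)] from_v[OF assms(2)] by blast
  from edge_path_trans[OF this(2) edge_path_sym[OF this(1)]] show ?thesis by blast
qed

lemma mdist_le:
  assumes "edge_path G len \<gamma> x r y" "x \<in> mspace \<Gamma>" shows "mdist \<Gamma> x y \<le> r"
  using assms path_metric[OF assms(2) edge_path_in_mspace[OF assms]]
  by (auto intro!: cInf_lower bdd_belowI[of _ 0] dest: edge_path_nonneg)

lemma mdist_chart_le:
  assumes "e \<in> arcs G" "s \<in> {0..len e}" "t \<in> {0..len e}"
  shows "mdist \<Gamma> (\<gamma> e s) (\<gamma> e t) \<le> \<bar>t - s\<bar>"
  using mdist_le[OF edge_path_segment[of e G s len t \<gamma>, OF assms]] chart_in_mspace[of e s] assms by auto

text \<open>Along a path, \<open>F\<close> changes by at most the length of each segment. Test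
  functions \<open>F\<close> thus bound distances from below, while single paths bound them from
  above.\<close>

lemma one_lipschitz_le_mdist:
  assumes lip: "\<And>e s t. \<lbrakk>e \<in> arcs G; s \<in> {0..len e}; t \<in> {0..len e}\<rbrakk> \<Longrightarrow> \<bar>F (\<gamma> e t) - F (\<gamma> e s)\<bar> \<le> \<bar>t - s\<bar>"
    and xy: "x \<in> mspace \<Gamma>" "y \<in> mspace \<Gamma>"
  shows "\<bar>F y - F x\<bar> \<le> mdist \<Gamma> x y"
proof -
  have "\<bar>F y - F x\<bar> \<le> r" if "edge_path G len \<gamma> x r y" for r y
    using that
  proof (induction rule: edge_path.induct)
    case (step r e s t)
    then show ?case using lip[of e s t] by auto
  qed auto
  then show ?thesis using edge_path_exists[OF xy] unfolding path_metric[OF xy] by (auto intro!: cInf_greatest)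
qed

text \<open>The path metric is inherited through \<open>path\<close>, and so is connectedness of
  \<open>G'\<close>: any two points are joined by an edge path, and a path that starts in a closed
  set of vertices never leaves that set and the edges issuing from it.\<close>

lemma refinement_is_model:
  assumes fin: "fin_digraph G'" and ne: "verts G' \<noteq> {}"
    and len_pos': "\<And>e. e \<in> arcs G' \<Longrightarrow> 0 < len' e"
    and verts': "verts G' \<subseteq> mspace \<Gamma>"
    and tail': "\<And>e. e \<in> arcs G' \<Longrightarrow> \<gamma>' e 0 = tail G' e"
    and head': "\<And>e. e \<in> arcs G' \<Longrightarrow> \<gamma>' e (len' e) = head G' e"
    and int': "bij_betw (\<lambda>(e, t). \<gamma>' e t) (SIGMA e:arcs G'. {0<..<len' e}) (mspace \<Gamma> - verts G')"
    and path: "\<And>x r y. edge_path G' len' \<gamma>' x r y = edge_path G len \<gamma> x r y"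
  shows "metric_graph_model \<Gamma> G' len' \<gamma>'"
proof -
  interpret G': fin_digraph G' by fact
  have interior_not: "\<gamma>' e t \<notin> verts G'" if "e \<in> arcs G'" "0 < t" "t < len' e" for e t
    using bij_betwE[OF int'] that by force
  have "Digraph_Component.connected G'"
    unfolding G'.connected_iff
  proof (intro conjI ne allI impI)
    fix S assume S: "S \<subseteq> verts G'" "S \<noteq> {}" and closed: "\<forall>e\<in>arcs G'. tail G' e \<in> S \<longleftrightarrow> head G' e \<in> S"
    \<comment> \<open>\<open>S\<close> together with the interiors of the edges issuing from it. As
      \<open>S\<close> is closed, each edge lies entirely inside or entirely outside
      \<open>X\<close>.\<close>
    define X where "X = S \<union> {\<gamma>' e t |e t. e \<in> arcs G' \<and> 0 < t \<and> t < len' e \<and> tail G' e \<in> S}"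
    have vert_X: "v \<in> X \<longleftrightarrow> v \<in> S" if "v \<in> verts G'" for v
      using that interior_not by (auto simp: X_def)
    have edge_X: "\<gamma>' e t \<in> X \<longleftrightarrow> tail G' e \<in> S" if e: "e \<in> arcs G'" "t \<in> {0..len' e}" for e t
    proof -
      consider "t = 0" | "t = len' e" | "0 < t" "t < len' e" using e by fastforce
      then show ?thesis
      proof cases
        case 3
        have "tail G' e \<in> S" if "\<gamma>' e t = \<gamma>' e' t'" "e' \<in> arcs G'" "0 < t'" "t' < len' e'" "tail G' e' \<in> S" for e' t'
          using bij_betw_inj[OF int', of "(e, t)" "(e', t')"] that e 3 by auto
        moreover have "\<gamma>' e t \<notin> S" using interior_not[OF e(1) 3] S(1) by blast
        ultimately show ?thesis unfolding X_def using e(1) 3 by blast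
      qed (use e closed vert_X tail' head' in auto)
    qed
    obtain u where u: "u \<in> S" using S by auto
    have "y \<in> X" if "edge_path G' len' \<gamma>' u r y" for r y
      using that
    proof (induction rule: edge_path.induct)
      case refl
      then show ?case using u by (simp add: X_def)
    qed (use edge_X in auto)
    moreover have "\<exists>r. edge_path G' len' \<gamma>' u r v" if "v \<in> verts G'" for v
      unfolding path using edge_path_exists[of u v] u S(1) verts' that by blast
    ultimately have "v \<in> S" if "v \<in> verts G'" for v using vert_X[OF that] that by blast
    then show "S = verts G'" using S(1) by blast
  qed
  then show ?thesis
    using len_pos' verts' tail' head' int' path_metric unfolding path[symmetric]
    by (intro metric_graph_model.intro metric_graph_model_axioms.intro fin) auto
qed

end

section \<open>Subdividing and relabelling models\<close>

text \<open>The label \<open>e\<close> keeps the initial part \<open>[0, t]\<close>, and the fresh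
  label \<open>k\<close> takes the rest, reparametrized to start at 0.\<close>

definition cut_graph :: "('a, 'e) pre_digraph \<Rightarrow> ('e \<Rightarrow> real \<Rightarrow> 'a) \<Rightarrow> 'e \<Rightarrow> real \<Rightarrow> 'e \<Rightarrow> ('a, 'e) pre_digraph" where
  "cut_graph G \<gamma> e t k = \<lparr>verts = insert (\<gamma> e t) (verts G), arcs = insert k (arcs G),
     tail = (tail G)(k := \<gamma> e t), head = (head G)(e := \<gamma> e t, k := head G e)\<rparr>"

definition cut_len :: "('e \<Rightarrow> real) \<Rightarrow> 'e \<Rightarrow> real \<Rightarrow> 'e \<Rightarrow> 'e \<Rightarrow> real" where
  "cut_len len e t k = len(e := t, k := len e - t)"

definition cut_chart :: "('e \<Rightarrow> real \<Rightarrow> 'a) \<Rightarrow> 'e \<Rightarrow> real \<Rightarrow> 'e \<Rightarrow> 'e \<Rightarrow> real \<Rightarrow> 'a" where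
  "cut_chart \<gamma> e t k = \<gamma>(k := \<lambda>s. \<gamma> e (t + s))"

lemma cut_simps [simp]:
  "verts (cut_graph G \<gamma> e t k) = insert (\<gamma> e t) (verts G)"
  "arcs (cut_graph G \<gamma> e t k) = insert k (arcs G)"
  "tail (cut_graph G \<gamma> e t k) f = (if f = k then \<gamma> e t else tail G f)"
  "head (cut_graph G \<gamma> e t k) f = (if f = k then head G e else if f = e then \<gamma> e t else head G f)"
  "cut_len len e t k f = (if f = k then len e - t else if f = e then t else len f)"
  "cut_chart \<gamma> e t k f s = (if f = k then \<gamma> e (t + s) else \<gamma> f s)"
  by (simp_all add: cut_graph_def cut_len_def cut_chart_def)

context metric_graph_model
begin

text \<open>A segment of \<open>e\<close> on one side of \<open>t\<close> is a segment of one of the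
  two parts; a segment across \<open>t\<close> is replaced by two whose lengths add up. So the path
  metric is unchanged.\<close>

lemma cut_edge_path:
  assumes e: "e \<in> arcs G" "0 < t" "t < len e" and k: "k \<notin> arcs G"
  shows "edge_path (cut_graph G \<gamma> e t k) (cut_len len e t k) (cut_chart \<gamma> e t k) x r y = edge_path G len \<gamma> x r y"
    (is "edge_path ?G ?len ?\<gamma> x r y = _")
proof
  have ke: "k \<noteq> e" using e k by auto
  show "edge_path G len \<gamma> x r y" if "edge_path ?G ?len ?\<gamma> x r y"
    using that
  proof (induction rule: edge_path.induct)
    case (step r f a b)
    consider "f = k" | "f = e" | "f \<noteq> k" "f \<noteq> e" by blast
    then show ?case
    proof cases
      case 1
      show ?thesis
        by (rule edge_path_stepI[OF step.IH, of e "t + a" "t + b"]) (use 1 step e in auto)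
    next
      case 2
      show ?thesis
        by (rule edge_path_stepI[OF step.IH, of e a b]) (use 2 step e ke in auto)
    next
      case 3
      show ?thesis
        by (rule edge_path_stepI[OF step.IH, of f a b]) (use 3 step e ke in auto)
    qed
  qed (rule edge_path.refl)
  show "edge_path ?G ?len ?\<gamma> x r y" if "edge_path G len \<gamma> x r y"
    using that
  proof (induction rule: edge_path.induct)
    case (step r f a b)
    show ?case
    proof (cases "f = e")
      case False
      show ?thesis
        by (rule edge_path_stepI[OF step.IH, of f a b]) (use False step k in auto)
    next
      case True
      have low: "edge_path ?G ?len ?\<gamma> x (r + \<bar>b - a\<bar>) (\<gamma> e b)"
        if "edge_path ?G ?len ?\<gamma> x r (\<gamma> e a)" "0 \<le> a" "a \<le> t" "0 \<le> b" "b \<le> t" for a b r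
        by (rule edge_path_stepI[OF that(1), of e a b]) (use that ke e in auto)
      have high: "edge_path ?G ?len ?\<gamma> x (r + \<bar>b - a\<bar>) (\<gamma> e b)"
        if "edge_path ?G ?len ?\<gamma> x r (\<gamma> e a)" "t \<le> a" "a \<le> len e" "t \<le> b" "b \<le> len e" for a b r
        by (rule edge_path_stepI[OF that(1), of k "a - t" "b - t"]) (use that ke e in auto)
      have ab: "0 \<le> a" "a \<le> len e" "0 \<le> b" "b \<le> len e" using step.hyps True by auto
      have IH: "edge_path ?G ?len ?\<gamma> x r (\<gamma> e a)" using step.IH unfolding True .
      consider "a \<le> t" "b \<le> t" | "t \<le> a" "t \<le> b" | "a \<le> t" "t \<le> b" | "b \<le> t" "t \<le> a" by linarith
      then have "edge_path ?G ?len ?\<gamma> x (r + \<bar>b - a\<bar>) (\<gamma> e b)"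
      proof cases
        case 3
        have "edge_path ?G ?len ?\<gamma> x (r + \<bar>t - a\<bar> + \<bar>b - t\<bar>) (\<gamma> e b)"
          by (rule high[OF low[OF IH]]) (use 3 ab e in auto)
        moreover have "r + \<bar>t - a\<bar> + \<bar>b - t\<bar> = r + \<bar>b - a\<bar>" using 3 by linarith
        ultimately show ?thesis by (simp only:)
      next
        case 4
        have "edge_path ?G ?len ?\<gamma> x (r + \<bar>t - a\<bar> + \<bar>b - t\<bar>) (\<gamma> e b)"
          by (rule low[OF high[OF IH]]) (use 4 ab e in auto)
        moreover have "r + \<bar>t - a\<bar> + \<bar>b - t\<bar> = r + \<bar>b - a\<bar>" using 4 by linarith
        ultimately show ?thesis by (simp only:)
      next
        case 1
        show ?thesis by (rule low[OF IH]) (use 1 ab in auto)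
      next
        case 2
        show ?thesis by (rule high[OF IH]) (use 2 ab in auto)
      qed
      then show ?thesis unfolding True .
    qed
  qed (rule edge_path.refl)
qed

lemma cut_is_model:
  assumes e: "e \<in> arcs G" "0 < t" "t < len e" and k: "k \<notin> arcs G"
  shows "metric_graph_model \<Gamma> (cut_graph G \<gamma> e t k) (cut_len len e t k) (cut_chart \<gamma> e t k)"
    (is "metric_graph_model _ ?G ?len ?\<gamma>")
proof (rule refinement_is_model)
  have ke: "k \<noteq> e" using e k by auto
  show "fin_digraph ?G"
    by unfold_locales (use e in \<open>auto simp: cut_graph_def\<close>)
  show "verts ?G \<subseteq> mspace \<Gamma>" using verts_subset chart_in_mspace[of e t] e by (simp add: cut_graph_def)
  show "0 < ?len f" if "f \<in> arcs ?G" for f using that e len_pos by (auto simp: cut_graph_def cut_len_def)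
  show "?\<gamma> f 0 = tail ?G f" if "f \<in> arcs ?G" for f
    using that chart_tail by (auto simp: cut_graph_def cut_chart_def)
  show "?\<gamma> f (?len f) = head ?G f" if "f \<in> arcs ?G" for f
    using that chart_head e ke by (auto simp: cut_graph_def cut_chart_def cut_len_def)
  define D where "D = (SIGMA f:arcs G. {0<..<len f})"
  \<comment> \<open>\<open>\<pi>\<close> undoes the cut on interior points and \<open>\<rho>\<close>
    inverts it. Only \<open>(e, t)\<close> is missed, which has become a vertex.\<close>
  define \<pi> where "\<pi> = (\<lambda>(f, s). if f = k then (e, t + s) else (f, s))"
  define \<rho> where "\<rho> = (\<lambda>(f, s). if f = e \<and> t < s then (k, s - t) else (f, s))"
  have "bij_betw \<pi> (SIGMA f:arcs ?G. {0<..<?len f}) (D - {(e, t)})"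
    by (rule bij_betw_byWitness[of _ \<rho>])
      (use e k ke in \<open>auto simp: \<pi>_def \<rho>_def D_def cut_graph_def cut_len_def split: if_splits\<close>)
  moreover have "bij_betw (\<lambda>(f, s). \<gamma> f s) (D - {(e, t)}) (mspace \<Gamma> - verts G - {\<gamma> e t})"
    using bij_betw_DiffI[OF chart_interior[folded D_def], of "{(e, t)}" "{\<gamma> e t}"] chart_interior_in[OF e] e
    by (simp add: D_def bij_betw_def)
  ultimately have "bij_betw ((\<lambda>(f, s). \<gamma> f s) \<circ> \<pi>) (SIGMA f:arcs ?G. {0<..<?len f}) (mspace \<Gamma> - verts G - {\<gamma> e t})"
    by (rule bij_betw_trans)
  moreover have "(\<lambda>(f, s). \<gamma> f s) \<circ> \<pi> = (\<lambda>(f, s). ?\<gamma> f s)"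
    by (auto simp: \<pi>_def cut_chart_def fun_eq_iff)
  moreover have "mspace \<Gamma> - verts G - {\<gamma> e t} = mspace \<Gamma> - verts ?G" by (auto simp: cut_graph_def)
  ultimately show "bij_betw (\<lambda>(f, s). ?\<gamma> f s) (SIGMA f:arcs ?G. {0<..<?len f}) (mspace \<Gamma> - verts ?G)" by simp
qed (simp, rule cut_edge_path[OF assms])

lemma relabelled_model:
  assumes inj: "inj_on j (arcs G)"
  obtains G' len' \<gamma>' where "metric_graph_model \<Gamma> G' len' \<gamma>'" "verts G' = verts G" "arcs G' = j ` arcs G"
    "\<And>e. e \<in> arcs G \<Longrightarrow> len' (j e) = len e \<and> \<gamma>' (j e) = \<gamma> e"
proof -
  define i where "i = inv_into (arcs G) j"
  have i: "i (j e) = e" if "e \<in> arcs G" for e using inv_into_f_f[OF inj that] by (simp add: i_def)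
  define G' where "G' = \<lparr>verts = verts G, arcs = j ` arcs G, tail = tail G \<circ> i, head = head G \<circ> i\<rparr>"
  have path1: "edge_path G' (len \<circ> i) (\<gamma> \<circ> i) x r y" if "edge_path G len \<gamma> x r y" for x r y
    using that
  proof (induction rule: edge_path.induct)
    case (step r e s t)
    show ?case
      by (rule edge_path_stepI[OF step.IH, of "j e" s t]) (use step in \<open>auto simp: G'_def i\<close>)
  qed (rule edge_path.refl)
  have path2: "edge_path G len \<gamma> x r y" if "edge_path G' (len \<circ> i) (\<gamma> \<circ> i) x r y" for x r y
    using that
  proof (induction rule: edge_path.induct)
    case (step r f s t)
    then obtain e where "e \<in> arcs G" "f = j e" by (auto simp: G'_def)
    then show ?case using step edge_path.step[of G len \<gamma> x r e s t] i by simp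
  qed (rule edge_path.refl)
  have bij: "bij_betw (\<lambda>(e, t). (i e, t)) (SIGMA e:arcs G'. {0<..<(len \<circ> i) e}) (SIGMA e:arcs G. {0<..<len e})"
    by (rule bij_betw_byWitness[of _ "\<lambda>(e, t). (j e, t)"]) (auto simp: G'_def i)
  have "metric_graph_model \<Gamma> G' (len \<circ> i) (\<gamma> \<circ> i)"
  proof (rule refinement_is_model)
    show "fin_digraph G'" by unfold_locales (auto simp: G'_def i)
    have "(\<lambda>(e, t). \<gamma> e t) \<circ> (\<lambda>(e, t). (i e, t)) = (\<lambda>(e, t). (\<gamma> \<circ> i) e t)" by (simp add: fun_eq_iff)
    with bij_betw_trans[OF bij chart_interior]
    show "bij_betw (\<lambda>(e, t). (\<gamma> \<circ> i) e t) (SIGMA e:arcs G'. {0<..<(len \<circ> i) e}) (mspace \<Gamma> - verts G')"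
      by (simp add: G'_def)
    show "edge_path G' (len \<circ> i) (\<gamma> \<circ> i) x r y = edge_path G len \<gamma> x r y" for x r y
      using path1 path2 by blast
  qed (use verts_nonempty verts_subset chart_tail chart_head len_pos in \<open>auto simp: G'_def i\<close>)
  then show ?thesis by (rule that) (auto simp: G'_def i)
qed

text \<open>\<open>PL_int\<close> speaks of models labelled by natural numbers. These also supply a
  fresh label for each cut, which the original type of labels may not have.\<close>

lemma nat_model:
  obtains G' :: "('a, nat) pre_digraph" and len' \<gamma>' j where "metric_graph_model \<Gamma> G' len' \<gamma>'" "verts G' = verts G"
    "inj_on j (arcs G)" "arcs G' = j ` arcs G" "\<And>e. e \<in> arcs G \<Longrightarrow> len' (j e) = len e \<and> \<gamma>' (j e) = \<gamma> e"
proof -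
  obtain j :: "'e \<Rightarrow> nat" where inj: "inj_on j (arcs G)"
    using finite_imp_inj_to_nat_seg[OF finite_arcs] by blast
  show ?thesis by (rule relabelled_model[OF inj], rule that[OF _ _ inj])
qed

end


section \<open>The local structure of the metric\<close>

text \<open>For piecewise linear \<open>f\<close> and small \<open>r\<close> this is \<open>r\<close> times the sum of the outgoing slopes of \<open>f\<close>
  at \<open>x\<close>, which shows that the latter does not depend on the model.\<close>

definition sphere_sum :: "'a metric \<Rightarrow> ('a \<Rightarrow> real) \<Rightarrow> 'a \<Rightarrow> real \<Rightarrow> real" where
  "sphere_sum \<Gamma> f x r = (\<Sum>y\<in>{y \<in> mspace \<Gamma>. mdist \<Gamma> x y = r}. f y - f x)"

text \<open>A description of \<^const>\<open>PL_int\<close> without models. It makes closure under differences evident,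
  so that no common refinement of two models is needed.\<close>

definition locally_conic :: "'a metric \<Rightarrow> ('a \<Rightarrow> real) \<Rightarrow> bool" where
  "locally_conic \<Gamma> f \<longleftrightarrow> (\<forall>x\<in>mspace \<Gamma>. \<exists>\<rho>>0. \<exists>B. \<forall>y\<in>mspace \<Gamma>. mdist \<Gamma> x y < \<rho> \<longrightarrow>
     (\<exists>m::int. \<bar>m\<bar> \<le> B \<and> f y = f x + of_int m * mdist \<Gamma> x y))"

lemma linear_on_edgesD:
  assumes "linear_on_edges G len \<gamma> f m" "e \<in> arcs G" "0 \<le> t" "t \<le> len e"
  shows "f (\<gamma> e t) = f (\<gamma> e 0) + of_int (m e) * t"
  using assms(1)[unfolded linear_on_edges_def, THEN bspec, OF assms(2), THEN bspec, of t] assms(3,4) by simp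

lemma eventually_at_right_less: "0 < (\<rho>::real) \<Longrightarrow> \<forall>\<^sub>F r in at_right 0. 0 < r \<and> r < \<rho>"
  unfolding eventually_at_right_field by blast

context metric_graph_model
begin

text \<open>The factor 2 keeps the neighbourhoods of the two ends of an edge disjoint, also when the
  edge is a loop.\<close>

lemma small_radius: obtains \<rho> where "0 < \<rho>" "\<And>e. e \<in> arcs G \<Longrightarrow> 2 * \<rho> < len e"
proof -
  define \<rho> where "\<rho> = Min (insert 1 (len ` arcs G)) / 3"
  have "0 < Min (insert 1 (len ` arcs G))" using len_pos by (subst Min_gr_iff) auto
  then have "0 < \<rho>" by (simp add: \<rho>_def)
  moreover have "2 * \<rho> < len e" if "e \<in> arcs G" for e
  proof -
    have "3 * \<rho> \<le> len e" unfolding \<rho>_def using that by (simp add: Min_le)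
    then show ?thesis using \<open>0 < \<rho>\<close> by linarith
  qed
  ultimately show ?thesis by (rule that)
qed

text \<open>Around a vertex the metric is that of a star with one ray for each half-edge, hence two
  for a loop. The edge itself bounds a distance from above, a 1-Lipschitz function from
  below.\<close>

lemma vertex_nbhd:
  assumes x: "x \<in> verts G"
  obtains \<rho> where "0 < \<rho>" "\<And>e. e \<in> arcs G \<Longrightarrow> 2 * \<rho> < len e"
    "\<And>e s. \<lbrakk>e \<in> out_arcs G x; 0 \<le> s; s < \<rho>\<rbrakk> \<Longrightarrow> mdist \<Gamma> x (\<gamma> e s) = s"
    "\<And>e s. \<lbrakk>e \<in> in_arcs G x; 0 \<le> s; s < \<rho>\<rbrakk> \<Longrightarrow> mdist \<Gamma> x (\<gamma> e (len e - s)) = s"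
    "\<And>y. \<lbrakk>y \<in> mspace \<Gamma>; y \<noteq> x; mdist \<Gamma> x y < \<rho>\<rbrakk> \<Longrightarrow>
      (\<exists>e\<in>out_arcs G x. y = \<gamma> e (mdist \<Gamma> x y)) \<or> (\<exists>e\<in>in_arcs G x. y = \<gamma> e (len e - mdist \<Gamma> x y))"
proof -
  obtain \<rho> where \<rho>: "0 < \<rho>" "\<And>e. e \<in> arcs G \<Longrightarrow> 2 * \<rho> < len e" using small_radius by metis
  \<comment> \<open>the distance from \<open>x\<close>, cut off at \<open>\<rho>\<close>; being 1-Lipschitz, it bounds \<^term>\<open>mdist \<Gamma> x\<close> from below\<close>
  define \<phi> where "\<phi> e t = min \<rho> (min (if tail G e = x then t else \<rho>) (if head G e = x then len e - t else \<rho>))" for e t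
  have ends: "\<phi> e 0 = (if tail G e = x then 0 else \<rho>)" "\<phi> e (len e) = (if head G e = x then 0 else \<rho>)"
    if "e \<in> arcs G" for e
    using \<rho>(1) \<rho>(2)[OF that] by (auto simp: \<phi>_def)
  obtain F where F: "\<And>v. v \<in> verts G \<Longrightarrow> F v = (if v = x then 0 else \<rho>)"
    "\<And>e t. \<lbrakk>e \<in> arcs G; 0 \<le> t; t \<le> len e\<rbrakk> \<Longrightarrow> F (\<gamma> e t) = \<phi> e t"
    using chart_function_exists[of \<phi> "\<lambda>v. if v = x then 0 else \<rho>", OF ends] by blast
  have xm: "x \<in> mspace \<Gamma>" using x verts_subset by blast
  have le: "F y \<le> mdist \<Gamma> x y" if "y \<in> mspace \<Gamma>" for y
  proof -
    have "\<bar>F y - F x\<bar> \<le> mdist \<Gamma> x y"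
    proof (rule one_lipschitz_le_mdist[OF _ xm that])
      fix e s t assume "e \<in> arcs G" "s \<in> {0..len e}" "t \<in> {0..len e}"
      then show "\<bar>F (\<gamma> e t) - F (\<gamma> e s)\<bar> \<le> \<bar>t - s\<bar>"
        by (simp add: F(2)) (auto simp: \<phi>_def min_def)
    qed
    then show ?thesis using F(1)[OF x] by simp
  qed
  have out: "mdist \<Gamma> x (\<gamma> e s) = s" if "e \<in> out_arcs G x" "0 \<le> s" "s < \<rho>" for e s
  proof -
    have e: "e \<in> arcs G" "tail G e = x" using that by auto
    have "F (\<gamma> e s) = s" using \<rho>(1) \<rho>(2)[OF e(1)] that e by (subst F(2)) (auto simp: \<phi>_def)
    moreover have "mdist \<Gamma> x (\<gamma> e s) \<le> s"
      using mdist_chart_le[of e 0 s] chart_tail[OF e(1)] \<rho>(1) \<rho>(2)[OF e(1)] that e by simp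
    moreover have "F (\<gamma> e s) \<le> mdist \<Gamma> x (\<gamma> e s)"
      using \<rho>(1) \<rho>(2)[OF e(1)] that e by (intro le chart_in_mspace) auto
    ultimately show ?thesis by linarith
  qed
  have inn: "mdist \<Gamma> x (\<gamma> e (len e - s)) = s" if "e \<in> in_arcs G x" "0 \<le> s" "s < \<rho>" for e s
  proof -
    have e: "e \<in> arcs G" "head G e = x" using that by auto
    have "F (\<gamma> e (len e - s)) = s" using \<rho>(1) \<rho>(2)[OF e(1)] that e by (subst F(2)) (auto simp: \<phi>_def)
    moreover have "mdist \<Gamma> x (\<gamma> e (len e - s)) \<le> s"
      using mdist_chart_le[of e "len e" "len e - s"] chart_head[OF e(1)] \<rho>(1) \<rho>(2)[OF e(1)] that e by simp
    moreover have "F (\<gamma> e (len e - s)) \<le> mdist \<Gamma> x (\<gamma> e (len e - s))"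
      using \<rho>(1) \<rho>(2)[OF e(1)] that e by (intro le chart_in_mspace) auto
    ultimately show ?thesis by linarith
  qed
  have ball: "(\<exists>e\<in>out_arcs G x. y = \<gamma> e (mdist \<Gamma> x y)) \<or> (\<exists>e\<in>in_arcs G x. y = \<gamma> e (len e - mdist \<Gamma> x y))"
    if y: "y \<in> mspace \<Gamma>" "y \<noteq> x" "mdist \<Gamma> x y < \<rho>" for y
  proof -
    have small: "F y < \<rho>" using le[OF y(1)] y(3) by linarith
    from y(1) show ?thesis
    proof (cases rule: point_cases)
      case 1
      then show ?thesis using F(1) small y by simp
    next
      case (2 e t)
      then have "\<phi> e t < \<rho>" using F(2)[of e t] small by simp
      then consider "tail G e = x" "t < \<rho>" | "head G e = x" "len e - t < \<rho>"
        by (auto simp: \<phi>_def min_def split: if_splits)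
      then show ?thesis
      proof cases
        case 1
        then have "e \<in> out_arcs G x" using 2 by simp
        with out[OF this, of t] 1 2 show ?thesis by (intro disjI1 bexI[of _ e]) auto
      next
        case b: 2
        then have "e \<in> in_arcs G x" using 2 by simp
        with inn[OF this, of "len e - t"] b 2 show ?thesis by (intro disjI2 bexI[of _ e]) auto
      qed
    qed
  qed
  show ?thesis by (rule that[OF \<rho> out inn ball])
qed

text \<open>A cut turns an interior point into a vertex with two half-edges, so that facts about
  vertices cover all points of \<Gamma>. The last clause holds because both parts of
  \<open>e\<close> inherit its slope.\<close>

lemma interior_cut:
  assumes e: "e \<in> arcs G" "0 < t" "t < len e"
  obtains G' :: "('a, nat) pre_digraph" and len' \<gamma>' e' k where "metric_graph_model \<Gamma> G' len' \<gamma>'"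
    "verts G' = insert (\<gamma> e t) (verts G)"
    "out_arcs G' (\<gamma> e t) = {k}" "in_arcs G' (\<gamma> e t) = {e'}"
    "len' e' = t" "\<And>s. \<gamma>' e' s = \<gamma> e s" "\<And>s. \<gamma>' k s = \<gamma> e (t + s)"
    "\<And>f m. linear_on_edges G len \<gamma> f m \<Longrightarrow> \<exists>m'. linear_on_edges G' len' \<gamma>' f m'"
proof -
  obtain N :: "('a, nat) pre_digraph" and l g j where N: "metric_graph_model \<Gamma> N l g" "verts N = verts G"
    and j: "inj_on j (arcs G)" "arcs N = j ` arcs G" "\<And>e. e \<in> arcs G \<Longrightarrow> l (j e) = len e \<and> g (j e) = \<gamma> e"
    using nat_model by metis
  interpret N: metric_graph_model \<Gamma> N l g by fact
  obtain k where k: "k \<notin> arcs N" using ex_new_if_finite[OF infinite_UNIV_nat N.finite_arcs] by blast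
  have je: "j e \<in> arcs N" "l (j e) = len e" "g (j e) = \<gamma> e" using j e by auto
  have ke: "k \<noteq> j e" using je k by blast
  have x: "\<gamma> e t \<notin> verts N" using chart_interior_in[OF e] N by simp
  have tl: "tail N f \<noteq> \<gamma> e t" "head N f \<noteq> \<gamma> e t" if "f \<in> arcs N" for f
    using that x N.tail_in_verts N.head_in_verts by metis+
  show ?thesis
  proof (rule that)
    show "metric_graph_model \<Gamma> (cut_graph N g (j e) t k) (cut_len l (j e) t k) (cut_chart g (j e) t k)"
      by (rule N.cut_is_model) (use je e k in auto)
    show "out_arcs (cut_graph N g (j e) t k) (\<gamma> e t) = {k}"
      using tl je by (auto simp: out_arcs_def)
    show "in_arcs (cut_graph N g (j e) t k) (\<gamma> e t) = {j e}"
      using tl je ke by (auto simp: in_arcs_def)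
    fix f m assume lin: "linear_on_edges G len \<gamma> f m"
    define m' where "m' = (\<lambda>a. m (inv_into (arcs G) j (if a = k then j e else a)))"
    have inv: "inv_into (arcs G) j (j a) = a" if "a \<in> arcs G" for a using inv_into_f_f[OF j(1) that] .
    have m'k: "m' k = m e" "\<And>a. a \<in> arcs G \<Longrightarrow> m' (j a) = m a" using inv e k j(2) by (auto simp: m'_def)
    have l: "f (\<gamma> a s) = f (\<gamma> a 0) + m a * s" if "a \<in> arcs G" "0 \<le> s" "s \<le> len a" for a and s :: real
      by (rule linear_on_edgesD[OF lin that])
    have "linear_on_edges (cut_graph N g (j e) t k) (cut_len l (j e) t k) (cut_chart g (j e) t k) f m'"
      unfolding linear_on_edges_def
    proof (intro ballI)
      fix a s assume a: "a \<in> arcs (cut_graph N g (j e) t k)" "s \<in> {0..cut_len l (j e) t k a}"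
      show "f (cut_chart g (j e) t k a s) = f (cut_chart g (j e) t k a 0) + m' a * s"
      proof (cases "a = k")
        case True
        then show ?thesis using l[of e "t + s"] l[of e t] a e je m'k by (simp add: algebra_simps)
      next
        case False
        then obtain b where b: "b \<in> arcs G" "a = j b" using a j by auto
        have "b = e" if "a = j e" using that b j(1) e(1) by (auto dest: inj_onD)
        then have "s \<le> len b" "0 \<le> s" using a b False j(3)[OF b(1)] e je by (auto split: if_splits)
        then show ?thesis using l[OF b(1), of s] b j(3)[OF b(1)] m'k \<open>0 \<le> s\<close> \<open>s \<le> len b\<close> False by simp
      qed
    qed
    then show "\<exists>m'. linear_on_edges (cut_graph N g (j e) t k) (cut_len l (j e) t k) (cut_chart g (j e) t k) f m'"
      by (rule exI[of _ m'])
  qed (use N je ke in simp_all)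
qed

text \<open>A small sphere around \<open>x\<close> has one point on each half-edge at
  \<open>x\<close>, and two distinct ones on a loop. How small it must be depends on the model
  alone, hence the quantifier over \<open>f\<close> inside the eventuality.\<close>

lemma vertex_sphere_sum:
  assumes x: "x \<in> verts G"
  shows "\<forall>\<^sub>F r in at_right 0. \<forall>f. sphere_sum \<Gamma> f x r =
    (\<Sum>e\<in>out_arcs G x. f (\<gamma> e r) - f x) + (\<Sum>e\<in>in_arcs G x. f (\<gamma> e (len e - r)) - f x)"
proof -
  obtain \<rho> where \<rho>: "0 < \<rho>" "\<And>e. e \<in> arcs G \<Longrightarrow> 2 * \<rho> < len e"
    and out: "\<And>e s. \<lbrakk>e \<in> out_arcs G x; 0 \<le> s; s < \<rho>\<rbrakk> \<Longrightarrow> mdist \<Gamma> x (\<gamma> e s) = s"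
    and inn: "\<And>e s. \<lbrakk>e \<in> in_arcs G x; 0 \<le> s; s < \<rho>\<rbrakk> \<Longrightarrow> mdist \<Gamma> x (\<gamma> e (len e - s)) = s"
    and ball: "\<And>y. \<lbrakk>y \<in> mspace \<Gamma>; y \<noteq> x; mdist \<Gamma> x y < \<rho>\<rbrakk> \<Longrightarrow>
      (\<exists>e\<in>out_arcs G x. y = \<gamma> e (mdist \<Gamma> x y)) \<or> (\<exists>e\<in>in_arcs G x. y = \<gamma> e (len e - mdist \<Gamma> x y))"
    using vertex_nbhd[OF x] by blast
  have "sphere_sum \<Gamma> f x r =
    (\<Sum>e\<in>out_arcs G x. f (\<gamma> e r) - f x) + (\<Sum>e\<in>in_arcs G x. f (\<gamma> e (len e - r)) - f x)"
    if r: "0 < r \<and> r < \<rho>" for r f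
  proof -
    let ?A = "(\<lambda>e. \<gamma> e r) ` out_arcs G x" and ?B = "(\<lambda>e. \<gamma> e (len e - r)) ` in_arcs G x"
    have xm: "x \<in> mspace \<Gamma>" using x verts_subset by blast
    have lr: "r < len e - r" "0 < len e - r" "len e - r < len e" "r < len e" if "e \<in> arcs G" for e
      using \<rho>(2)[OF that] r by linarith+
    have sphere: "{y \<in> mspace \<Gamma>. mdist \<Gamma> x y = r} = ?A \<union> ?B"
    proof (intro subset_antisym subsetI)
      fix y assume y: "y \<in> {y \<in> mspace \<Gamma>. mdist \<Gamma> x y = r}"
      then have "0 < mdist \<Gamma> x y" using r by simp
      moreover have "mdist \<Gamma> x x = 0" using xm by simp
      ultimately have "y \<noteq> x" by (metis less_irrefl)
      then show "y \<in> ?A \<union> ?B" using ball[of y] y r by auto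
    next
      fix y assume "y \<in> ?A \<union> ?B"
      then show "y \<in> {y \<in> mspace \<Gamma>. mdist \<Gamma> x y = r}"
        using out[of _ r] inn[of _ r] r chart_in_mspace lr by (force simp: less_imp_le)
    qed
    have injA: "inj_on (\<lambda>e. \<gamma> e r) (out_arcs G x)"
      using chart_interior_inj[of _ r _ r] r lr by (auto intro!: inj_onI)
    have injB: "inj_on (\<lambda>e. \<gamma> e (len e - r)) (in_arcs G x)"
    proof (rule inj_onI)
      fix a b assume "a \<in> in_arcs G x" "b \<in> in_arcs G x" "\<gamma> a (len a - r) = \<gamma> b (len b - r)"
      then show "a = b" using chart_interior_inj(1)[of a "len a - r" b "len b - r"] lr[of a] lr[of b] r by simp
    qed
    have "\<gamma> a r \<noteq> \<gamma> b (len b - r)" if "a \<in> out_arcs G x" "b \<in> in_arcs G x" for a b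
      using chart_interior_inj[of a r b "len b - r"] lr[of a] lr[of b] that r by auto
    then have "?A \<inter> ?B = {}" by auto
    then show ?thesis unfolding sphere_sum_def sphere
      by (subst sum.union_disjoint) (auto simp: sum.reindex[OF injA] sum.reindex[OF injB])
  qed
  then show ?thesis using eventually_at_right_less[OF \<rho>(1)] by (auto elim: eventually_mono)
qed

lemma interior_sphere_sum:
  assumes e: "e \<in> arcs G" "0 < t" "t < len e"
  shows "\<forall>\<^sub>F r in at_right 0. \<forall>f. sphere_sum \<Gamma> f (\<gamma> e t) r = f (\<gamma> e (t + r)) + f (\<gamma> e (t - r)) - 2 * f (\<gamma> e t)"
proof -
  obtain G' :: "('a, nat) pre_digraph" and len' \<gamma>' e' k where M: "metric_graph_model \<Gamma> G' len' \<gamma>'"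
    and "verts G' = insert (\<gamma> e t) (verts G)"
    and G': "out_arcs G' (\<gamma> e t) = {k}" "in_arcs G' (\<gamma> e t) = {e'}"
    "len' e' = t" "\<And>s. \<gamma>' e' s = \<gamma> e s" "\<And>s. \<gamma>' k s = \<gamma> e (t + s)"
    using interior_cut[OF e] by metis
  then have "\<gamma> e t \<in> verts G'" by simp
  from metric_graph_model.vertex_sphere_sum[OF M this] show ?thesis by (simp add: G' algebra_simps)
qed

text \<open>At a vertex the slopes are those of the incident half-edges; any other point is first
  made a vertex by a cut.\<close>

lemma linear_imp_locally_conic:
  assumes "linear_on_edges G len \<gamma> f m" shows "locally_conic \<Gamma> f"
proof -
  have at_vertex: "\<exists>\<rho>>0. \<exists>B. \<forall>y\<in>mspace \<Gamma>. mdist \<Gamma> x y < \<rho> \<longrightarrow> (\<exists>m::int. \<bar>m\<bar> \<le> B \<and> f y = f x + of_int m * mdist \<Gamma> x y)"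
    if M: "metric_graph_model \<Gamma> N l g" and lin: "linear_on_edges N l g f m" and x: "x \<in> verts N"
    for N :: "('a, 'n) pre_digraph" and l g m x
  proof -
    interpret N: metric_graph_model \<Gamma> N l g by fact
    obtain \<rho> where \<rho>: "0 < \<rho>" "\<And>e. e \<in> arcs N \<Longrightarrow> 2 * \<rho> < l e"
      and ball: "\<And>y. \<lbrakk>y \<in> mspace \<Gamma>; y \<noteq> x; mdist \<Gamma> x y < \<rho>\<rbrakk> \<Longrightarrow>
        (\<exists>e\<in>out_arcs N x. y = g e (mdist \<Gamma> x y)) \<or> (\<exists>e\<in>in_arcs N x. y = g e (l e - mdist \<Gamma> x y))"
      using N.vertex_nbhd[OF x] by metis
    have L: "f (g e s) = f (g e 0) + m e * s" if "e \<in> arcs N" "0 \<le> s" "s \<le> l e" for e and s :: real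
      by (rule linear_on_edgesD[OF lin that])
    \<comment> \<open>One bound for all slopes. It confines the slopes to finitely many integers, on
      which the converse direction rests.\<close>
    have m: "\<bar>m e\<bar> \<le> (\<Sum>e\<in>arcs N. \<bar>m e\<bar>)" if "e \<in> arcs N" for e
      by (rule member_le_sum[of e _ "\<lambda>e. \<bar>m e\<bar>"]) (use that in auto)
    have "\<exists>n::int. \<bar>n\<bar> \<le> (\<Sum>e\<in>arcs N. \<bar>m e\<bar>) \<and> f y = f x + of_int n * mdist \<Gamma> x y"
      if y: "y \<in> mspace \<Gamma>" "mdist \<Gamma> x y < \<rho>" for y
    proof (cases "y = x")
      case True
      then show ?thesis by (intro exI[of _ 0]) (auto simp: sum_nonneg)
    next
      case False
      define d where "d = mdist \<Gamma> x y"
      have d: "0 \<le> d" "d < \<rho>" using y by (simp_all add: d_def)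
      from ball[OF y(1) False y(2), folded d_def] show ?thesis
      proof (elim disjE bexE)
        fix e assume e: "e \<in> out_arcs N x" "y = g e d"
        then have "e \<in> arcs N" "g e 0 = x" using N.chart_tail by auto
        then show ?thesis unfolding d_def[symmetric] using L[of e d] \<rho>(2)[of e] d e(2) m[of e]
          by (intro exI[of _ "m e"]) simp
      next
        fix e assume e: "e \<in> in_arcs N x" "y = g e (l e - d)"
        then have "e \<in> arcs N" "g e (l e) = x" using N.chart_head by auto
        then show ?thesis unfolding d_def[symmetric]
          using L[of e "l e - d"] L[of e "l e"] \<rho>(2)[of e] d e(2) m[of e]
          by (intro exI[of _ "- m e"]) (simp add: algebra_simps)
      qed
    qed
    then show ?thesis using \<rho>(1) by blast
  qed
  show ?thesis unfolding locally_conic_def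
  proof
    fix x assume "x \<in> mspace \<Gamma>"
    then show "\<exists>\<rho>>0. \<exists>B. \<forall>y\<in>mspace \<Gamma>. mdist \<Gamma> x y < \<rho> \<longrightarrow> (\<exists>m::int. \<bar>m\<bar> \<le> B \<and> f y = f x + of_int m * mdist \<Gamma> x y)"
    proof (cases rule: point_cases)
      case 1
      obtain N :: "('a, nat) pre_digraph" and l g j where N: "metric_graph_model \<Gamma> N l g" "verts N = verts G"
        and j: "inj_on j (arcs G)" "arcs N = j ` arcs G" "\<And>e. e \<in> arcs G \<Longrightarrow> l (j e) = len e \<and> g (j e) = \<gamma> e"
        using nat_model by metis
      have "linear_on_edges N l g f (m \<circ> inv_into (arcs G) j)"
        unfolding linear_on_edges_def
      proof (intro ballI)
        fix a s assume a: "a \<in> arcs N" "s \<in> {0..l a}"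
        then obtain b where b: "b \<in> arcs G" "a = j b" using j by auto
        show "f (g a s) = f (g a 0) + real_of_int ((m \<circ> inv_into (arcs G) j) a) * s"
          using linear_on_edgesD[OF assms b(1), of s] b j(3) inv_into_f_f[OF j(1) b(1)] a by simp
      qed
      from at_vertex[OF N(1) this] show ?thesis using 1 N(2) by blast
    next
      case (2 e t)
      obtain G' :: "('a, nat) pre_digraph" and len' \<gamma>' e' k where M: "metric_graph_model \<Gamma> G' len' \<gamma>'"
        and v: "verts G' = insert (\<gamma> e t) (verts G)"
        and lin: "\<And>f m. linear_on_edges G len \<gamma> f m \<Longrightarrow> \<exists>m'. linear_on_edges G' len' \<gamma>' f m'"
        using interior_cut[OF 2(2-4)] by metis
      obtain m' where "linear_on_edges G' len' \<gamma>' f m'" using lin[OF assms] by blast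
      from at_vertex[OF M this] show ?thesis using 2 v by blast
    qed
  qed
qed

lemma eventually_mdist_chart:
  assumes "e \<in> arcs G"
  shows "0 \<le> t \<Longrightarrow> t < len e \<Longrightarrow> \<forall>\<^sub>F s in at_right 0. mdist \<Gamma> (\<gamma> e t) (\<gamma> e (t + s)) = s"
    and "0 < t \<Longrightarrow> t \<le> len e \<Longrightarrow> \<forall>\<^sub>F s in at_right 0. mdist \<Gamma> (\<gamma> e t) (\<gamma> e (t - s)) = s"
proof -
  have at_vertex: "(\<forall>f\<in>out_arcs N x. \<forall>\<^sub>F s in at_right 0. mdist \<Gamma> x (g f s) = s)
      \<and> (\<forall>f\<in>in_arcs N x. \<forall>\<^sub>F s in at_right 0. mdist \<Gamma> x (g f (l f - s)) = s)"
    if M: "metric_graph_model \<Gamma> N l g" and x: "x \<in> verts N" for N :: "('a, 'n) pre_digraph" and l g x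
  proof -
    obtain \<rho> where \<rho>: "0 < \<rho>"
      and "\<And>f s. \<lbrakk>f \<in> out_arcs N x; 0 \<le> s; s < \<rho>\<rbrakk> \<Longrightarrow> mdist \<Gamma> x (g f s) = s"
      "\<And>f s. \<lbrakk>f \<in> in_arcs N x; 0 \<le> s; s < \<rho>\<rbrakk> \<Longrightarrow> mdist \<Gamma> x (g f (l f - s)) = s"
      using metric_graph_model.vertex_nbhd[OF M x] by metis
    then show ?thesis using eventually_at_right_less[OF \<rho>] by (auto elim!: eventually_mono)
  qed
  have interior: "(\<forall>\<^sub>F s in at_right 0. mdist \<Gamma> (\<gamma> e t) (\<gamma> e (t + s)) = s)
      \<and> (\<forall>\<^sub>F s in at_right 0. mdist \<Gamma> (\<gamma> e t) (\<gamma> e (t - s)) = s)" if t: "0 < t" "t < len e"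
  proof -
    obtain G' :: "('a, nat) pre_digraph" and len' \<gamma>' e' k where M: "metric_graph_model \<Gamma> G' len' \<gamma>'"
      and "verts G' = insert (\<gamma> e t) (verts G)"
      and G': "out_arcs G' (\<gamma> e t) = {k}" "in_arcs G' (\<gamma> e t) = {e'}"
      "len' e' = t" "\<And>s. \<gamma>' e' s = \<gamma> e s" "\<And>s. \<gamma>' k s = \<gamma> e (t + s)"
      using interior_cut[OF assms t] by metis
    then have "\<gamma> e t \<in> verts G'" by simp
    from at_vertex[OF M this] show ?thesis by (simp add: G')
  qed
  have model: "metric_graph_model \<Gamma> G len \<gamma>" by unfold_locales
  show "\<forall>\<^sub>F s in at_right 0. mdist \<Gamma> (\<gamma> e t) (\<gamma> e (t + s)) = s" if "0 \<le> t" "t < len e"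
  proof (cases "t = 0")
    case True
    have "\<forall>\<^sub>F s in at_right 0. mdist \<Gamma> (tail G e) (\<gamma> e s) = s"
      by (rule at_vertex[OF model, THEN conjunct1, THEN bspec]) (use assms in auto)
    then show ?thesis using True chart_tail[OF assms] by simp
  qed (use interior that in simp)
  show "\<forall>\<^sub>F s in at_right 0. mdist \<Gamma> (\<gamma> e t) (\<gamma> e (t - s)) = s" if "0 < t" "t \<le> len e"
  proof (cases "t = len e")
    case True
    have "\<forall>\<^sub>F s in at_right 0. mdist \<Gamma> (head G e) (\<gamma> e (len e - s)) = s"
      by (rule at_vertex[OF model, THEN conjunct2, THEN bspec]) (use assms in auto)
    then show ?thesis using True chart_head[OF assms] by simp
  qed (use interior that in simp)
qed

end


section \<open>Piecewise linear functions\<close>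

definition germ_linear :: "(real \<Rightarrow> real) \<Rightarrow> real \<Rightarrow> bool" where
  "germ_linear \<phi> t \<longleftrightarrow> (\<exists>m::int. \<forall>\<^sub>F s in at_right 0. \<phi> (t + s) = \<phi> t + of_int m * s)"

text \<open>Left germs are right germs of the reflected function, so one notion of germ serves both
  sides. Nothing is required beyond either end of the interval.\<close>

definition PL_interval :: "(real \<Rightarrow> real) \<Rightarrow> real \<Rightarrow> bool" where
  "PL_interval \<phi> L \<longleftrightarrow> (\<forall>t\<in>{0..<L}. germ_linear \<phi> t) \<and> (\<forall>t\<in>{0<..L}. germ_linear (\<lambda>u. \<phi> (- u)) (- t))"

text \<open>The number counts inner break points, so \<open>pieces 0\<close> means linear. Break
  points are split off from the left, matching a cut that leaves the first part to the old
  edge.\<close>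

fun pieces :: "nat \<Rightarrow> (real \<Rightarrow> real) \<Rightarrow> real \<Rightarrow> real \<Rightarrow> bool" where
  "pieces 0 \<phi> a b \<longleftrightarrow> (\<exists>m::int. \<forall>t\<in>{a..b}. \<phi> t = \<phi> a + of_int m * (t - a))"
| "pieces (Suc n) \<phi> a b \<longleftrightarrow> (\<exists>c. a < c \<and> c < b \<and> pieces 0 \<phi> a c \<and> pieces n \<phi> c b)"

declare pieces.simps(1) [simp del]

text \<open>The common end \<open>b\<close> becomes one more break point, whence the
  \<open>Suc\<close>, even if the slopes on both sides agree.\<close>

lemma pieces_append:
  "pieces n \<phi> a b \<Longrightarrow> pieces k \<phi> b c \<Longrightarrow> a < b \<Longrightarrow> b < c \<Longrightarrow> pieces (Suc (n + k)) \<phi> a c"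
proof (induction n arbitrary: a)
  case 0
  then show ?case by (simp only: pieces.simps(2) add_0) blast
next
  case (Suc n)
  then obtain d where d: "a < d" "d < b" "pieces 0 \<phi> a d" "pieces n \<phi> d b" by auto
  have "pieces (Suc (n + k)) \<phi> d c" using Suc.IH d Suc.prems by blast
  then have "\<exists>d. a < d \<and> d < c \<and> pieces 0 \<phi> a d \<and> pieces (Suc (n + k)) \<phi> d c"
    using d Suc.prems by (intro exI[of _ d]) auto
  then show ?case unfolding add_Suc by (rule pieces.simps(2)[THEN iffD2])
qed

lemma pieces_shift: "pieces n \<phi> (c + a) (c + b) \<Longrightarrow> pieces n (\<lambda>t. \<phi> (c + t)) a b"
proof (induction n arbitrary: a)
  case 0
  then obtain m :: int where m: "\<forall>t\<in>{c + a..c + b}. \<phi> t = \<phi> (c + a) + of_int m * (t - (c + a))"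
    unfolding pieces.simps(1) by blast
  have "\<phi> (c + t) = \<phi> (c + a) + of_int m * (t - a)" if "t \<in> {a..b}" for t
    using bspec[OF m, of "c + t"] that by simp
  then show ?case unfolding pieces.simps(1) by blast
next
  case (Suc n)
  then obtain d where d: "c + a < d" "d < c + b" "pieces 0 \<phi> (c + a) d" "pieces n \<phi> d (c + b)" by auto
  obtain m :: int where m: "\<forall>t\<in>{c + a..d}. \<phi> t = \<phi> (c + a) + of_int m * (t - (c + a))"
    using d(3) unfolding pieces.simps(1) by blast
  have "\<phi> (c + t) = \<phi> (c + a) + of_int m * (t - a)" if "t \<in> {a..d - c}" for t
    using bspec[OF m, of "c + t"] that by simp
  then have "pieces 0 (\<lambda>t. \<phi> (c + t)) a (d - c)" unfolding pieces.simps(1) by blast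
  moreover have "pieces n (\<lambda>t. \<phi> (c + t)) (d - c) b" using Suc.IH[of "d - c"] d by simp
  moreover have "a < d - c" "d - c < b" using d by linarith+
  ultimately show ?case by (simp only: pieces.simps(2)) blast
qed

text \<open>Compactness of \<open>[0, L]\<close> by bisection: having finitely many pieces is
  additive over adjacent intervals, and it holds on short intervals around each point because the
  germs there are linear.\<close>

lemma PL_interval_pieces:
  assumes PL: "PL_interval \<phi> L" and "0 < L"
  shows "\<exists>n. pieces n \<phi> 0 L"
proof -
  \<comment> \<open>The guards make \<open>P\<close> vacuous for degenerate intervals and outside
    \<open>[0, L]\<close>, since the bisection principle lets the ends range over all reals.\<close>
  define P where "P a b \<longleftrightarrow> (0 \<le> a \<longrightarrow> a < b \<longrightarrow> b \<le> L \<longrightarrow> (\<exists>n. pieces n \<phi> a b))" for a b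
  have "0 \<le> L" using assms by simp
  then have "P 0 L"
  proof (induction rule: Bolzano)
    case (trans a b c)
    consider "a = b" | "b = c" | "a < b" "b < c" using trans by linarith
    then show ?case
    proof cases
      case 3
      then show ?thesis using trans(1,2) pieces_append[of _ \<phi> a b _ c] unfolding P_def by (meson less_imp_le order_trans)
    qed (use trans in auto)
  next
    case (local x)
    have right: "\<exists>d>0. \<forall>b. x < b \<and> b - x < d \<longrightarrow> pieces 0 \<phi> x b" if "x < L"
    proof -
      have "germ_linear \<phi> x" using PL local that by (simp add: PL_interval_def)
      then obtain m :: int and d where d: "0 < d" "\<And>s. 0 < s \<Longrightarrow> s < d \<Longrightarrow> \<phi> (x + s) = \<phi> x + of_int m * s"
        unfolding germ_linear_def eventually_at_right_field by blast
      have "pieces 0 \<phi> x b" if "x < b" "b - x < d" for b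
        unfolding pieces.simps(1)
      proof (intro exI[of _ m] ballI)
        fix t assume t: "t \<in> {x..b}"
        show "\<phi> t = \<phi> x + of_int m * (t - x)"
          using d(2)[of "t - x"] t that by (cases "t = x") auto
      qed
      then show ?thesis using d(1) by blast
    qed
    have left: "\<exists>d>0. \<forall>a. a < x \<and> x - a < d \<longrightarrow> pieces 0 \<phi> a x" if "0 < x"
    proof -
      have "germ_linear (\<lambda>u. \<phi> (- u)) (- x)" using PL local that by (simp add: PL_interval_def)
      then obtain m :: int and d where d: "0 < d" "\<And>s. 0 < s \<Longrightarrow> s < d \<Longrightarrow> \<phi> (x - s) = \<phi> x + of_int m * s"
        unfolding germ_linear_def eventually_at_right_field by auto
      have "pieces 0 \<phi> a x" if "a < x" "x - a < d" for a
        unfolding pieces.simps(1)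
      \<comment> \<open>The germ measures the slope leftwards from \<open>x\<close>, the negative of
        the slope in the direction of increasing \<open>t\<close>.\<close>
      proof (intro exI[of _ "- m"] ballI)
        fix t assume t: "t \<in> {a..x}"
        show "\<phi> t = \<phi> a + of_int (- m) * (t - a)"
          using d(2)[of "x - t"] d(2)[of "x - a"] t that by (cases "t = x") (auto simp: algebra_simps)
      qed
      then show ?thesis using d(1) by blast
    qed
    obtain d1 where d1: "d1 > 0" "\<And>b. x < L \<Longrightarrow> x < b \<Longrightarrow> b - x < d1 \<Longrightarrow> pieces 0 \<phi> x b"
      using right by (cases "x < L") (auto intro: zero_less_one)
    obtain d2 where d2: "d2 > 0" "\<And>a. 0 < x \<Longrightarrow> a < x \<Longrightarrow> x - a < d2 \<Longrightarrow> pieces 0 \<phi> a x"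
      using left by (cases "0 < x") (auto intro: zero_less_one)
    have "P a b" if ab: "a \<le> x" "x \<le> b" "b - a < min d1 d2" for a b
      unfolding P_def
    proof (intro impI)
      assume "0 \<le> a" "a < b" "b \<le> L"
      consider "a = x" | "b = x" | "a < x" "x < b" using ab by linarith
      then show "\<exists>n. pieces n \<phi> a b"
      proof cases
        case 1
        then show ?thesis using d1(2)[of b] ab \<open>a < b\<close> \<open>b \<le> L\<close> by (intro exI[of _ 0]) auto
      next
        case 2
        then show ?thesis using d2(2)[of a] ab \<open>a < b\<close> \<open>0 \<le> a\<close> by (intro exI[of _ 0]) auto
      next
        case 3
        have "pieces 0 \<phi> a x" "pieces 0 \<phi> x b"
          using d1(2)[of b] d2(2)[of a] ab 3 \<open>b \<le> L\<close> \<open>0 \<le> a\<close> by auto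
        from pieces_append[OF this 3] show ?thesis by blast
      qed
    qed
    then show ?case using d1(1) d2(1) by (intro exI[of _ "min d1 d2"]) auto
  qed
  then show ?thesis using assms by (simp add: P_def)
qed

section \<open>From locally conic functions to adapted models\<close>

text \<open>The slope quotient along \<open>c\<close> is an integer in \<open>[-B, B]\<close> and
  depends continuously on \<open>s\<close>, so on a connected interval it is constant. This makes
  uniform a slope that \<open>locally_conic\<close> chooses for each point separately.\<close>

lemma germ_linear_along:
  assumes lc: "locally_conic \<Gamma> f" and x: "x \<in> mspace \<Gamma>"
    and c: "\<forall>\<^sub>F s in at_right 0. c s \<in> mspace \<Gamma> \<and> mdist \<Gamma> x (c s) = s"
    and cont: "continuous_on {0<..<\<delta>} (\<lambda>s. f (c s))" and "0 < \<delta>"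
  shows "\<exists>m::int. \<forall>\<^sub>F s in at_right 0. f (c s) = f x + of_int m * s"
proof -
  obtain \<rho> B where \<rho>: "0 < \<rho>"
    and B: "\<And>y. \<lbrakk>y \<in> mspace \<Gamma>; mdist \<Gamma> x y < \<rho>\<rbrakk> \<Longrightarrow> \<exists>m::int. \<bar>m\<bar> \<le> B \<and> f y = f x + of_int m * mdist \<Gamma> x y"
    using lc x unfolding locally_conic_def by meson
  obtain d where d: "0 < d" "\<And>s. 0 < s \<Longrightarrow> s < d \<Longrightarrow> c s \<in> mspace \<Gamma> \<and> mdist \<Gamma> x (c s) = s"
    using c unfolding eventually_at_right_field by auto
  define r where "r = min d (min \<rho> \<delta>)"
  have r: "0 < r" "r \<le> d" "r \<le> \<rho>" "r \<le> \<delta>" using d \<rho> \<open>0 < \<delta>\<close> by (auto simp: r_def)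
  define g where "g s = (f (c s) - f x) / s" for s
  have "\<exists>m\<in>{-B..B}. g s = of_int m" if s: "s \<in> {0<..<r}" for s
  proof -
    have s': "0 < s" "s < d" "s < \<rho>" using s r by auto
    have "c s \<in> mspace \<Gamma>" "mdist \<Gamma> x (c s) = s" using d(2)[of s] s' by auto
    then obtain m where "\<bar>m\<bar> \<le> B" "f (c s) = f x + of_int m * s" using B[of "c s"] s' by auto
    then show ?thesis using s by (intro bexI[of _ m]) (auto simp: g_def)
  qed
  then have "g ` {0<..<r} \<subseteq> of_int ` {-B..B}" by blast
  then have "finite (g ` {0<..<r})" using finite_surj[of "{-B..B}"] by blast
  moreover have "continuous_on {0<..<r} g" unfolding g_def
    by (intro continuous_intros continuous_on_subset[OF cont]) (use r in auto)
  moreover have "Topological_Spaces.connected {0<..<r}" by (rule connected_Ioo)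
  ultimately have "g constant_on {0<..<r}" using continuous_finite_range_constant by blast
  moreover have half: "r / 2 \<in> {0<..<r}" using r by simp
  ultimately have const: "g s = g (r / 2)" if "s \<in> {0<..<r}" for s
    using that unfolding constant_on_def by metis
  obtain m :: int where m: "g (r / 2) = of_int m"
    using \<open>\<And>s. s \<in> {0<..<r} \<Longrightarrow> \<exists>m\<in>{-B..B}. g s = of_int m\<close>[OF half] by blast
  have "f (c s) = f x + of_int m * s" if "0 < s \<and> s < r" for s
  proof -
    have "(f (c s) - f x) / s = of_int m" using const[of s] m that by (simp add: g_def)
    then show ?thesis using that by (simp add: field_simps)
  qed
  then have "\<forall>\<^sub>F s in at_right 0. f (c s) = f x + of_int m * s"
    by (rule eventually_mono[OF eventually_at_right_less[OF r(1)]])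
  then show ?thesis by (rule exI[of _ m])
qed

lemma locally_conic_lipschitz:
  assumes "locally_conic \<Gamma> f" "x \<in> mspace \<Gamma>"
  obtains \<rho> K where "0 < \<rho>" "0 < K"
    "\<And>y. \<lbrakk>y \<in> mspace \<Gamma>; mdist \<Gamma> x y < \<rho>\<rbrakk> \<Longrightarrow> \<bar>f y - f x\<bar> \<le> K * mdist \<Gamma> x y"
proof -
  obtain \<rho> B where \<rho>: "0 < \<rho>"
    and B: "\<And>y. \<lbrakk>y \<in> mspace \<Gamma>; mdist \<Gamma> x y < \<rho>\<rbrakk> \<Longrightarrow> \<exists>m::int. \<bar>m\<bar> \<le> B \<and> f y = f x + of_int m * mdist \<Gamma> x y"
    using assms unfolding locally_conic_def by meson
  \<comment> \<open>The \<open>+ 1\<close> makes the Lipschitz constant positive, so that it can be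
    divided by.\<close>
  have "\<bar>f y - f x\<bar> \<le> (\<bar>of_int B\<bar> + 1) * mdist \<Gamma> x y" if y: "y \<in> mspace \<Gamma>" "mdist \<Gamma> x y < \<rho>" for y
  proof -
    obtain m where m: "\<bar>m\<bar> \<le> B" "f y = f x + of_int m * mdist \<Gamma> x y" using B[OF y] by blast
    have "\<bar>f y - f x\<bar> = \<bar>of_int m\<bar> * mdist \<Gamma> x y" by (simp add: m(2) abs_mult)
    also have "\<dots> \<le> (\<bar>of_int B\<bar> + 1) * mdist \<Gamma> x y" by (intro mult_right_mono mdist_nonneg) (use m(1) in linarith)
    finally show ?thesis .
  qed
  then show ?thesis using that[OF \<rho>, of "\<bar>of_int B\<bar> + 1"] by simp
qed

lemma locally_conic_small_change:
  assumes "locally_conic \<Gamma> f" "x \<in> mspace \<Gamma>" "0 < \<epsilon>"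
  obtains r where "0 < r" "\<And>y. \<lbrakk>y \<in> mspace \<Gamma>; mdist \<Gamma> x y < r\<rbrakk> \<Longrightarrow> \<bar>f y - f x\<bar> < \<epsilon>"
proof -
  obtain \<rho> K where \<rho>: "0 < \<rho>" "0 < K"
    and K: "\<And>y. \<lbrakk>y \<in> mspace \<Gamma>; mdist \<Gamma> x y < \<rho>\<rbrakk> \<Longrightarrow> \<bar>f y - f x\<bar> \<le> K * mdist \<Gamma> x y"
    using locally_conic_lipschitz[OF assms(1,2)] by metis
  have "\<bar>f y - f x\<bar> < \<epsilon>" if y: "y \<in> mspace \<Gamma>" "mdist \<Gamma> x y < min \<rho> (\<epsilon> / K)" for y
  proof -
    have "\<bar>f y - f x\<bar> \<le> K * mdist \<Gamma> x y" using K y by simp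
    also have "\<dots> < K * (\<epsilon> / K)" using y(2) \<rho>(2) by (intro mult_strict_left_mono) auto
    finally show ?thesis using \<rho>(2) by simp
  qed
  then show ?thesis using that[of "min \<rho> (\<epsilon> / K)"] \<rho> assms(3) by simp
qed

lemma locally_conic_continuous:
  assumes "locally_conic \<Gamma> f" shows "continuous_map (mtopology_of \<Gamma>) euclideanreal f"
proof -
  interpret M: Metric_space "mspace \<Gamma>" "mdist \<Gamma>" by (rule Metric_space_mspace_mdist)
  show ?thesis unfolding continuous_map_def mtopology_of_def
  proof (intro conjI allI impI)
    fix U :: "real set" assume "openin euclideanreal U"
    then have U: "open U" by simp
    show "openin M.mtopology {x \<in> topspace M.mtopology. f x \<in> U}"
      unfolding M.openin_mtopology
    proof (intro conjI allI impI)
      fix x assume "x \<in> {x \<in> topspace M.mtopology. f x \<in> U}"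
      then have x: "x \<in> mspace \<Gamma>" "f x \<in> U" by auto
      obtain \<epsilon> where \<epsilon>: "0 < \<epsilon>" "ball (f x) \<epsilon> \<subseteq> U" using U x(2) open_contains_ball by blast
      obtain r where r: "0 < r" "\<And>y. \<lbrakk>y \<in> mspace \<Gamma>; mdist \<Gamma> x y < r\<rbrakk> \<Longrightarrow> \<bar>f y - f x\<bar> < \<epsilon>"
        using locally_conic_small_change[OF assms x(1) \<epsilon>(1)] by metis
      have "f y \<in> U" if "y \<in> mspace \<Gamma>" "mdist \<Gamma> x y < r" for y
        using r(2)[OF that] \<epsilon>(2) by (auto simp: dist_real_def abs_minus_commute)
      then have "M.mball x r \<subseteq> {x \<in> topspace M.mtopology. f x \<in> U}" by auto
      then show "\<exists>r>0. M.mball x r \<subseteq> {x \<in> topspace M.mtopology. f x \<in> U}" using r(1) by blast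
    qed auto
  qed auto
qed

lemma PL_int_locally_conic: "f \<in> PL_int \<Gamma> \<Longrightarrow> locally_conic \<Gamma> f"
  unfolding PL_int_def using metric_graph_model.linear_imp_locally_conic by blast

lemma linear_imp_PL_int:
  fixes N :: "('a, nat) pre_digraph"
  assumes "metric_graph_model \<Gamma> N l g" "linear_on_edges N l g f m"
  shows "f \<in> PL_int \<Gamma>"
  using assms locally_conic_continuous[OF metric_graph_model.linear_imp_locally_conic[OF assms]]
  unfolding PL_int_def by blast

text \<open>Cutting an edge at its first break point leaves the first part linear and lowers the
  total number of break points. When none is left, the model itself witnesses membership.\<close>

lemma pieces_imp_PL_int:
  fixes N :: "('a, nat) pre_digraph"
  assumes "metric_graph_model \<Gamma> N l g" "\<And>e. e \<in> arcs N \<Longrightarrow> pieces (n e) (\<lambda>t. f (g e t)) 0 (l e)"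
  shows "f \<in> PL_int \<Gamma>"
  using assms
proof (induction "\<Sum>e\<in>arcs N. n e" arbitrary: N l g n rule: less_induct)
  case less
  interpret metric_graph_model \<Gamma> N l g by (rule less.prems)
  show ?case
  proof (cases "\<forall>e\<in>arcs N. n e = 0")
    case True
    have "\<forall>e\<in>arcs N. \<exists>m::int. \<forall>t\<in>{0..l e}. f (g e t) = f (g e 0) + of_int m * (t - 0)"
    proof (intro ballI)
      fix e assume e: "e \<in> arcs N"
      then have "pieces 0 (\<lambda>t. f (g e t)) 0 (l e)" using less.prems(2)[OF e] True by simp
      then show "\<exists>m::int. \<forall>t\<in>{0..l e}. f (g e t) = f (g e 0) + of_int m * (t - 0)"
        by (simp only: pieces.simps(1))
    qed
    from bchoice[OF this] obtain m where
      "\<forall>e\<in>arcs N. \<forall>t\<in>{0..l e}. f (g e t) = f (g e 0) + of_int (m e) * (t - 0)" by (rule exE)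
    then have "linear_on_edges N l g f m" unfolding linear_on_edges_def diff_0_right .
    then show ?thesis by (rule linear_imp_PL_int[OF less.prems(1)])
  next
    case False
    then obtain e p where e: "e \<in> arcs N" "n e = Suc p" by (metis not0_implies_Suc)
    obtain c where c: "0 < c" "c < l e" "pieces 0 (\<lambda>t. f (g e t)) 0 c" "pieces p (\<lambda>t. f (g e t)) c (l e)"
      using less.prems(2)[OF e(1)] e(2) by auto
    obtain k where k: "k \<notin> arcs N" using ex_new_if_finite[OF infinite_UNIV_nat finite_arcs] by blast
    then have ke: "k \<noteq> e" using e by blast
    define n' where "n' = n(e := 0, k := p)"
    show ?thesis
    proof (rule less.hyps)
      show "metric_graph_model \<Gamma> (cut_graph N g e c k) (cut_len l e c k) (cut_chart g e c k)"
        by (rule cut_is_model) fact+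
      have "(\<Sum>a\<in>insert k (arcs N). n' a) = p + (\<Sum>a\<in>arcs N - {e}. n' a)"
        using k ke e by (simp add: n'_def sum.remove[OF finite_arcs e(1)])
      also have "(\<Sum>a\<in>arcs N - {e}. n' a) = (\<Sum>a\<in>arcs N - {e}. n a)"
        using k by (intro sum.cong) (auto simp: n'_def)
      also have "p + \<dots> < (\<Sum>a\<in>arcs N. n a)" using sum.remove[OF finite_arcs e(1), of n] e(2) by simp
      finally show "(\<Sum>a\<in>arcs (cut_graph N g e c k). n' a) < (\<Sum>a\<in>arcs N. n a)" by simp
      fix a assume a: "a \<in> arcs (cut_graph N g e c k)"
      have "pieces p (\<lambda>t. f (g e (c + t))) 0 (l e - c)"
        using pieces_shift[of p "\<lambda>t. f (g e t)" c 0 "l e - c"] c(4) by simp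
      then show "pieces (n' a) (\<lambda>t. f (cut_chart g e c k a t)) 0 (cut_len l e c k a)"
        using a c(3) less.prems(2)[of a] ke by (auto simp: n'_def)
    qed
  qed
qed

context metric_graph_model
begin

lemma locally_conic_chart_continuous:
  assumes lc: "locally_conic \<Gamma> f" and e: "e \<in> arcs G"
  shows "continuous_on {0..len e} (\<lambda>t. f (\<gamma> e t))"
  unfolding continuous_on_iff
proof (intro ballI allI impI)
  fix t and \<epsilon> :: real assume t: "t \<in> {0..len e}" and "0 < \<epsilon>"
  then have x: "\<gamma> e t \<in> mspace \<Gamma>" using chart_in_mspace[OF e] by simp
  obtain r where r: "0 < r" "\<And>y. \<lbrakk>y \<in> mspace \<Gamma>; mdist \<Gamma> (\<gamma> e t) y < r\<rbrakk> \<Longrightarrow> \<bar>f y - f (\<gamma> e t)\<bar> < \<epsilon>"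
    using locally_conic_small_change[OF lc x \<open>0 < \<epsilon>\<close>] by metis
  have "dist (f (\<gamma> e s)) (f (\<gamma> e t)) < \<epsilon>" if s: "s \<in> {0..len e}" "dist s t < r" for s
  proof -
    have "mdist \<Gamma> (\<gamma> e t) (\<gamma> e s) < r" using mdist_chart_le[OF e t s(1)] s(2) by (simp add: dist_real_def)
    then show ?thesis using r(2) chart_in_mspace[OF e] s by (simp add: dist_real_def)
  qed
  then show "\<exists>d>0. \<forall>x'\<in>{0..len e}. dist x' t < d \<longrightarrow> dist (f (\<gamma> e x')) (f (\<gamma> e t)) < \<epsilon>" using r(1) by blast
qed

lemma locally_conic_imp_PL_interval:
  assumes lc: "locally_conic \<Gamma> f" and e: "e \<in> arcs G"
  shows "PL_interval (\<lambda>t. f (\<gamma> e t)) (len e)"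
  unfolding PL_interval_def
proof (intro conjI ballI)
  note cont = locally_conic_chart_continuous[OF lc e]
  fix t assume t: "t \<in> {0..<len e}"
  show "germ_linear (\<lambda>t. f (\<gamma> e t)) t" unfolding germ_linear_def
  proof (rule germ_linear_along[OF lc])
    show "\<gamma> e t \<in> mspace \<Gamma>" using chart_in_mspace[OF e] t by simp
    have "\<forall>\<^sub>F s in at_right 0. 0 < s \<and> s < len e - t" using t by (intro eventually_at_right_less) simp
    moreover have "\<forall>\<^sub>F s in at_right 0. mdist \<Gamma> (\<gamma> e t) (\<gamma> e (t + s)) = s"
      using eventually_mdist_chart(1)[OF e] t by simp
    ultimately show "\<forall>\<^sub>F s in at_right 0. \<gamma> e (t + s) \<in> mspace \<Gamma> \<and> mdist \<Gamma> (\<gamma> e t) (\<gamma> e (t + s)) = s"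
      by eventually_elim (use chart_in_mspace[OF e] t in simp)
    show "continuous_on {0<..<len e - t} (\<lambda>s. f (\<gamma> e (t + s)))"
      by (rule continuous_on_compose2[OF cont]) (use t in \<open>auto intro!: continuous_intros\<close>)
  qed (use t in simp)
next
  note cont = locally_conic_chart_continuous[OF lc e]
  fix t assume t: "t \<in> {0<..len e}"
  have "\<exists>m::int. \<forall>\<^sub>F s in at_right 0. f (\<gamma> e (t - s)) = f (\<gamma> e t) + of_int m * s"
  proof (rule germ_linear_along[OF lc])
    show "\<gamma> e t \<in> mspace \<Gamma>" using chart_in_mspace[OF e] t by simp
    have "\<forall>\<^sub>F s in at_right 0. 0 < s \<and> s < t" using t by (intro eventually_at_right_less) simp
    moreover have "\<forall>\<^sub>F s in at_right 0. mdist \<Gamma> (\<gamma> e t) (\<gamma> e (t - s)) = s"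
      using eventually_mdist_chart(2)[OF e] t by simp
    ultimately show "\<forall>\<^sub>F s in at_right 0. \<gamma> e (t - s) \<in> mspace \<Gamma> \<and> mdist \<Gamma> (\<gamma> e t) (\<gamma> e (t - s)) = s"
      by eventually_elim (use chart_in_mspace[OF e] t in simp)
    show "continuous_on {0<..<t} (\<lambda>s. f (\<gamma> e (t - s)))"
      by (rule continuous_on_compose2[OF cont]) (use t in \<open>auto intro!: continuous_intros\<close>)
  qed (use t in simp)
  then show "germ_linear (\<lambda>u. f (\<gamma> e (- u))) (- t)" by (simp add: germ_linear_def)
qed

lemma PL_interval_imp_PL_int:
  assumes "\<And>e. e \<in> arcs G \<Longrightarrow> PL_interval (\<lambda>t. f (\<gamma> e t)) (len e)"
  shows "f \<in> PL_int \<Gamma>"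
proof -
  obtain N :: "('a, nat) pre_digraph" and l g j where N: "metric_graph_model \<Gamma> N l g"
    and "verts N = verts G" "inj_on j (arcs G)"
    and j: "arcs N = j ` arcs G" "\<And>e. e \<in> arcs G \<Longrightarrow> l (j e) = len e \<and> g (j e) = \<gamma> e"
    using nat_model by metis
  have "\<exists>n. pieces n (\<lambda>t. f (g a t)) 0 (l a)" if "a \<in> arcs N" for a
    using that j PL_interval_pieces[OF assms len_pos] by auto
  then have "\<forall>a\<in>arcs N. \<exists>n. pieces n (\<lambda>t. f (g a t)) 0 (l a)" by blast
  then obtain n where "\<forall>a\<in>arcs N. pieces (n a) (\<lambda>t. f (g a t)) 0 (l a)" by (rule bchoice[THEN exE]) blast
  then show ?thesis using pieces_imp_PL_int[OF N] by blast
qed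

lemma PL_int_iff_locally_conic: "f \<in> PL_int \<Gamma> \<longleftrightarrow> locally_conic \<Gamma> f"
  using PL_int_locally_conic PL_interval_imp_PL_int locally_conic_imp_PL_interval by blast

text \<open>Each half-edge contributes \<open>r\<close> times its outgoing slope. Off the vertices
  the two opposite slopes cancel, and both sums on the right are empty.\<close>

lemma linear_sphere_sum:
  assumes lin: "linear_on_edges G len \<gamma> f m" and x: "x \<in> mspace \<Gamma>"
  shows "\<forall>\<^sub>F r in at_right 0. sphere_sum \<Gamma> f x r = r * of_int ((\<Sum>e\<in>out_arcs G x. m e) + (\<Sum>e\<in>in_arcs G x. - m e))"
  using x
proof (cases rule: point_cases)
  case 1
  obtain \<rho> where \<rho>: "0 < \<rho>" "\<And>e. e \<in> arcs G \<Longrightarrow> 2 * \<rho> < len e" using small_radius by metis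
  have out: "f (\<gamma> e r) - f x = of_int (m e) * r" if "e \<in> out_arcs G x" "0 < r" "r < \<rho>" for e and r :: real
    using linear_on_edgesD[OF lin, of e r] chart_tail[of e] that \<rho>(2)[of e] by auto
  have inn: "f (\<gamma> e (len e - r)) - f x = - of_int (m e) * r" if "e \<in> in_arcs G x" "0 < r" "r < \<rho>" for e and r :: real
    using linear_on_edgesD[OF lin, of e "len e - r"] linear_on_edgesD[OF lin, of e "len e"] chart_head[of e] that \<rho>(2)[of e]
    by (auto simp: algebra_simps)
  show ?thesis
    using vertex_sphere_sum[OF 1] eventually_at_right_less[OF \<rho>(1)]
  proof eventually_elim
    case (elim r)
    then have r: "0 < r" "r < \<rho>" by auto
    have "sphere_sum \<Gamma> f x r = (\<Sum>e\<in>out_arcs G x. of_int (m e) * r) + (\<Sum>e\<in>in_arcs G x. - of_int (m e) * r)"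
    proof -
      have "(\<Sum>e\<in>out_arcs G x. f (\<gamma> e r) - f x) = (\<Sum>e\<in>out_arcs G x. of_int (m e) * r)"
        by (rule sum.cong[OF HOL.refl]) (rule out[OF _ r])
      moreover have "(\<Sum>e\<in>in_arcs G x. f (\<gamma> e (len e - r)) - f x) = (\<Sum>e\<in>in_arcs G x. - of_int (m e) * r)"
        by (rule sum.cong[OF HOL.refl]) (rule inn[OF _ r])
      ultimately show ?thesis using elim(1) by (simp only:)
    qed
    then show ?case by (simp add: sum_distrib_left sum_negf algebra_simps)
  qed
next
  case (2 e t)
  have "out_arcs G x = {}" "in_arcs G x = {}" using 2(1) by (auto simp: out_arcs_def in_arcs_def)
  moreover have "\<forall>\<^sub>F r in at_right 0. sphere_sum \<Gamma> f x r = 0"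
    using interior_sphere_sum[OF 2(2-4)] eventually_at_right_less[OF 2(3)]
      eventually_at_right_less[of "len e - t", simplified, OF 2(4)]
  proof eventually_elim
    case (elim r)
    then show ?case
      using linear_on_edgesD[OF lin 2(2), of "t + r"] linear_on_edgesD[OF lin 2(2), of "t - r"]
        linear_on_edgesD[OF lin 2(2), of t] 2 spec[OF elim(1), of f] by (simp add: algebra_simps)
  qed
  ultimately show ?thesis by simp
qed

end

lemma eventually_slope_unique:
  fixes a b :: int
  assumes "\<forall>\<^sub>F r in at_right (0::real). S r = r * of_int a" "\<forall>\<^sub>F r in at_right 0. S r = r * of_int b"
  shows "a = b"
proof -
  have "\<forall>\<^sub>F r in at_right (0::real). a = b"
    using assms eventually_at_right_less[of 1, simplified] by eventually_elim simp
  then show ?thesis by (simp add: trivial_limit_at_right_real)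
qed

text \<open>Spheres are defined by the metric alone, so any two models give the same multiple of
  \<open>r\<close> for small \<open>r\<close>, and the definite description denotes a unique
  integer.\<close>

lemma outgoing_slope_sum_model:
  fixes N :: "('a, nat) pre_digraph"
  assumes N: "metric_graph_model \<Gamma> N l g" "linear_on_edges N l g f m" and x: "x \<in> mspace \<Gamma>"
  shows "outgoing_slope_sum \<Gamma> f x = (\<Sum>e\<in>out_arcs N x. m e) + (\<Sum>e\<in>in_arcs N x. - m e)"
  unfolding outgoing_slope_sum_def
proof (rule the_equality)
  fix a assume "\<exists>(G :: ('a, nat) pre_digraph) len \<gamma> m. metric_graph_model \<Gamma> G len \<gamma> \<and> linear_on_edges G len \<gamma> f m \<and>
    a = (\<Sum>e\<in>out_arcs G x. m e) + (\<Sum>e\<in>in_arcs G x. - m e)"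
  then show "a = (\<Sum>e\<in>out_arcs N x. m e) + (\<Sum>e\<in>in_arcs N x. - m e)"
    using eventually_slope_unique metric_graph_model.linear_sphere_sum[OF N x]
      metric_graph_model.linear_sphere_sum[OF _ _ x] by metis
qed (use N in blast)

lemma outgoing_slope_sum_sphere:
  assumes "f \<in> PL_int \<Gamma>" "x \<in> mspace \<Gamma>"
  shows "\<forall>\<^sub>F r in at_right 0. sphere_sum \<Gamma> f x r = r * of_int (outgoing_slope_sum \<Gamma> f x)"
proof -
  obtain N :: "('a, nat) pre_digraph" and l g m where N: "metric_graph_model \<Gamma> N l g" "linear_on_edges N l g f m"
    using assms by (auto simp: PL_int_def)
  show ?thesis unfolding outgoing_slope_sum_model[OF N assms(2)]
    by (rule metric_graph_model.linear_sphere_sum[OF N assms(2)])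
qed

text \<open>The slopes of a constructed function are read off from small spheres, so no model
  adapted to it has to be exhibited.\<close>

lemma outgoing_slope_sum_eqI:
  assumes "f \<in> PL_int \<Gamma>" "x \<in> mspace \<Gamma>" "\<forall>\<^sub>F r in at_right 0. sphere_sum \<Gamma> f x r = r * of_int a"
  shows "outgoing_slope_sum \<Gamma> f x = a"
  by (rule eventually_slope_unique[OF outgoing_slope_sum_sphere[OF assms(1,2)] assms(3)])

lemma finite_outgoing_slope_sum_support:
  assumes "f \<in> PL_int \<Gamma>" shows "finite {x \<in> mspace \<Gamma>. outgoing_slope_sum \<Gamma> f x \<noteq> 0}"
proof -
  obtain N :: "('a, nat) pre_digraph" and l g m where N: "metric_graph_model \<Gamma> N l g" "linear_on_edges N l g f m"
    using assms by (auto simp: PL_int_def)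
  interpret N: metric_graph_model \<Gamma> N l g by fact
  have "outgoing_slope_sum \<Gamma> f x = 0" if "x \<in> mspace \<Gamma>" "x \<notin> verts N" for x
  proof -
    have "out_arcs N x = {}" "in_arcs N x = {}" using that(2) by (auto simp: out_arcs_def in_arcs_def)
    then show ?thesis using outgoing_slope_sum_model[OF N that(1)] by simp
  qed
  then have "{x \<in> mspace \<Gamma>. outgoing_slope_sum \<Gamma> f x \<noteq> 0} \<subseteq> verts N" by blast
  then show ?thesis using N.finite_verts finite_subset by blast
qed

text \<open>In a model on whose edges \<open>f\<close> is linear, each edge enters with
  \<open>m e\<close> at its tail and with \<open>- m e\<close> at its head.\<close>

lemma sum_outgoing_slope_sum:
  assumes "f \<in> PL_int \<Gamma>" "finite X" "{x \<in> mspace \<Gamma>. outgoing_slope_sum \<Gamma> f x \<noteq> 0} \<subseteq> X" "X \<subseteq> mspace \<Gamma>"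
  shows "(\<Sum>x\<in>X. outgoing_slope_sum \<Gamma> f x) = 0"
proof -
  obtain N :: "('a, nat) pre_digraph" and l g m where N: "metric_graph_model \<Gamma> N l g" "linear_on_edges N l g f m"
    using assms by (auto simp: PL_int_def)
  interpret N: metric_graph_model \<Gamma> N l g by fact
  let ?Y = "X \<union> verts N"
  have Y: "finite ?Y" "?Y \<subseteq> mspace \<Gamma>" using assms N.verts_subset by auto
  have "(\<Sum>x\<in>X. outgoing_slope_sum \<Gamma> f x) = (\<Sum>x\<in>?Y. outgoing_slope_sum \<Gamma> f x)"
    by (rule sum.mono_neutral_left) (use Y assms N.verts_subset in auto)
  also have "\<dots> = (\<Sum>x\<in>?Y. (\<Sum>e\<in>{e \<in> arcs N. tail N e = x}. m e) + (\<Sum>e\<in>{e \<in> arcs N. head N e = x}. - m e))"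
    by (rule sum.cong) (use Y outgoing_slope_sum_model[OF N] in \<open>auto simp: out_arcs_def in_arcs_def\<close>)
  also have "\<dots> = (\<Sum>e\<in>arcs N. m e) + (\<Sum>e\<in>arcs N. - m e)"
  proof -
    have "(\<Sum>x\<in>?Y. \<Sum>e\<in>{e \<in> arcs N. tail N e = x}. m e) = (\<Sum>e\<in>arcs N. m e)"
      by (rule sum.group) (use Y in auto)
    moreover have "(\<Sum>x\<in>?Y. \<Sum>e\<in>{e \<in> arcs N. head N e = x}. - m e) = (\<Sum>e\<in>arcs N. - m e)"
      by (rule sum.group) (use Y in auto)
    ultimately show ?thesis by (simp only: sum.distrib)
  qed
  also have "\<dots> = 0" by (simp add: sum_negf)
  finally show ?thesis .
qed


section \<open>Principal divisors\<close>

lemma germ_linear_add: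
  assumes "germ_linear \<phi> t" "germ_linear \<psi> t" shows "germ_linear (\<lambda>t. \<phi> t + \<psi> t) t"
proof -
  obtain m n :: int where "\<forall>\<^sub>F s in at_right 0. \<phi> (t + s) = \<phi> t + of_int m * s"
    "\<forall>\<^sub>F s in at_right 0. \<psi> (t + s) = \<psi> t + of_int n * s"
    using assms by (auto simp: germ_linear_def)
  then have "\<forall>\<^sub>F s in at_right 0. \<phi> (t + s) + \<psi> (t + s) = \<phi> t + \<psi> t + of_int (m + n) * s"
    by eventually_elim (simp add: algebra_simps)
  then show ?thesis unfolding germ_linear_def by (rule exI[of _ "m + n"])
qed

lemma germ_linear_cmul:
  assumes "germ_linear \<phi> t" shows "germ_linear (\<lambda>t. of_int k * \<phi> t) t"
proof -
  obtain m :: int where "\<forall>\<^sub>F s in at_right 0. \<phi> (t + s) = \<phi> t + of_int m * s"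
    using assms by (auto simp: germ_linear_def)
  then have "\<forall>\<^sub>F s in at_right 0. of_int k * \<phi> (t + s) = of_int k * \<phi> t + of_int (k * m) * s"
    by eventually_elim (simp add: algebra_simps)
  then show ?thesis unfolding germ_linear_def by (rule exI[of _ "k * m"])
qed

lemma germ_linear_ramp_up: "germ_linear (\<lambda>t. max 0 (t - b)) t"
proof (cases "t < b")
  case True
  then have "\<forall>\<^sub>F s in at_right 0. max 0 (t + s - b) = max 0 (t - b) + of_int 0 * s"
    using eventually_at_right_less[of "b - t"] by (auto elim!: eventually_mono)
  then show ?thesis unfolding germ_linear_def by (rule exI[of _ 0])
next
  case False
  then have "\<forall>\<^sub>F s in at_right 0. max 0 (t + s - b) = max 0 (t - b) + of_int 1 * s"
    using eventually_at_right_less[of 1] by (auto elim!: eventually_mono)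
  then show ?thesis unfolding germ_linear_def by (rule exI[of _ 1])
qed

lemma germ_linear_ramp_down: "germ_linear (\<lambda>t. max 0 (b - t)) t"
proof (cases "t < b")
  case True
  then have "\<forall>\<^sub>F s in at_right 0. max 0 (b - (t + s)) = max 0 (b - t) + of_int (- 1) * s"
    using eventually_at_right_less[of "b - t"] by (auto elim!: eventually_mono)
  then show ?thesis unfolding germ_linear_def by (rule exI[of _ "- 1"])
next
  case False
  then have "\<forall>\<^sub>F s in at_right 0. max 0 (b - (t + s)) = max 0 (b - t) + of_int 0 * s"
    using eventually_at_right_less[of 1] by (auto elim!: eventually_mono)
  then show ?thesis unfolding germ_linear_def by (rule exI[of _ 0])
qed

lemma PL_interval_add: "PL_interval \<phi> L \<Longrightarrow> PL_interval \<psi> L \<Longrightarrow> PL_interval (\<lambda>t. \<phi> t + \<psi> t) L"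
  unfolding PL_interval_def by (auto intro!: germ_linear_add)

lemma PL_interval_cmul: "PL_interval \<phi> L \<Longrightarrow> PL_interval (\<lambda>t. of_int k * \<phi> t) L"
  unfolding PL_interval_def by (auto intro!: germ_linear_cmul)

lemma PL_interval_ramp_up: "PL_interval (\<lambda>t. max 0 (t - b)) L"
  using germ_linear_ramp_up[of b] germ_linear_ramp_down[of "- b"]
  by (simp add: PL_interval_def minus_diff_commute)

lemma PL_interval_ramp_down: "PL_interval (\<lambda>t. max 0 (b - t)) L"
  using germ_linear_ramp_down[of b] germ_linear_ramp_up[of "- b"]
  by (simp add: PL_interval_def algebra_simps)

lemma PL_interval_cong:
  assumes "PL_interval \<phi> L" and eq: "\<And>t. 0 \<le> t \<Longrightarrow> t \<le> L \<Longrightarrow> \<psi> t = \<phi> t"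
  shows "PL_interval \<psi> L"
  unfolding PL_interval_def
proof (intro conjI ballI)
  fix t assume t: "t \<in> {0..<L}"
  then have "germ_linear \<phi> t" using assms(1) by (simp add: PL_interval_def)
  then obtain m :: int where m: "\<forall>\<^sub>F s in at_right 0. \<phi> (t + s) = \<phi> t + of_int m * s"
    by (auto simp: germ_linear_def)
  have "\<forall>\<^sub>F s in at_right 0. 0 < s \<and> s < L - t" using t by (intro eventually_at_right_less) simp
  with m have "\<forall>\<^sub>F s in at_right 0. \<psi> (t + s) = \<psi> t + of_int m * s"
    by eventually_elim (use t eq in simp)
  then show "germ_linear \<psi> t" unfolding germ_linear_def by (rule exI[of _ m])
next
  fix t assume t: "t \<in> {0<..L}"
  then have "germ_linear (\<lambda>u. \<phi> (- u)) (- t)" using assms(1) by (simp add: PL_interval_def)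
  then obtain m :: int where m: "\<forall>\<^sub>F s in at_right 0. \<phi> (- (- t + s)) = \<phi> t + of_int m * s"
    by (auto simp: germ_linear_def)
  have "\<forall>\<^sub>F s in at_right 0. 0 < s \<and> s < t" using t by (intro eventually_at_right_less) simp
  with m have "\<forall>\<^sub>F s in at_right 0. \<psi> (- (- t + s)) = \<psi> (- (- t)) + of_int m * s"
    by eventually_elim (use t eq in simp)
  then show "germ_linear (\<lambda>u. \<psi> (- u)) (- t)" unfolding germ_linear_def by (rule exI[of _ m])
qed

text \<open>The second difference isolates the change of slope: a ramp bends by 1 at
  \<open>b\<close> and nowhere else. The divisor of a combination of ramps can thus be read off from
  its coefficients.\<close>

lemma eventually_ramp_up_second_difference:
  "\<forall>\<^sub>F r in at_right (0::real). max 0 (t + r - b) + max 0 (t - r - b) - 2 * max 0 (t - b) = r * of_bool (t = b)"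
proof -
  have "\<forall>\<^sub>F r in at_right 0. 0 < r \<and> r < (if t = b then 1 else \<bar>t - b\<bar>)"
    by (intro eventually_at_right_less) auto
  then show ?thesis by eventually_elim (auto simp: max_def abs_if split: if_splits)
qed

lemma eventually_ramp_down_second_difference:
  "\<forall>\<^sub>F r in at_right (0::real). max 0 (b - (t + r)) + max 0 (b - (t - r)) - 2 * max 0 (b - t) = r * of_bool (t = b)"
proof -
  have "\<forall>\<^sub>F r in at_right 0. 0 < r \<and> r < (if t = b then 1 else \<bar>t - b\<bar>)"
    by (intro eventually_at_right_less) auto
  then show ?thesis by eventually_elim (auto simp: max_def abs_if split: if_splits)
qed

lemma lookup_Laplacian:
  assumes "f \<in> PL_int \<Gamma>"
  shows "Poly_Mapping.lookup (Laplacian \<Gamma> f) x = (if x \<in> mspace \<Gamma> then - outgoing_slope_sum \<Gamma> f x else 0)"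
  using finite_outgoing_slope_sum_support[OF assms]
  by (auto simp: Laplacian_def lookup_sum if_distrib[of "(*) _"] cong: if_cong)

lemma sphere_sum_diff:
  "sphere_sum \<Gamma> (\<lambda>x. f x - g x) x r = sphere_sum \<Gamma> f x r - sphere_sum \<Gamma> g x r"
  unfolding sphere_sum_def by (simp flip: sum_subtractf add: algebra_simps)

lemma locally_conic_diff:
  assumes "locally_conic \<Gamma> f" "locally_conic \<Gamma> g"
  shows "locally_conic \<Gamma> (\<lambda>x. f x - g x)"
  unfolding locally_conic_def
proof
  fix x assume x: "x \<in> mspace \<Gamma>"
  obtain \<rho> B where \<rho>: "0 < \<rho>"
    and B: "\<And>y. \<lbrakk>y \<in> mspace \<Gamma>; mdist \<Gamma> x y < \<rho>\<rbrakk> \<Longrightarrow> \<exists>m::int. \<bar>m\<bar> \<le> B \<and> f y = f x + of_int m * mdist \<Gamma> x y"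
    using assms(1) x unfolding locally_conic_def by meson
  obtain \<rho>' B' where \<rho>': "0 < \<rho>'"
    and B': "\<And>y. \<lbrakk>y \<in> mspace \<Gamma>; mdist \<Gamma> x y < \<rho>'\<rbrakk> \<Longrightarrow> \<exists>m::int. \<bar>m\<bar> \<le> B' \<and> g y = g x + of_int m * mdist \<Gamma> x y"
    using assms(2) x unfolding locally_conic_def by meson
  have "\<exists>m::int. \<bar>m\<bar> \<le> B + B' \<and> f y - g y = f x - g x + of_int m * mdist \<Gamma> x y"
    if y: "y \<in> mspace \<Gamma>" "mdist \<Gamma> x y < min \<rho> \<rho>'" for y
  proof -
    obtain m m' where "\<bar>m\<bar> \<le> B" "f y = f x + of_int m * mdist \<Gamma> x y"
      "\<bar>m'\<bar> \<le> B'" "g y = g x + of_int m' * mdist \<Gamma> x y"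
      using B[of y] B'[of y] y by auto
    then show ?thesis by (intro exI[of _ "m - m'"]) (auto simp: algebra_simps)
  qed
  moreover have "0 < min \<rho> \<rho>'" using \<rho> \<rho>' by simp
  ultimately show "\<exists>\<rho>>0. \<exists>B. \<forall>y\<in>mspace \<Gamma>. mdist \<Gamma> x y < \<rho> \<longrightarrow>
    (\<exists>m::int. \<bar>m\<bar> \<le> B \<and> f y - g y = f x - g x + of_int m * mdist \<Gamma> x y)" by blast
qed

lemma locally_conic_const: "locally_conic \<Gamma> (\<lambda>_. c)"
  unfolding locally_conic_def by (intro ballI exI[of _ 1] conjI exI[of _ 0]) (auto intro!: exI[of _ 0])

abbreviation principal_divisors :: "'a metric \<Rightarrow> ('a \<Rightarrow>\<^sub>0 int) set" where
  "principal_divisors \<Gamma> \<equiv> Laplacian \<Gamma> ` PL_int \<Gamma>"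

lemma principal_keys:
  assumes "D \<in> principal_divisors \<Gamma>" shows "Poly_Mapping.keys D \<subseteq> mspace \<Gamma>"
proof -
  obtain f where f: "f \<in> PL_int \<Gamma>" "D = Laplacian \<Gamma> f" using assms by auto
  show ?thesis using lookup_Laplacian[OF f(1)] by (auto simp: f(2) in_keys_iff split: if_splits)
qed

lemma principal_degree:
  assumes "D \<in> principal_divisors \<Gamma>" shows "divisor_degree D = 0"
proof -
  obtain f where f: "f \<in> PL_int \<Gamma>" "D = Laplacian \<Gamma> f" using assms by auto
  let ?K = "Poly_Mapping.keys D"
  have K: "?K \<subseteq> mspace \<Gamma>" by (rule principal_keys[OF assms])
  have "divisor_degree D = - (\<Sum>x\<in>?K. outgoing_slope_sum \<Gamma> f x)"
    unfolding divisor_degree_def sum_negf[symmetric]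
    by (rule sum.cong) (use K f lookup_Laplacian[OF f(1)] in auto)
  also have "(\<Sum>x\<in>?K. outgoing_slope_sum \<Gamma> f x) = 0"
    by (rule sum_outgoing_slope_sum[OF f(1)]) (use K f lookup_Laplacian[OF f(1)] in \<open>auto simp: in_keys_iff\<close>)
  finally show ?thesis by simp
qed

context metric_graph_model
begin

lemma principal_subgroup: "additive_subgroup (principal_divisors \<Gamma>)"
proof
  have oss0: "outgoing_slope_sum \<Gamma> (\<lambda>_. 0) x = 0" if "x \<in> mspace \<Gamma>" for x
    by (rule outgoing_slope_sum_eqI) (use that in \<open>auto simp: PL_int_iff_locally_conic locally_conic_const sphere_sum_def\<close>)
  have "(\<lambda>_. 0) \<in> PL_int \<Gamma>" by (simp add: PL_int_iff_locally_conic locally_conic_const)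
  moreover from this have "Laplacian \<Gamma> (\<lambda>_. 0) = 0"
    by (intro poly_mapping_eqI) (simp add: lookup_Laplacian oss0)
  ultimately show "0 \<in> principal_divisors \<Gamma>" by (metis image_eqI)
next
  fix a b assume "a \<in> principal_divisors \<Gamma>" "b \<in> principal_divisors \<Gamma>"
  then obtain f g where f: "f \<in> PL_int \<Gamma>" "a = Laplacian \<Gamma> f" and g: "g \<in> PL_int \<Gamma>" "b = Laplacian \<Gamma> g" by auto
  have fg: "(\<lambda>x. f x - g x) \<in> PL_int \<Gamma>"
    using f(1) g(1) locally_conic_diff by (simp add: PL_int_iff_locally_conic)
  have "outgoing_slope_sum \<Gamma> (\<lambda>x. f x - g x) x = outgoing_slope_sum \<Gamma> f x - outgoing_slope_sum \<Gamma> g x"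
    if x: "x \<in> mspace \<Gamma>" for x
  proof (rule outgoing_slope_sum_eqI[OF fg x])
    show "\<forall>\<^sub>F r in at_right 0. sphere_sum \<Gamma> (\<lambda>x. f x - g x) x r
        = r * of_int (outgoing_slope_sum \<Gamma> f x - outgoing_slope_sum \<Gamma> g x)"
      using outgoing_slope_sum_sphere[OF f(1) x] outgoing_slope_sum_sphere[OF g(1) x]
      by eventually_elim (simp add: sphere_sum_diff algebra_simps)
  qed
  then have "Laplacian \<Gamma> (\<lambda>x. f x - g x) = a - b"
    by (intro poly_mapping_eqI) (simp add: lookup_Laplacian f g fg lookup_minus)
  then show "a - b \<in> principal_divisors \<Gamma>" using fg by (metis image_eqI)
qed

section \<open>Divisors of tents and stars\<close>

text \<open>\<open>\<phi>\<close> describes a function edge by edge and \<open>D\<close> its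
  outgoing slope sums; the minus sign in the conclusion is that of the Laplacian. All conditions can
  be checked on the edge functions, without a model on which the function is linear.\<close>

lemma principal_chartI:
  assumes PL: "\<And>e. e \<in> arcs G \<Longrightarrow> PL_interval (\<phi> e) (len e)"
    and ends: "\<And>e. e \<in> arcs G \<Longrightarrow> \<phi> e 0 = u (tail G e)" "\<And>e. e \<in> arcs G \<Longrightarrow> \<phi> e (len e) = u (head G e)"
    and D: "Poly_Mapping.keys D \<subseteq> mspace \<Gamma>"
    and vert: "\<And>v. v \<in> verts G \<Longrightarrow> \<forall>\<^sub>F r in at_right 0.
      (\<Sum>e\<in>out_arcs G v. \<phi> e r - \<phi> e 0) + (\<Sum>e\<in>in_arcs G v. \<phi> e (len e - r) - \<phi> e (len e))
        = r * of_int (Poly_Mapping.lookup D v)"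
    and inter: "\<And>e t. \<lbrakk>e \<in> arcs G; 0 < t; t < len e\<rbrakk> \<Longrightarrow> \<forall>\<^sub>F r in at_right 0.
      \<phi> e (t + r) + \<phi> e (t - r) - 2 * \<phi> e t = r * of_int (Poly_Mapping.lookup D (\<gamma> e t))"
  shows "- D \<in> principal_divisors \<Gamma>"
proof -
  obtain F where F: "\<And>v. v \<in> verts G \<Longrightarrow> F v = u v"
    "\<And>e t. \<lbrakk>e \<in> arcs G; 0 \<le> t; t \<le> len e\<rbrakk> \<Longrightarrow> F (\<gamma> e t) = \<phi> e t"
    using chart_function_exists[of \<phi> u, OF ends] by blast
  have FPL: "F \<in> PL_int \<Gamma>"
    by (rule PL_interval_imp_PL_int, rule PL_interval_cong[OF PL]) (use F(2) in auto)
  have "outgoing_slope_sum \<Gamma> F x = Poly_Mapping.lookup D x" if x: "x \<in> mspace \<Gamma>" for x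
  proof (rule outgoing_slope_sum_eqI[OF FPL x])
    from x show "\<forall>\<^sub>F r in at_right 0. sphere_sum \<Gamma> F x r = r * of_int (Poly_Mapping.lookup D x)"
    proof (cases rule: point_cases)
      case 1
      obtain \<rho> where \<rho>: "0 < \<rho>" "\<And>e. e \<in> arcs G \<Longrightarrow> 2 * \<rho> < len e" using small_radius by metis
      show ?thesis using vertex_sphere_sum[OF 1] vert[OF 1] eventually_at_right_less[OF \<rho>(1)]
      proof eventually_elim
        case (elim r)
        have "(\<Sum>e\<in>out_arcs G x. F (\<gamma> e r) - F x) = (\<Sum>e\<in>out_arcs G x. \<phi> e r - \<phi> e 0)"
        proof (rule sum.cong[OF HOL.refl])
          fix e assume "e \<in> out_arcs G x"
          then show "F (\<gamma> e r) - F x = \<phi> e r - \<phi> e 0"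
            using F(2)[of e r] F(1)[OF 1] ends(1)[of e] \<rho>(2)[of e] elim(3) by auto
        qed
        moreover have "(\<Sum>e\<in>in_arcs G x. F (\<gamma> e (len e - r)) - F x) = (\<Sum>e\<in>in_arcs G x. \<phi> e (len e - r) - \<phi> e (len e))"
        proof (rule sum.cong[OF HOL.refl])
          fix e assume "e \<in> in_arcs G x"
          then show "F (\<gamma> e (len e - r)) - F x = \<phi> e (len e - r) - \<phi> e (len e)"
            using F(2)[of e "len e - r"] F(1)[OF 1] ends(2)[of e] \<rho>(2)[of e] elim(3) by auto
        qed
        ultimately show ?case using spec[OF elim(1), of F] elim(2) by linarith
      qed
    next
      case (2 e t)
      show ?thesis unfolding 2(5)
        using interior_sphere_sum[OF 2(2-4)] inter[OF 2(2-4)] eventually_at_right_less[OF 2(3)]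
          eventually_at_right_less[of "len e - t", simplified, OF 2(4)]
      proof eventually_elim
        case (elim r)
        then show ?case using spec[OF elim(1), of F] F(2)[OF 2(2), of "t + r"] F(2)[OF 2(2), of "t - r"] F(2)[OF 2(2), of t] 2
          by simp
      qed
    qed
  qed
  then have "Laplacian \<Gamma> F = - D"
    using D by (intro poly_mapping_eqI) (auto simp: lookup_Laplacian[OF FPL] in_keys_iff)
  then show ?thesis using FPL by (metis image_eqI)
qed

text \<open>The tent \<open>\<tau>\<close> has slopes 0, 1, -1, 0, hence bends by 1, -2, 1 at foot,
  top and foot. So two points of an edge are together congruent to twice their midpoint, which
  forces additivity along the edge.\<close>

lemma midpoint_principal:
  assumes e: "e \<in> arcs G" and a: "0 \<le> a" "0 < h" "a + 2 * h \<le> len e"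
  shows "frag_of (\<gamma> e a) + frag_of (\<gamma> e (a + 2 * h)) - frag_cmul 2 (frag_of (\<gamma> e (a + h))) \<in> principal_divisors \<Gamma>"
proof -
  interpret H: additive_subgroup "principal_divisors \<Gamma>" by (rule principal_subgroup)
  define D where "D = frag_of (\<gamma> e a) + frag_of (\<gamma> e (a + 2 * h)) - frag_cmul 2 (frag_of (\<gamma> e (a + h)))"
  define \<tau> where "\<tau> t = max 0 (t - a) + (max 0 (t - (a + 2 * h)) + of_int (- 2) * max 0 (t - (a + h)))" for t :: real
  define \<phi> where "\<phi> f = (if f = e then \<tau> else (\<lambda>_. 0))" for f
  have lookup_D: "Poly_Mapping.lookup D x = of_bool (x = \<gamma> e a) + of_bool (x = \<gamma> e (a + 2 * h)) - 2 * of_bool (x = \<gamma> e (a + h))" for x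
    by (simp add: D_def lookup_add lookup_minus)
  have "- D \<in> principal_divisors \<Gamma>"
  proof (rule principal_chartI[where \<phi> = \<phi> and u = "\<lambda>_. 0"])
    fix f assume "f \<in> arcs G"
    have "PL_interval (\<lambda>t. 0) (len f)" using PL_interval_cmul[OF PL_interval_ramp_up, of 0] by simp
    moreover have "PL_interval \<tau> (len f)" unfolding \<tau>_def
      by (intro PL_interval_add PL_interval_cmul PL_interval_ramp_up)
    ultimately show "PL_interval (\<phi> f) (len f)" by (auto simp: \<phi>_def)
    show "\<phi> f 0 = 0" "\<phi> f (len f) = 0" using a by (auto simp: \<phi>_def \<tau>_def)
  next
    show "Poly_Mapping.keys D \<subseteq> mspace \<Gamma>"
    proof (rule subsetI, rule ccontr)
      fix x assume x: "x \<in> Poly_Mapping.keys D" "x \<notin> mspace \<Gamma>"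
      have "\<gamma> e a \<in> mspace \<Gamma>" "\<gamma> e (a + h) \<in> mspace \<Gamma>" "\<gamma> e (a + 2 * h) \<in> mspace \<Gamma>"
        using a by (auto intro!: chart_in_mspace[OF e])
      then have "x \<noteq> \<gamma> e a" "x \<noteq> \<gamma> e (a + h)" "x \<noteq> \<gamma> e (a + 2 * h)" using x(2) by auto
      then show False using x(1) by (simp add: in_keys_iff lookup_D)
    qed
  next
    fix v assume v: "v \<in> verts G"
    have "a + h < len e" "0 < a + h" using a by linarith+
    then have mid: "v \<noteq> \<gamma> e (a + h)" using chart_interior_in[OF e] v by blast
    have va: "v = \<gamma> e a \<longleftrightarrow> a = 0 \<and> tail G e = v"
      using chart_interior_in[OF e, of a] v chart_tail[OF e] a by fastforce
    have vb: "v = \<gamma> e (a + 2 * h) \<longleftrightarrow> a + 2 * h = len e \<and> head G e = v"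
      using chart_interior_in[OF e, of "a + 2 * h"] v chart_head[OF e] a by fastforce
    \<comment> \<open>Within this distance of an end of \<open>e\<close>, the tent has no bend
      except a foot placed exactly at that end; \<open>h\<close> keeps the top out of reach.\<close>
    define \<rho> where "\<rho> = min h (min (if a = 0 then h else a) (if a + 2 * h = len e then h else len e - (a + 2 * h)))"
    have \<rho>: "0 < \<rho>" using a by (auto simp: \<rho>_def)
    show "\<forall>\<^sub>F r in at_right 0. (\<Sum>f\<in>out_arcs G v. \<phi> f r - \<phi> f 0) + (\<Sum>f\<in>in_arcs G v. \<phi> f (len f - r) - \<phi> f (len f))
        = r * of_int (Poly_Mapping.lookup D v)"
      using eventually_at_right_less[OF \<rho>]
    proof eventually_elim
      case (elim r)
      have "(\<Sum>f\<in>out_arcs G v. \<phi> f r - \<phi> f 0) = (\<Sum>f\<in>out_arcs G v. if f = e then r * of_bool (a = 0) else 0)"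
        by (rule sum.cong) (use elim a in \<open>auto simp: \<phi>_def \<tau>_def \<rho>_def\<close>)
      also have "\<dots> = r * of_bool (v = \<gamma> e a)" unfolding va using e by (simp add: finite_out_arcs)
      finally have 1: "(\<Sum>f\<in>out_arcs G v. \<phi> f r - \<phi> f 0) = r * of_bool (v = \<gamma> e a)" .
      have "(\<Sum>f\<in>in_arcs G v. \<phi> f (len f - r) - \<phi> f (len f))
          = (\<Sum>f\<in>in_arcs G v. if f = e then r * of_bool (a + 2 * h = len e) else 0)"
        by (rule sum.cong) (use elim a in \<open>auto simp: \<phi>_def \<tau>_def \<rho>_def split: if_splits\<close>)
      also have "\<dots> = r * of_bool (v = \<gamma> e (a + 2 * h))" unfolding vb using e by (simp add: finite_in_arcs)
      finally show ?case using 1 mid by (simp add: lookup_D algebra_simps)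
    qed
  next
    fix f t assume f: "f \<in> arcs G" "0 < t" "t < len f"
    have "\<gamma> f t = \<gamma> e s \<longleftrightarrow> f = e \<and> t = s" if "0 \<le> s" "s \<le> len e" for s
      using chart_eq_cases[of f t e s] e f that by auto
    then have L: "Poly_Mapping.lookup D (\<gamma> f t) =
        of_bool (f = e \<and> t = a) + of_bool (f = e \<and> t = a + 2 * h) - 2 * of_bool (f = e \<and> t = a + h)"
      using a by (simp add: lookup_D)
    show "\<forall>\<^sub>F r in at_right 0. \<phi> f (t + r) + \<phi> f (t - r) - 2 * \<phi> f t = r * of_int (Poly_Mapping.lookup D (\<gamma> f t))"
    proof (cases "f = e")
      case True
      show ?thesis unfolding L
        using eventually_ramp_up_second_difference[of t a] eventually_ramp_up_second_difference[of t "a + 2 * h"]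
          eventually_ramp_up_second_difference[of t "a + h"]
      proof eventually_elim
        case (elim r)
        have "\<phi> f (t + r) + \<phi> f (t - r) - 2 * \<phi> f t = r * of_bool (t = a) + r * of_bool (t = a + 2 * h) - 2 * (r * of_bool (t = a + h))"
          unfolding elim[symmetric] using True by (simp add: \<phi>_def \<tau>_def algebra_simps)
        then show ?case using True by (simp add: algebra_simps)
      qed
    next
      case False
      then show ?thesis by (simp add: L \<phi>_def)
    qed
  qed
  from H.minus_mem[OF this] have "D \<in> principal_divisors \<Gamma>" by simp
  then show ?thesis unfolding D_def .
qed

text \<open>The function has height \<open>\<epsilon>\<close> at \<open>v\<close> and falls with
  slope 1 along each half-edge. It bends by 1 at each foot and by -1 per half-edge at
  \<open>v\<close>; the bound on \<open>\<epsilon>\<close> keeps the two descents on a loop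
  apart.\<close>

lemma star_principal:
  assumes v: "v \<in> verts G" and \<epsilon>: "0 < \<epsilon>" "\<And>e. e \<in> arcs G \<Longrightarrow> 2 * \<epsilon> < len e"
  shows "(\<Sum>e\<in>out_arcs G v. frag_of (\<gamma> e \<epsilon>) - frag_of v) + (\<Sum>e\<in>in_arcs G v. frag_of (\<gamma> e (len e - \<epsilon>)) - frag_of v)
    \<in> principal_divisors \<Gamma>"
proof -
  interpret H: additive_subgroup "principal_divisors \<Gamma>" by (rule principal_subgroup)
  define D where "D = (\<Sum>e\<in>out_arcs G v. frag_of (\<gamma> e \<epsilon>) - frag_of v) + (\<Sum>e\<in>in_arcs G v. frag_of (\<gamma> e (len e - \<epsilon>)) - frag_of v)"
  define \<phi> where "\<phi> e t = of_int (of_bool (tail G e = v)) * max 0 (\<epsilon> - t)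
    + of_int (of_bool (head G e = v)) * max 0 (t - (len e - \<epsilon>))" for e t
  have lookup_D: "Poly_Mapping.lookup D x =
      (\<Sum>e\<in>out_arcs G v. of_bool (x = \<gamma> e \<epsilon>) - of_bool (x = v)) + (\<Sum>e\<in>in_arcs G v. of_bool (x = \<gamma> e (len e - \<epsilon>)) - of_bool (x = v))" for x
    unfolding D_def lookup_add lookup_sum lookup_minus by (auto intro!: sum.cong arg_cong2[of _ _ _ _ "(+)"])
  have int\<epsilon>: "\<gamma> e \<epsilon> \<in> mspace \<Gamma> - verts G" "\<gamma> e (len e - \<epsilon>) \<in> mspace \<Gamma> - verts G" if "e \<in> arcs G" for e
    using chart_interior_in[OF that, of \<epsilon>] chart_interior_in[OF that, of "len e - \<epsilon>"] \<epsilon>(1) \<epsilon>(2)[OF that] by auto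
  have "- D \<in> principal_divisors \<Gamma>"
  proof (rule principal_chartI[where \<phi> = \<phi> and u = "\<lambda>x. \<epsilon> * of_bool (x = v)"])
    fix e assume e: "e \<in> arcs G"
    show "PL_interval (\<phi> e) (len e)" unfolding \<phi>_def
      by (intro PL_interval_add PL_interval_cmul PL_interval_ramp_up PL_interval_ramp_down)
    show "\<phi> e 0 = \<epsilon> * of_bool (tail G e = v)" "\<phi> e (len e) = \<epsilon> * of_bool (head G e = v)"
      using \<epsilon>(1) \<epsilon>(2)[OF e] by (auto simp: \<phi>_def)
  next
    have "Poly_Mapping.lookup D x = 0" if "x \<notin> mspace \<Gamma>" for x
    proof -
      have "x \<noteq> v" using that v verts_subset by blast
      moreover have "x \<noteq> \<gamma> e \<epsilon>" "x \<noteq> \<gamma> e (len e - \<epsilon>)" if "e \<in> arcs G" for e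
        using int\<epsilon>[OF that] \<open>x \<notin> mspace \<Gamma>\<close> by auto
      ultimately show ?thesis by (simp add: lookup_D)
    qed
    then show "Poly_Mapping.keys D \<subseteq> mspace \<Gamma>" by (auto simp: in_keys_iff)
  next
    fix x assume x: "x \<in> verts G"
    have lx: "Poly_Mapping.lookup D x = (\<Sum>e\<in>out_arcs G v. - of_bool (x = v)) + (\<Sum>e\<in>in_arcs G v. - of_bool (x = v))"
    proof -
      have "x \<noteq> \<gamma> e \<epsilon>" "x \<noteq> \<gamma> e (len e - \<epsilon>)" if "e \<in> arcs G" for e using int\<epsilon>[OF that] x by auto
      then show ?thesis by (simp add: lookup_D)
    qed
    show "\<forall>\<^sub>F r in at_right 0. (\<Sum>e\<in>out_arcs G x. \<phi> e r - \<phi> e 0) + (\<Sum>e\<in>in_arcs G x. \<phi> e (len e - r) - \<phi> e (len e))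
        = r * of_int (Poly_Mapping.lookup D x)"
      using eventually_at_right_less[OF \<epsilon>(1)]
    proof eventually_elim
      case (elim r)
      have "(\<Sum>e\<in>out_arcs G x. \<phi> e r - \<phi> e 0) = (\<Sum>e\<in>out_arcs G x. r * of_int (- of_bool (x = v)))"
      proof (rule sum.cong[OF HOL.refl])
        fix e assume "e \<in> out_arcs G x"
        then show "\<phi> e r - \<phi> e 0 = r * of_int (- of_bool (x = v))"
          using elim \<epsilon>(1) \<epsilon>(2)[of e] by (auto simp: \<phi>_def)
      qed
      moreover have "(\<Sum>e\<in>in_arcs G x. \<phi> e (len e - r) - \<phi> e (len e)) = (\<Sum>e\<in>in_arcs G x. r * of_int (- of_bool (x = v)))"
      proof (rule sum.cong[OF HOL.refl])
        fix e assume "e \<in> in_arcs G x"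
        then show "\<phi> e (len e - r) - \<phi> e (len e) = r * of_int (- of_bool (x = v))"
          using elim \<epsilon>(1) \<epsilon>(2)[of e] by (auto simp: \<phi>_def)
      qed
      ultimately show ?case unfolding lx by (cases "x = v") (simp_all add: algebra_simps)
    qed
  next
    fix e t assume e: "e \<in> arcs G" "0 < t" "t < len e"
    have eq: "\<gamma> e t = \<gamma> f s \<longleftrightarrow> f = e \<and> t = s" if "f \<in> arcs G" "0 \<le> s" "s \<le> len f" for f s
      using chart_eq_cases[of e t f s] e that by auto
    have "\<gamma> e t \<noteq> v" using chart_interior_in[OF e] v by blast
    then have "Poly_Mapping.lookup D (\<gamma> e t) = (\<Sum>f\<in>out_arcs G v. of_bool (\<gamma> e t = \<gamma> f \<epsilon>)) + (\<Sum>f\<in>in_arcs G v. of_bool (\<gamma> e t = \<gamma> f (len f - \<epsilon>)))"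
      by (simp add: lookup_D)
    also have "(\<Sum>f\<in>out_arcs G v. of_bool (\<gamma> e t = \<gamma> f \<epsilon>)) = (\<Sum>f\<in>out_arcs G v. if f = e then of_bool (t = \<epsilon>) else 0 :: int)"
    proof (rule sum.cong[OF HOL.refl])
      fix f assume "f \<in> out_arcs G v"
      then show "of_bool (\<gamma> e t = \<gamma> f \<epsilon>) = (if f = e then of_bool (t = \<epsilon>) else 0 :: int)"
        using eq[of f \<epsilon>] \<epsilon>(1) \<epsilon>(2)[of f] by auto
    qed
    also have "\<dots> = of_bool (tail G e = v) * of_bool (t = \<epsilon>)" using e by (simp add: finite_out_arcs)
    also have "(\<Sum>f\<in>in_arcs G v. of_bool (\<gamma> e t = \<gamma> f (len f - \<epsilon>))) = (\<Sum>f\<in>in_arcs G v. if f = e then of_bool (t = len e - \<epsilon>) else 0 :: int)"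
    proof (rule sum.cong[OF HOL.refl])
      fix f assume "f \<in> in_arcs G v"
      then show "of_bool (\<gamma> e t = \<gamma> f (len f - \<epsilon>)) = (if f = e then of_bool (t = len e - \<epsilon>) else 0 :: int)"
        using eq[of f "len f - \<epsilon>"] \<epsilon>(1) \<epsilon>(2)[of f] by auto
    qed
    also have "\<dots> = of_bool (head G e = v) * of_bool (t = len e - \<epsilon>)" using e by (simp add: finite_in_arcs)
    finally have L: "Poly_Mapping.lookup D (\<gamma> e t) = of_bool (tail G e = v) * of_bool (t = \<epsilon>) + of_bool (head G e = v) * of_bool (t = len e - \<epsilon>)" .
    show "\<forall>\<^sub>F r in at_right 0. \<phi> e (t + r) + \<phi> e (t - r) - 2 * \<phi> e t = r * of_int (Poly_Mapping.lookup D (\<gamma> e t))"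
      unfolding L
      using eventually_ramp_down_second_difference[of \<epsilon> t] eventually_ramp_up_second_difference[of t "len e - \<epsilon>"]
    proof eventually_elim
      case (elim r)
      have "\<phi> e (t + r) + \<phi> e (t - r) - 2 * \<phi> e t = of_bool (tail G e = v) * (r * of_bool (t = \<epsilon>)) + of_bool (head G e = v) * (r * of_bool (t = len e - \<epsilon>))"
        unfolding elim[symmetric] by (simp add: \<phi>_def algebra_simps)
      then show ?case by (simp add: algebra_simps)
    qed
  qed
  from H.minus_mem[OF this] have "D \<in> principal_divisors \<Gamma>" by simp
  then show ?thesis unfolding D_def .
qed

end


section \<open>The Jacobian\<close>

locale frag_subgroup = additive_subgroup H for H :: "('a \<Rightarrow>\<^sub>0 int) set"
begin

lemma frag_cmul_mem:
  assumes "D \<in> H" shows "frag_cmul k D \<in> H"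
proof -
  have nat: "frag_cmul (int n) D \<in> H" for n
  proof (induction n)
    case (Suc n)
    from add_mem[OF this assms] show ?case by (simp add: frag_cmul_distrib add.commute)
  qed (simp add: zero_mem)
  show ?thesis
  proof (cases "0 \<le> k")
    case True
    then show ?thesis using nat[of "nat k"] by simp
  next
    case False
    then show ?thesis using minus_mem[OF nat[of "nat (- k)"]] by simp
  qed
qed

text \<open>No condition on the degree or the support is imposed, so the notion applies to arbitrary
  representatives on a curve and to their differences alike.\<close>

definition torsion_mod :: "('a \<Rightarrow>\<^sub>0 int) \<Rightarrow> bool" where
  "torsion_mod D \<longleftrightarrow> (\<exists>n::nat. 0 < n \<and> frag_cmul (int n) D \<in> H)"

definition coset :: "('a \<Rightarrow>\<^sub>0 int) \<Rightarrow> ('a \<Rightarrow>\<^sub>0 int) set" where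
  "coset D = (\<lambda>h. h + D) ` H"

lemma mem_coset_iff: "x \<in> coset D \<longleftrightarrow> x - D \<in> H"
  unfolding coset_def by (auto intro!: image_eqI[of _ _ "x - D"])

lemma coset_eq_iff: "coset D = coset D' \<longleftrightarrow> D - D' \<in> H"
proof
  assume "coset D = coset D'"
  moreover have "D \<in> coset D" using zero_mem by (simp add: mem_coset_iff)
  ultimately show "D - D' \<in> H" by (simp add: mem_coset_iff)
next
  assume D: "D - D' \<in> H"
  have "x - D \<in> H \<longleftrightarrow> x - D' \<in> H" for x
    using add_cancel_mem[OF D, of "x - D"] by simp
  then show "coset D = coset D'" by (auto simp: mem_coset_iff)
qed

lemma frag_cmul_diff2: "frag_cmul k (a - b) = frag_cmul k a - frag_cmul k b"
  by (rule poly_mapping_eqI) (simp add: lookup_minus algebra_simps)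

lemma torsion_mod_diff:
  assumes "torsion_mod a" "torsion_mod b" shows "torsion_mod (a - b)"
proof -
  obtain m n :: nat where mn: "0 < m" "0 < n" "frag_cmul (int m) a \<in> H" "frag_cmul (int n) b \<in> H"
    using assms by (auto simp: torsion_mod_def)
  from diff_mem[OF frag_cmul_mem[OF mn(3), of "int n"] frag_cmul_mem[OF mn(4), of "int m"]]
  have "frag_cmul (int (m * n)) (a - b) \<in> H" by (simp add: frag_cmul_diff2 mult.commute)
  then show ?thesis using mn unfolding torsion_mod_def by (intro exI[of _ "m * n"]) simp
qed

lemma torsion_mod_mem: "a \<in> H \<Longrightarrow> torsion_mod a"
  unfolding torsion_mod_def by (intro exI[of _ 1]) simp

lemma torsion_mod_cong: "a - b \<in> H \<Longrightarrow> torsion_mod b \<Longrightarrow> torsion_mod a"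
  using torsion_mod_diff[OF torsion_mod_mem torsion_mod_diff[OF torsion_mod_mem[OF zero_mem]], of "a - b" b] by simp

lemma torsion_mod_cmul: "torsion_mod a \<Longrightarrow> torsion_mod (frag_cmul k a)"
  unfolding torsion_mod_def using frag_cmul_mem by (metis frag_cmul_cmul mult.commute)

text \<open>This lets torsion pass from a long step along a curve to the equal short steps of which
  it is composed.\<close>

lemma torsion_mod_divide:
  assumes "torsion_mod (frag_cmul (int n) a)" "0 < n" shows "torsion_mod a"
proof -
  obtain m :: nat where "0 < m" "frag_cmul (int m) (frag_cmul (int n) a) \<in> H"
    using assms by (auto simp: torsion_mod_def)
  then show ?thesis using assms(2) unfolding torsion_mod_def by (intro exI[of _ "m * n"]) simp
qed

lemma hom_mod_nat_mult:
  assumes "hom_mod \<phi>" shows "\<phi> (real n * s) - frag_cmul (int n) (\<phi> s) \<in> H"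
proof (induction n)
  case (Suc n)
  from add_mem[OF Suc hom_modD[OF assms, of "real n * s" s]]
  show ?case by (simp add: algebra_simps frag_cmul_distrib)
qed (simp add: hom_mod_zero[OF assms])

text \<open>The torsion points in arithmetic progression between two given ones represent at most \<open>N\<close>
  classes, so by pigeonhole the common difference has order at most \<open>N\<close>. Since the given points
  are \<open>N!\<close> steps apart, they represent the same class.\<close>
lemma torsion_on_curve_unique:
  assumes hom: "hom_mod \<phi>" and "finite Q"
    and Q: "\<And>t. \<lbrakk>t \<in> {0..l}; torsion_mod (p + \<phi> t)\<rbrakk> \<Longrightarrow> coset (p + \<phi> t) \<in> Q"
    and t: "t\<^sub>1 \<in> {0..l}" "t\<^sub>2 \<in> {0..l}" and tor: "torsion_mod (p + \<phi> t\<^sub>1)" "torsion_mod (p + \<phi> t\<^sub>2)"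
  shows "\<phi> t\<^sub>2 - \<phi> t\<^sub>1 \<in> H"
proof -
  define N where "N = card Q"
  \<comment> \<open>The factorial is divisible by every order up to \<open>N\<close>, and being at
    least \<open>N\<close> it leaves room for the \<open>N + 1\<close> points \<open>P 0\<close>,
    ..., \<open>P N\<close> between the given ones.\<close>
  define K :: nat where "K = fact N"
  have K: "0 < K" "N \<le> K" by (simp_all add: K_def fact_ge_self)
  define s where "s = (t\<^sub>2 - t\<^sub>1) / real K"
  have Ks: "real K * s = t\<^sub>2 - t\<^sub>1" using K by (simp add: s_def)
  have full: "\<phi> t\<^sub>2 - \<phi> t\<^sub>1 - frag_cmul (int K) (\<phi> s) \<in> H"
    using diff_mem[OF hom_mod_nat_mult[OF hom, of K s, unfolded Ks] hom_mod_diff[OF hom, of t\<^sub>2 t\<^sub>1]]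
    by (simp add: algebra_simps)
  have "torsion_mod (\<phi> t\<^sub>2 - \<phi> t\<^sub>1)" using torsion_mod_diff[OF tor(2,1)] by simp
  then have "torsion_mod (frag_cmul (int K) (\<phi> s))"
    using minus_mem[OF full] by (intro torsion_mod_cong[of "frag_cmul (int K) (\<phi> s)" "\<phi> t\<^sub>2 - \<phi> t\<^sub>1"]) simp_all
  then have tor_s: "torsion_mod (\<phi> s)" using torsion_mod_divide K(1) by blast
  define P where "P j = p + \<phi> (t\<^sub>1 + real j * s)" for j :: nat
  have P: "P j - (p + \<phi> t\<^sub>1) - frag_cmul (int j) (\<phi> s) \<in> H" for j
    using add_mem[OF hom_modD[OF hom, of t\<^sub>1 "real j * s"] hom_mod_nat_mult[OF hom, of j s]]
    by (simp add: P_def algebra_simps)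
  have "coset (P j) \<in> Q" if "j \<le> N" for j
    unfolding P_def
  proof (rule Q)
    define u where "u = real j / real K"
    have "0 \<le> u" "u \<le> 1" using that K by (auto simp: u_def)
    moreover have "real j * s = u * (t\<^sub>2 - t\<^sub>1)" by (simp add: s_def u_def)
    then have "t\<^sub>1 + real j * s = (1 - u) * t\<^sub>1 + u * t\<^sub>2" by (simp add: algebra_simps)
    ultimately show "t\<^sub>1 + real j * s \<in> {0..l}"
      using convexD_alt[OF convex_real_interval(5)[of 0 l] t, of u] by simp
    have "torsion_mod (P j - (p + \<phi> t\<^sub>1))"
      by (rule torsion_mod_cong[OF P torsion_mod_cmul[OF tor_s]])
    from torsion_mod_diff[OF this torsion_mod_diff[OF torsion_mod_mem[OF zero_mem] tor(1)]]
    show "torsion_mod (p + \<phi> (t\<^sub>1 + real j * s))" by (simp add: P_def add.commute)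
  qed
  then have "(\<lambda>j. coset (P j)) ` {0..N} \<subseteq> Q" by auto
  then have "card ((\<lambda>j. coset (P j)) ` {0..N}) < card {0..N}"
    using card_mono[OF \<open>finite Q\<close>] by (simp add: N_def less_Suc_eq_le)
  then have "\<not> inj_on (\<lambda>j. coset (P j)) {0..N}" by (rule pigeonhole)
  then obtain i j where "i \<le> N" "j \<le> N" "i \<noteq> j" "coset (P i) = coset (P j)" by (auto simp: inj_on_def)
  then obtain i j where ij: "i < j" "j \<le> N" "coset (P j) = coset (P i)" by (metis linorder_neqE_nat)
  then have "P j - P i \<in> H" by (simp add: coset_eq_iff)
  from add_mem[OF diff_mem[OF this P[of j]] P[of i]]
  have "frag_cmul (int j) (\<phi> s) - frag_cmul (int i) (\<phi> s) \<in> H"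
    by (simp add: algebra_simps)
  then have step: "frag_cmul (int (j - i)) (\<phi> s) \<in> H" using ij(1) by (simp add: frag_cmul_diff_distrib of_nat_diff)
  have "(j - i) dvd K" unfolding K_def using ij by (intro dvd_fact) auto
  then obtain k where "K = (j - i) * k" by auto
  then have "frag_cmul (int K) (\<phi> s) \<in> H" using frag_cmul_mem[OF step, of "int k"] by (simp add: mult.commute)
  from add_mem[OF full this] show ?thesis by simp
qed

text \<open>At \<open>k * L + u\<close> the map \<open>\<psi>\<close> is \<open>k\<close> full
  increments of \<open>c\<close> plus the increment from 0 to \<open>u\<close>, and the
  parallelogram law makes this additive. Extending to all reals spares domain conditions in every
  later use of additivity.\<close>

lemma parallelogram_hom:
  assumes L: "0 < L"
    and par: "\<And>s t s' t'. \<lbrakk>s \<in> {0..L}; t \<in> {0..L}; s' \<in> {0..L}; t' \<in> {0..L}; s + t = s' + t'\<rbrakk> \<Longrightarrow> c s + c t - c s' - c t' \<in> H"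
  shows "\<exists>\<psi>. hom_mod \<psi> \<and> (\<forall>t\<in>{0..L}. c t - c 0 - \<psi> t \<in> H)"
proof -
  define fl where "fl t = \<lfloor>t / L\<rfloor>" for t
  define rem where "rem t = t - L * of_int (fl t)" for t
  define \<psi> where "\<psi> t = frag_cmul (fl t) (c L - c 0) + c (rem t) - c 0" for t
  have rem: "0 \<le> rem t" "rem t < L" for t
  proof -
    have "of_int (fl t) \<le> t / L" "t / L < of_int (fl t) + 1" unfolding fl_def by linarith+
    then have "of_int (fl t) * L \<le> t" "t < (of_int (fl t) + 1) * L" using L by (simp_all add: field_simps)
    then show "0 \<le> rem t" "rem t < L" by (simp_all add: rem_def algebra_simps)
  qed
  have unique: "fl t = k \<and> rem t = u" if "t = L * of_int k + u" "0 \<le> u" "u < L" for t k u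
  proof -
    have "t / L = of_int k + u / L" using that L by (simp add: field_simps)
    then have "fl t = k" unfolding fl_def using that L by (intro floor_unique) auto
    then show ?thesis using that by (simp add: rem_def)
  qed
  have split: "t = L * of_int (fl t) + rem t" for t by (simp add: rem_def)
  have "\<psi> (s + t) - \<psi> s - \<psi> t \<in> H" for s t
  proof (cases "rem s + rem t < L")
    case True
    have eq: "fl (s + t) = fl s + fl t \<and> rem (s + t) = rem s + rem t"
      by (rule unique) (use split[of s] split[of t] rem[of s] rem[of t] True in \<open>auto simp: algebra_simps\<close>)
    have "c (rem s + rem t) + c 0 - c (rem s) - c (rem t) \<in> H"
      by (rule par) (use rem[of s] rem[of t] True L in auto)
    then show ?thesis unfolding \<psi>_def eq[THEN conjunct1] eq[THEN conjunct2]
      by (simp add: frag_cmul_distrib algebra_simps)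
  next
    \<comment> \<open>The remainders carry over; the law now compares their pair with
      \<open>L\<close> and the reduced sum.\<close>
    case False
    have eq: "fl (s + t) = fl s + fl t + 1 \<and> rem (s + t) = rem s + rem t - L"
      by (rule unique) (use split[of s] split[of t] rem[of s] rem[of t] False in \<open>auto simp: algebra_simps\<close>)
    have "c L + c (rem s + rem t - L) - c (rem s) - c (rem t) \<in> H"
      by (rule par) (use rem[of s] rem[of t] False L in auto)
    then show ?thesis unfolding \<psi>_def eq[THEN conjunct1] eq[THEN conjunct2]
      by (simp add: frag_cmul_distrib algebra_simps)
  qed
  then have "hom_mod \<psi>" by (simp add: hom_mod_def)
  moreover have "c t - c 0 - \<psi> t \<in> H" if "t \<in> {0..L}" for t
  proof (cases "t = L")
    \<comment> \<open>The end \<open>L\<close> itself counts as one full period with remainder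
      0.\<close>
    case True
    then have "fl t = 1 \<and> rem t = 0" using L by (intro unique) auto
    then show ?thesis using True zero_mem by (simp add: \<psi>_def)
  next
    case False
    then have "fl t = 0 \<and> rem t = t" using that by (intro unique) auto
    then show ?thesis using zero_mem by (simp add: \<psi>_def)
  qed
  ultimately show ?thesis by blast
qed

end

section \<open>Degree-zero divisors and torsion in the Jacobian\<close>

lemma divisor_degree_superset:
  assumes "finite A" "Poly_Mapping.keys D \<subseteq> A"
  shows "divisor_degree D = (\<Sum>x\<in>A. Poly_Mapping.lookup D x)"
  unfolding divisor_degree_def
  by (rule sum.mono_neutral_left) (use assms in \<open>auto simp: in_keys_iff\<close>)

lemma divisor_degree_add: "divisor_degree (a + b) = divisor_degree a + divisor_degree b"
proof -
  let ?A = "Poly_Mapping.keys a \<union> Poly_Mapping.keys b"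
  have "divisor_degree (a + b) = (\<Sum>x\<in>?A. Poly_Mapping.lookup (a + b) x)"
    by (rule divisor_degree_superset) (use keys_add[of a b] in auto)
  also have "\<dots> = divisor_degree a + divisor_degree b"
    using divisor_degree_superset[of ?A a] divisor_degree_superset[of ?A b] by (simp add: lookup_add sum.distrib)
  finally show ?thesis .
qed

lemma divisor_degree_uminus: "divisor_degree (- a) = - divisor_degree a"
  by (simp add: divisor_degree_def sum_negf)

lemma divisor_degree_cmul: "divisor_degree (frag_cmul k a) = k * divisor_degree a"
proof -
  have "divisor_degree (frag_cmul k a) = (\<Sum>x\<in>Poly_Mapping.keys a. Poly_Mapping.lookup (frag_cmul k a) x)"
    by (rule divisor_degree_superset) (use keys_cmul in auto)
  then show ?thesis by (simp add: divisor_degree_def sum_distrib_left)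
qed

lemma Div0_simps [simp]:
  "D \<in> carrier (Div0 \<Gamma>) \<longleftrightarrow> Poly_Mapping.keys D \<subseteq> mspace \<Gamma> \<and> divisor_degree D = 0"
  "a \<otimes>\<^bsub>Div0 \<Gamma>\<^esub> b = a + b" "\<one>\<^bsub>Div0 \<Gamma>\<^esub> = 0"
  by (simp_all add: Div0_def Div_def free_Abelian_group_def)

lemma comm_group_Div0: "comm_group (Div0 \<Gamma>)"
proof (rule comm_groupI)
  fix x y assume "x \<in> carrier (Div0 \<Gamma>)" "y \<in> carrier (Div0 \<Gamma>)"
  then show "x \<otimes>\<^bsub>Div0 \<Gamma>\<^esub> y \<in> carrier (Div0 \<Gamma>)" using keys_add[of x y] by (auto simp: divisor_degree_add)
next
  fix x assume "x \<in> carrier (Div0 \<Gamma>)"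
  then show "\<exists>y\<in>carrier (Div0 \<Gamma>). y \<otimes>\<^bsub>Div0 \<Gamma>\<^esub> x = \<one>\<^bsub>Div0 \<Gamma>\<^esub>"
    by (intro bexI[of _ "- x"]) (auto simp: divisor_degree_uminus)
qed (auto simp: divisor_degree_def add.commute add.left_commute)

context metric_graph_model
begin

lemma principal_frag_subgroup: "frag_subgroup (principal_divisors \<Gamma>)"
  unfolding frag_subgroup_def by (rule principal_subgroup)

lemma divisor_class_eq_coset: "divisor_class \<Gamma> D = frag_subgroup.coset (principal_divisors \<Gamma>) D"
  unfolding divisor_class_def r_coset_def frag_subgroup.coset_def[OF principal_frag_subgroup] by auto

lemma principal_normal: "principal_divisors \<Gamma> \<lhd> Div0 \<Gamma>"
proof -
  interpret H: additive_subgroup "principal_divisors \<Gamma>" by (rule principal_subgroup)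
  interpret D: comm_group "Div0 \<Gamma>" by (rule comm_group_Div0)
  have "subgroup (principal_divisors \<Gamma>) (Div0 \<Gamma>)"
  proof
    show sub: "principal_divisors \<Gamma> \<subseteq> carrier (Div0 \<Gamma>)"
    proof
      fix x assume "x \<in> principal_divisors \<Gamma>"
      from principal_keys[OF this] principal_degree[OF this] show "x \<in> carrier (Div0 \<Gamma>)" by simp
    qed
    fix x assume x: "x \<in> principal_divisors \<Gamma>"
    have "x \<in> carrier (Div0 \<Gamma>)" "- x \<in> carrier (Div0 \<Gamma>)" using sub x H.minus_mem[OF x] by blast+
    then have "inv\<^bsub>Div0 \<Gamma>\<^esub> x = - x" by (intro D.inv_equality) simp_all
    then show "inv\<^bsub>Div0 \<Gamma>\<^esub> x \<in> principal_divisors \<Gamma>" using H.minus_mem[OF x] by (simp only:)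
    fix y assume "y \<in> principal_divisors \<Gamma>"
    from H.add_mem[OF x this] show "x \<otimes>\<^bsub>Div0 \<Gamma>\<^esub> y \<in> principal_divisors \<Gamma>" by (simp only: Div0_simps)
  next
    show "\<one>\<^bsub>Div0 \<Gamma>\<^esub> \<in> principal_divisors \<Gamma>" using H.zero_mem by (simp only: Div0_simps)
  qed
  then show ?thesis by (rule D.subgroup_imp_normal)
qed

lemma divisor_class_pow:
  assumes D: "D \<in> carrier (Div0 \<Gamma>)"
  shows "divisor_class \<Gamma> D [^]\<^bsub>Jac \<Gamma>\<^esub> n = divisor_class \<Gamma> (frag_cmul (int n) D)"
proof -
  interpret N: normal "principal_divisors \<Gamma>" "Div0 \<Gamma>" by (rule principal_normal)
  show ?thesis
  proof (induction n)
    case 0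
    have "divisor_class \<Gamma> 0 = principal_divisors \<Gamma>" by (simp add: divisor_class_def r_coset_def)
    then show ?case by (simp add: Jac_def FactGroup_def)
  next
    case (Suc n)
    have "frag_cmul (int n) D \<in> carrier (Div0 \<Gamma>)" using D by (auto simp: divisor_degree_cmul)
    from N.rcos_sum[OF this D] Suc show ?case
      by (simp add: Jac_def FactGroup_def divisor_class_def frag_cmul_distrib add.commute)
  qed
qed

lemma divisor_class_torsion_iff:
  assumes D: "D \<in> carrier (Div0 \<Gamma>)"
  shows "divisor_class \<Gamma> D \<in> torsion_elements (Jac \<Gamma>) \<longleftrightarrow> frag_subgroup.torsion_mod (principal_divisors \<Gamma>) D"
proof -
  interpret H: frag_subgroup "principal_divisors \<Gamma>" by (rule principal_frag_subgroup)
  have carrier: "divisor_class \<Gamma> D \<in> carrier (Jac \<Gamma>)"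
    using D by (auto simp: Jac_def FactGroup_def divisor_class_def RCOSETS_def)
  have one: "\<one>\<^bsub>Jac \<Gamma>\<^esub> = H.coset 0" by (simp add: Jac_def FactGroup_def H.coset_def)
  have "divisor_class \<Gamma> D [^]\<^bsub>Jac \<Gamma>\<^esub> n = \<one>\<^bsub>Jac \<Gamma>\<^esub> \<longleftrightarrow> frag_cmul (int n) D \<in> principal_divisors \<Gamma>" for n :: nat
    by (subst divisor_class_pow[OF D]) (simp add: one divisor_class_eq_coset H.coset_eq_iff)
  then show ?thesis using carrier by (simp add: torsion_elements_def H.torsion_mod_def)
qed

section \<open>From a model to a graph of curves\<close>

text \<open>Both pairs have the same midpoint, and each is congruent to twice that point, by a tent
  unless its two points coincide.\<close>

lemma chart_parallelogram:
  assumes e: "e \<in> arcs G" and st: "s \<in> {0..len e}" "t \<in> {0..len e}" "s' \<in> {0..len e}" "t' \<in> {0..len e}" "s + t = s' + t'"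
  shows "frag_of (\<gamma> e s) + frag_of (\<gamma> e t) - frag_of (\<gamma> e s') - frag_of (\<gamma> e t') \<in> principal_divisors \<Gamma>"
proof -
  interpret H: frag_subgroup "principal_divisors \<Gamma>" by (rule principal_frag_subgroup)
  have less: "frag_of (\<gamma> e s) + frag_of (\<gamma> e t) - frag_cmul 2 (frag_of (\<gamma> e ((s + t) / 2))) \<in> principal_divisors \<Gamma>"
    if "0 \<le> s" "s < t" "t \<le> len e" for s t
    using midpoint_principal[OF e, of s "(t - s) / 2"] that by (simp add: field_simps)
  have mid: "frag_of (\<gamma> e s) + frag_of (\<gamma> e t) - frag_cmul 2 (frag_of (\<gamma> e ((s + t) / 2))) \<in> principal_divisors \<Gamma>"
    if "s \<in> {0..len e}" "t \<in> {0..len e}" for s t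
  proof -
    consider "s < t" | "t < s" | "s = t" by linarith
    then show ?thesis
    proof cases
      case 3
      have "frag_of (\<gamma> e s) + frag_of (\<gamma> e s) = frag_cmul 2 (frag_of (\<gamma> e s))"
        by (rule poly_mapping_eqI) (simp add: lookup_add)
      then show ?thesis using 3 H.zero_mem by (simp only: diff_self add_divide_distrib field_sum_of_halves)
    qed (use less[of s t] less[of t s] that in \<open>auto simp: add.commute\<close>)
  qed
  have "frag_of (\<gamma> e s) + frag_of (\<gamma> e t) - frag_cmul 2 (frag_of (\<gamma> e ((s' + t') / 2))) \<in> principal_divisors \<Gamma>"
    using mid[OF st(1,2)] st(5) by (simp only:)
  from H.diff_mem[OF this mid[OF st(3,4)]] show ?thesis by (simp only: diff_diff_eq2 diff_add_eq add_diff_cancel diff_diff_eq)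
qed

text \<open>The Boolean \<open>True\<close> stands for the tail. From the head an edge is run
  backwards, which for an additive map amounts to \<open>- \<psi> e\<close>, so that
  \<open>reverse\<close> is an exact identity. The relation at a vertex is the star divisor
  rewritten through the charts.\<close>

lemma curve_graph_of_model:
  "\<exists>\<psi>. curve_graph (principal_divisors \<Gamma>) (verts G) (arcs G) (\<lambda>e b. if b then tail G e else head G e) len
      (\<lambda>e b t. if b then \<psi> e t else - \<psi> e t) frag_of \<and>
    (\<forall>e\<in>arcs G. \<forall>t\<in>{0..len e}. frag_of (\<gamma> e t) - frag_of (tail G e) - \<psi> e t \<in> principal_divisors \<Gamma>)"
proof -
  interpret H: frag_subgroup "principal_divisors \<Gamma>" by (rule principal_frag_subgroup)
  have "\<forall>e\<in>arcs G. \<exists>\<psi>. H.hom_mod \<psi> \<and> (\<forall>t\<in>{0..len e}. frag_of (\<gamma> e t) - frag_of (\<gamma> e 0) - \<psi> t \<in> principal_divisors \<Gamma>)"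
  proof
    fix e assume e: "e \<in> arcs G"
    show "\<exists>\<psi>. H.hom_mod \<psi> \<and> (\<forall>t\<in>{0..len e}. frag_of (\<gamma> e t) - frag_of (\<gamma> e 0) - \<psi> t \<in> principal_divisors \<Gamma>)"
      by (rule H.parallelogram_hom[OF len_pos[OF e], of "\<lambda>t. frag_of (\<gamma> e t)"]) (rule chart_parallelogram[OF e])
  qed
  from bchoice[OF this] obtain \<psi> where "\<forall>e\<in>arcs G. H.hom_mod (\<psi> e) \<and>
      (\<forall>t\<in>{0..len e}. frag_of (\<gamma> e t) - frag_of (\<gamma> e 0) - \<psi> e t \<in> principal_divisors \<Gamma>)" by (rule exE)
  then have hom: "\<And>e. e \<in> arcs G \<Longrightarrow> H.hom_mod (\<psi> e)"
    and chart: "\<And>e t. \<lbrakk>e \<in> arcs G; t \<in> {0..len e}\<rbrakk> \<Longrightarrow> frag_of (\<gamma> e t) - frag_of (tail G e) - \<psi> e t \<in> principal_divisors \<Gamma>"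
    using chart_tail by auto
  have head: "frag_of (head G e) - frag_of (tail G e) - \<psi> e (len e) \<in> principal_divisors \<Gamma>" if "e \<in> arcs G" for e
    using chart[OF that, of "len e"] chart_head[OF that] len_pos[OF that] by simp
  have kirchhoff: "(\<Sum>e\<in>out_arcs G v. \<psi> e t) + (\<Sum>e\<in>in_arcs G v. - \<psi> e t) \<in> principal_divisors \<Gamma>"
    if v: "v \<in> verts G" for v t
  proof -
    obtain \<rho> where \<rho>: "0 < \<rho>" "\<And>e. e \<in> arcs G \<Longrightarrow> 2 * \<rho> < len e" using small_radius by metis
    let ?\<Psi> = "\<lambda>t. (\<Sum>e\<in>out_arcs G v. \<psi> e t) + (\<Sum>e\<in>in_arcs G v. - \<psi> e t)"
    have homs: "H.hom_mod (\<lambda>t. \<Sum>e\<in>out_arcs G v. \<psi> e t)" "H.hom_mod (\<lambda>t. \<Sum>e\<in>in_arcs G v. - \<psi> e t)"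
      by (intro H.hom_mod_sum H.hom_mod_uminus hom; simp)+

    have "?\<Psi> (s + t) - ?\<Psi> s - ?\<Psi> t \<in> principal_divisors \<Gamma>" for s t
      using H.add_mem[OF H.hom_modD[OF homs(1), of s t] H.hom_modD[OF homs(2), of s t]] by (simp add: algebra_simps)
    then have "H.hom_mod ?\<Psi>" unfolding H.hom_mod_def by blast
    \<comment> \<open>Stars are available for small \<open>\<epsilon>\<close> only; additivity then
      gives triviality on all reals.\<close>
    moreover have "?\<Psi> \<epsilon> \<in> principal_divisors \<Gamma>" if \<epsilon>: "0 < \<epsilon>" "\<epsilon> < \<rho>" for \<epsilon>
    proof -
      have small: "2 * \<epsilon> < len e" if "e \<in> arcs G" for e using \<rho>(2)[OF that] \<epsilon> by linarith
      have out: "frag_of (\<gamma> e \<epsilon>) - frag_of v - \<psi> e \<epsilon> \<in> principal_divisors \<Gamma>" if "e \<in> out_arcs G v" for e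
        using chart[of e \<epsilon>] small[of e] that \<epsilon> by auto
      have inn: "frag_of (\<gamma> e (len e - \<epsilon>)) - frag_of v - (- \<psi> e \<epsilon>) \<in> principal_divisors \<Gamma>" if "e \<in> in_arcs G v" for e
      proof -
        have e: "e \<in> arcs G" "head G e = v" using that by auto
        have c: "frag_of (\<gamma> e (len e - \<epsilon>)) - frag_of (tail G e) - \<psi> e (len e - \<epsilon>) \<in> principal_divisors \<Gamma>"
          using chart[OF e(1), of "len e - \<epsilon>"] small[OF e(1)] \<epsilon> by simp
        \<comment> \<open>Subtracting the increment of the whole edge moves the base point from the
          tail to the head and leaves \<open>- \<psi> e \<epsilon>\<close>.\<close>
        from H.add_mem[OF H.diff_mem[OF c head[OF e(1)]] H.hom_mod_diff[OF hom[OF e(1)], of "len e" \<epsilon>]]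
        show ?thesis unfolding e(2) by (simp add: algebra_simps)
      qed
      have "(\<Sum>e\<in>out_arcs G v. frag_of (\<gamma> e \<epsilon>) - frag_of v) + (\<Sum>e\<in>in_arcs G v. frag_of (\<gamma> e (len e - \<epsilon>)) - frag_of v) - ?\<Psi> \<epsilon>
        = (\<Sum>e\<in>out_arcs G v. frag_of (\<gamma> e \<epsilon>) - frag_of v - \<psi> e \<epsilon>) + (\<Sum>e\<in>in_arcs G v. frag_of (\<gamma> e (len e - \<epsilon>)) - frag_of v - (- \<psi> e \<epsilon>))"
        by (simp only: sum_subtractf add_diff_add)
      also have "\<dots> \<in> principal_divisors \<Gamma>" by (intro H.add_mem H.sum_mem out inn)
      finally have diff: "(\<Sum>e\<in>out_arcs G v. frag_of (\<gamma> e \<epsilon>) - frag_of v)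
        + (\<Sum>e\<in>in_arcs G v. frag_of (\<gamma> e (len e - \<epsilon>)) - frag_of v) - ?\<Psi> \<epsilon> \<in> principal_divisors \<Gamma>" .
      show ?thesis by (rule H.mem_of_diff_mem[OF star_principal[OF v \<epsilon>(1) small] diff])
    qed
    ultimately show ?thesis by (rule H.hom_mod_trivial[OF _ \<rho>(1)])
  qed
  have "curve_graph (principal_divisors \<Gamma>) (verts G) (arcs G) (\<lambda>e b. if b then tail G e else head G e) len
      (\<lambda>e b t. if b then \<psi> e t else - \<psi> e t) frag_of"
  proof
    fix S assume S: "S \<subseteq> verts G" "S \<noteq> {}"
      and closed: "\<And>e b. e \<in> arcs G \<Longrightarrow> (if b then tail G e else head G e) \<in> S \<Longrightarrow> (if \<not> b then tail G e else head G e) \<in> S"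
    show "S = verts G"
    proof (rule connected_closed[OF S])
      fix e assume "e \<in> arcs G"
      from closed[OF this, of True] closed[OF this, of False] show "tail G e \<in> S \<longleftrightarrow> head G e \<in> S" by auto
    qed
  next
    fix e b assume "e \<in> arcs G"
    then show "H.hom_mod ((\<lambda>t. if b then \<psi> e t else - \<psi> e t))" using hom H.hom_mod_uminus by (cases b) auto
  next
    fix e b assume "e \<in> arcs G"
    then show "frag_of (if \<not> b then tail G e else head G e) - frag_of (if b then tail G e else head G e)
        - (if b then \<psi> e (len e) else - \<psi> e (len e)) \<in> principal_divisors \<Gamma>"
      using head[of e] H.minus_mem[OF head[of e]] by (cases b) (auto simp: algebra_simps)
  next
    fix v t assume v: "v \<in> verts G"
    have "{x \<in> arcs G \<times> UNIV. (if snd x then tail G (fst x) else head G (fst x)) = v}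
        = (\<lambda>e. (e, True)) ` out_arcs G v \<union> (\<lambda>e. (e, False)) ` in_arcs G v"
      by (auto simp: image_iff split: if_splits)
    moreover have "(\<Sum>(e, b)\<in>(\<lambda>e. (e, True)) ` out_arcs G v \<union> (\<lambda>e. (e, False)) ` in_arcs G v. if b then \<psi> e t else - \<psi> e t)
        = (\<Sum>e\<in>out_arcs G v. \<psi> e t) + (\<Sum>e\<in>in_arcs G v. - \<psi> e t)"
      by (subst sum.union_disjoint) (auto simp: finite_out_arcs finite_in_arcs sum.reindex inj_on_def)
    ultimately show "(\<Sum>(e, b)\<in>{x \<in> arcs G \<times> UNIV. (if snd x then tail G (fst x) else head G (fst x)) = v}.
        if b then \<psi> e t else - \<psi> e t) \<in> principal_divisors \<Gamma>"
      using kirchhoff[OF v, of t] by (simp only:)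
  qed (use len_pos H.zero_mem in auto)
  then show ?thesis using chart by (intro exI[of _ \<psi>] conjI ballI)
qed

end

theorem theorem1p1:
  fixes \<Gamma> :: "'a metric" and G :: "('a, 'e) pre_digraph"
    and len :: "'e \<Rightarrow> real" and \<gamma> :: "'e \<Rightarrow> real \<Rightarrow> 'a" and q :: 'a
  assumes "metric_graph_model \<Gamma> G len \<gamma>"
    and "genus G \<ge> 2"
    and "q \<in> mspace \<Gamma>"
    and "finite (Abel_Jacobi \<Gamma> q ` mspace \<Gamma> \<inter> torsion_elements (Jac \<Gamma>))"
  shows "int (card (Abel_Jacobi \<Gamma> q ` mspace \<Gamma> \<inter> torsion_elements (Jac \<Gamma>))) \<le> 3 * genus G - 3"
proof -
  interpret metric_graph_model \<Gamma> G len \<gamma> by fact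
  interpret H: frag_subgroup "principal_divisors \<Gamma>" by (rule principal_frag_subgroup)
  define T where "T = Abel_Jacobi \<Gamma> q ` mspace \<Gamma> \<inter> torsion_elements (Jac \<Gamma>)"
  have AJ: "Abel_Jacobi \<Gamma> q x = H.coset (frag_of x - frag_of q)" for x
    by (simp add: Abel_Jacobi_def divisor_class_eq_coset)
  have torsion: "Abel_Jacobi \<Gamma> q x \<in> torsion_elements (Jac \<Gamma>) \<longleftrightarrow> H.torsion_mod (frag_of x - frag_of q)"
    if x: "x \<in> mspace \<Gamma>" for x
    unfolding Abel_Jacobi_def
  proof (rule divisor_class_torsion_iff)
    have "divisor_degree (frag_of x + - frag_of q) = 0"
      unfolding divisor_degree_add divisor_degree_uminus by (simp add: divisor_degree_def)
    then show "frag_of x - frag_of q \<in> carrier (Div0 \<Gamma>)"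
      using x assms(3) keys_diff[of "frag_of x" "frag_of q"] by auto
  qed
  from curve_graph_of_model
  obtain \<psi> where \<psi>: "curve_graph (principal_divisors \<Gamma>) (verts G) (arcs G) (\<lambda>e b. if b then tail G e else head G e) len
      (\<lambda>e b t. if b then \<psi> e t else - \<psi> e t) frag_of \<and>
    (\<forall>e\<in>arcs G. \<forall>t\<in>{0..len e}. frag_of (\<gamma> e t) - frag_of (tail G e) - \<psi> e t \<in> principal_divisors \<Gamma>)"
    by (rule exE)
  then have chart: "\<And>e t. \<lbrakk>e \<in> arcs G; t \<in> {0..len e}\<rbrakk> \<Longrightarrow> frag_of (\<gamma> e t) - frag_of (tail G e) - \<psi> e t \<in> principal_divisors \<Gamma>"
    by blast
  from \<psi> interpret C: curve_graph "principal_divisors \<Gamma>" "verts G" "arcs G" "\<lambda>e b. if b then tail G e else head G e" len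
    "\<lambda>e b t. if b then \<psi> e t else - \<psi> e t" frag_of by simp
  have genus: "Suc (card (verts G)) \<le> card (arcs G)" using assms(2) by (simp add: genus_def)
  from curve_graph_cover[OF C.curve_graph_axioms genus]
  obtain \<C> where cover: "finite \<C> \<and> card \<C> + 3 * card (verts G) \<le> 3 * card (arcs G) \<and>
    (\<forall>C\<in>\<C>. \<exists>p \<phi> l. H.hom_mod \<phi> \<and> C = H.curve p \<phi> l) \<and> \<Union>\<C> = (\<Union>e\<in>arcs G. C.edge_curve e)"
    by (rule exE)
  note \<C> = cover[THEN conjunct1] cover[THEN conjunct2, THEN conjunct1]
    cover[THEN conjunct2, THEN conjunct2, THEN conjunct1] cover[THEN conjunct2, THEN conjunct2, THEN conjunct2]
  have point_on_curve: "\<exists>C\<in>\<C>. frag_of x \<in> C" if x: "x \<in> mspace \<Gamma>" for x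
  proof -
    have "\<exists>e\<in>arcs G. frag_of x \<in> C.edge_curve e"
      using x
    proof (cases rule: point_cases)
      case 1
      have "arcs G \<noteq> {}" using genus by auto
      then obtain h where "h \<in> C.half_edges x" using C.ex_half_edge[OF _ 1] by blast
      then have h: "fst h \<in> arcs G" "(if snd h then tail G (fst h) else head G (fst h)) = x"
        by (auto simp: C.half_edges_def)
      have "frag_of x \<in> C.edge_curve (fst h)" using C.pos_mem_edge_curve[OF h(1), of "snd h"] unfolding h(2) .
      then show ?thesis using h(1) by blast
    next
      case (2 e t)
      then have "frag_of x \<in> C.edge_curve e"
        using chart[of e t] by (auto simp: C.edge_curve_def H.curve_def intro!: bexI[of _ t])
      then show ?thesis using 2(2) by blast
    qed
    then show ?thesis using \<C>(4) by blast
  qed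
  \<comment> \<open>Every class on a covering curve comes from a point of \<Gamma>. Torsion classes
    found on such a curve therefore lie in \<open>T\<close>, and the assumed finiteness applies to
    them.\<close>
  have curve_on_graph: "\<exists>x\<in>mspace \<Gamma>. z - frag_of x \<in> principal_divisors \<Gamma>" if "z \<in> C" "C \<in> \<C>" for z C
  proof -
    have "z \<in> \<Union>\<C>" using that(2,1) by (rule UnionI)
    then obtain e where e: "e \<in> arcs G" "z \<in> C.edge_curve e" unfolding \<C>(4) by (rule UN_E)
    then obtain t where t: "t \<in> {0..len e}" "z - frag_of (tail G e) - \<psi> e t \<in> principal_divisors \<Gamma>"
      by (auto simp: C.edge_curve_def H.curve_def)
    from H.diff_mem[OF t(2) chart[OF e(1) t(1)]] have "z - frag_of (\<gamma> e t) \<in> principal_divisors \<Gamma>" by simp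
    then show ?thesis using chart_in_mspace[OF e(1), of t] t(1) by auto
  qed
  \<comment> \<open>Each torsion class is assigned one covering curve that carries it; injectivity
    of this choice bounds the count by the number of curves.\<close>
  have "\<forall>\<tau>\<in>T. \<exists>C. C \<in> \<C> \<and> (\<exists>x\<in>mspace \<Gamma>. \<tau> = Abel_Jacobi \<Gamma> q x \<and> frag_of x \<in> C)"
    using point_on_curve unfolding T_def by blast
  from bchoice[OF this] obtain \<kappa> where
    "\<forall>\<tau>\<in>T. \<kappa> \<tau> \<in> \<C> \<and> (\<exists>x\<in>mspace \<Gamma>. \<tau> = Abel_Jacobi \<Gamma> q x \<and> frag_of x \<in> \<kappa> \<tau>)" by (rule exE)
  then have \<kappa>: "\<And>\<tau>. \<tau> \<in> T \<Longrightarrow> \<kappa> \<tau> \<in> \<C>"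
    "\<And>\<tau>. \<tau> \<in> T \<Longrightarrow> \<exists>x\<in>mspace \<Gamma>. \<tau> = Abel_Jacobi \<Gamma> q x \<and> frag_of x \<in> \<kappa> \<tau>" by blast+
  have "inj_on \<kappa> T"
  proof (rule inj_onI)
    fix \<tau> \<tau>' assume T: "\<tau> \<in> T" "\<tau>' \<in> T" and eq: "\<kappa> \<tau> = \<kappa> \<tau>'"
    obtain x where x: "x \<in> mspace \<Gamma>" "\<tau> = Abel_Jacobi \<Gamma> q x" "frag_of x \<in> \<kappa> \<tau>" using \<kappa>(2)[OF T(1)] by blast
    obtain y where y: "y \<in> mspace \<Gamma>" "\<tau>' = Abel_Jacobi \<Gamma> q y" "frag_of y \<in> \<kappa> \<tau>" using \<kappa>(2)[OF T(2)] eq by auto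
    obtain p \<phi> l where hom: "H.hom_mod \<phi>" and C: "\<kappa> \<tau> = H.curve p \<phi> l" using \<C>(3) \<kappa>(1)[OF T(1)] by blast
    obtain t\<^sub>1 where t1: "t\<^sub>1 \<in> {0..l}" "frag_of x - p - \<phi> t\<^sub>1 \<in> principal_divisors \<Gamma>" using x(3) C by (auto simp: H.curve_def)
    obtain t\<^sub>2 where t2: "t\<^sub>2 \<in> {0..l}" "frag_of y - p - \<phi> t\<^sub>2 \<in> principal_divisors \<Gamma>" using y(3) C by (auto simp: H.curve_def)
    have "\<phi> t\<^sub>2 - \<phi> t\<^sub>1 \<in> principal_divisors \<Gamma>"
    \<comment> \<open>The starting point is shifted by \<open>- frag_of q\<close>, which turns
      points of the curve into Abel-Jacobi images.\<close>
    proof (rule H.torsion_on_curve_unique[OF hom, of T l "p - frag_of q"])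
      show "finite T" using assms(4) by (simp add: T_def)
      fix t assume t: "t \<in> {0..l}" "H.torsion_mod (p - frag_of q + \<phi> t)"
      have "p + \<phi> t \<in> \<kappa> \<tau>" unfolding C H.curve_def using t(1) H.zero_mem by (auto intro!: bexI[of _ t])
      then obtain w where w: "w \<in> mspace \<Gamma>" "p + \<phi> t - frag_of w \<in> principal_divisors \<Gamma>"
        using curve_on_graph[OF _ \<kappa>(1)[OF T(1)]] by blast
      have pw: "(p - frag_of q + \<phi> t) - (frag_of w - frag_of q) \<in> principal_divisors \<Gamma>"
        using w(2) by (simp add: algebra_simps)
      then have "H.coset (p - frag_of q + \<phi> t) = Abel_Jacobi \<Gamma> q w" by (simp add: AJ H.coset_eq_iff)
      moreover have "H.torsion_mod (frag_of w - frag_of q)"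
        using H.torsion_mod_cong[OF _ t(2)] H.minus_mem[OF pw] by simp
      ultimately show "H.coset (p - frag_of q + \<phi> t) \<in> T" using w(1) torsion by (simp add: T_def)
    next
      show "H.torsion_mod (p - frag_of q + \<phi> t\<^sub>1)"
      proof (rule H.torsion_mod_cong)
        show "p - frag_of q + \<phi> t\<^sub>1 - (frag_of x - frag_of q) \<in> principal_divisors \<Gamma>"
          using H.minus_mem[OF t1(2)] by (simp add: algebra_simps)
        show "H.torsion_mod (frag_of x - frag_of q)" using T(1) x torsion by (simp add: T_def)
      qed
      show "H.torsion_mod (p - frag_of q + \<phi> t\<^sub>2)"
      proof (rule H.torsion_mod_cong)
        show "p - frag_of q + \<phi> t\<^sub>2 - (frag_of y - frag_of q) \<in> principal_divisors \<Gamma>"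
          using H.minus_mem[OF t2(2)] by (simp add: algebra_simps)
        show "H.torsion_mod (frag_of y - frag_of q)" using T(2) y torsion by (simp add: T_def)
      qed
    qed (use t1 t2 in auto)
    from H.diff_mem[OF H.diff_mem[OF t1(2) t2(2)] this]
    have "frag_of x - frag_of y \<in> principal_divisors \<Gamma>" by (simp add: algebra_simps)
    then show "\<tau> = \<tau>'" by (simp add: x(2) y(2) AJ H.coset_eq_iff)
  qed
  then have "card T \<le> card \<C>" using \<kappa>(1) by (intro card_inj_on_le[of \<kappa>]) (auto simp: \<C>(1))
  then have "card T + 3 * card (verts G) \<le> 3 * card (arcs G)" using \<C>(2) by linarith
  then have "int (card T + 3 * card (verts G)) \<le> int (3 * card (arcs G))" by (simp only: of_nat_le_iff)
  then show ?thesis unfolding T_def[symmetric] genus_def by simp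
qed

end
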